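(* Let $\mathscr{A}=(\{\mathcal{A}_{s,t}\}_{0<s<t},\{\Delta_{r,s,t}\}_{0<r<s<t})$ be a co-unital $C^*$-subproduct system and $\{\varphi_{s,t}\}_{0<s<t}$ be a co-unit of $\mathscr{A}$. Consider the Tsirelson subproduct system of Hilbert spaces $\mathscr{H}_{\{\varphi_{s,t}\}}=(\{H_{s,t}\}_{0<s<t},\{V_{r,s,t}\}_{0<r<s<t})$ associated with $\{\varphi_{s,t}\}_{0<s<t}$, and let $\mathscr{H}^\sharp_{\{\varphi_{s,t}\}}$ be its Bhat-Mukherjee dilation. If $\mathscr{H}_{\{\varphi^\sharp_{s,t}\}}=(\{H'_{s,t}\}_{0<s<t},\{V'_{r,s,t}\}_{0<r<s<t})$ is the Tsirelson product system of Hilbert spaces associated with the co-unit dilation $\{\varphi^\sharp_{s,t}\}_{0<s<t}$ of $\{\varphi_{s,t}\}_{0<s<t}$, then $\mathscr{H}_{\{\varphi^\sharp_{s,t}\}}$ and $\mathscr{H}^\sharp_{\{\varphi_{s,t}\}}$ are isomorphic Tsirelson product systems of Hilbert spaces.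
   Context: All tensor products of $C^*$-algebras are injective (minimal) tensor products; $\mathrm{id}$ and $1$ denote identity maps; a $*$-monomorphism is an injective $*$-homomorphism. $C^*$-systems. A $C^*$-subproduct system is a pair $\mathscr{A}=(\{\mathcal{A}_{s,t}\}_{0<s<t},\{\Delta_{r,s,t}\}_{0<r<s<t})$ of $C^*$-algebras $\mathcal{A}_{s,t}$ and $*$-monomorphisms $\Delta_{r,s,t}:\mathcal{A}_{r,t}\to\mathcal{A}_{r,s}\otimes\mathcal{A}_{s,t}$ such that $(\mathrm{id}_{\mathcal{A}_{r,s}}\otimes\Delta_{s,t,u})\Delta_{r,s,u}=(\Delta_{r,s,t}\otimes\mathrm{id}_{\mathcal{A}_{t,u}})\Delta_{r,t,u}$ for all $0<r<s<t<u$; it is a $C^*$-product system if all $\Delta_{r,s,t}$ are $*$-isomorphisms. A co-unit of $\mathscr{A}$ is a family of states $\varphi_{s,t}$ of $\mathcal{A}_{s,t}$, $0<s<t$, with $\varphi_{r,t}=(\varphi_{r,s}\otimes\varphi_{s,t})\circ\Delta_{r,s,t}$ for all $0<r<s<t$; $\mathscr{A}$ is co-unital if it admits a co-unit. Hilbert space systems. A Tsirelson subproduct (resp. product) system of Hilbert spaces is a pair $(\{H_{s,t}\}_{0<s<t},\{U_{r,s,t}\}_{0<r<s<t})$ of Hilbert spaces and isometries (resp. unitaries) $U_{r,s,t}:H_{r,t}\to H_{r,s}\otimes H_{s,t}$ with $(1_{H_{r,s}}\otimes U_{s,t,u})U_{r,s,u}=(U_{r,s,t}\otimes1_{H_{t,u}})U_{r,t,u}$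 for all $0<r<s<t<u$. Two Tsirelson product systems $(\{H_{s,t}\},\{U_{r,s,t}\})$ and $(\{K_{s,t}\},\{W_{r,s,t}\})$ are isomorphic if there are unitaries $Z_{s,t}:H_{s,t}\to K_{s,t}$, $0<s<t$, with $(Z_{r,s}\otimes Z_{s,t})U_{r,s,t}=W_{r,s,t}Z_{r,t}$ for all $0<r<s<t$. System associated with a co-unit. For a state $\varphi$ of a $C^*$-algebra $\mathcal{A}$, with left kernel $\mathcal{N}_\varphi=\{x:\varphi(x^*x)=0\}$, let $\eta_\varphi(x)=x+\mathcal{N}_\varphi$; the GNS Hilbert space is the completion of $\mathcal{A}/\mathcal{N}_\varphi$ for $\langle\eta_\varphi(x),\eta_\varphi(y)\rangle=\varphi(y^*x)$. For a co-unit $\{\varphi_{s,t}\}$ of $\mathscr{A}$, the associated Tsirelson subproduct system $\mathscr{H}_{\{\varphi_{s,t}\}}$ consists of the GNS Hilbert spaces $H_{s,t}$ of $\varphi_{s,t}$ and the isometries $V_{r,s,t}:H_{r,t}\to H_{r,s}\otimes H_{s,t}$, $V_{r,s,t}\eta_{\varphi_{r,t}}(x)=\eta_{\varphi_{r,s}\otimes\varphi_{s,t}}(\Delta_{r,s,t}(x))$, $x\in\mathcal{A}_{r,t}$, where $H_{r,s}\otimes H_{s,t}$ is identified with the GNS space of $\varphi_{r,s}\otimes\varphi_{s,t}$ via $\eta_{\varphi_{r,s}}(x)\otimes\eta_{\varphi_{s,t}}(y)\mapsto\eta_{\varphi_{r,s}\otimes\varphi_{s,t}}(x\otimes y)$.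 It is a Tsirelson product system if $\mathscr{A}$ is a $C^*$-product system. Partitions. For $0<s<t$, $\mathcal{P}_{s,t}$ is the set, ordered by inclusion, of finite partitions $I=\{s=\iota_0<\iota_1<\dots<\iota_m<\iota_{m+1}=t\}$ of $[s,t]$ ($m\ge0$). For $I\subseteq J$ in $\mathcal{P}_{s,t}$ put $I_i=J\cap[\iota_i,\iota_{i+1}]$. Inductive dilation of $\mathscr{A}$. Put $\mathcal{A}_I=\mathcal{A}_{\iota_0,\iota_1}\otimes\cdots\otimes\mathcal{A}_{\iota_m,\iota_{m+1}}$. Define $\Delta_{\{s,t\},I}:\mathcal{A}_{s,t}\to\mathcal{A}_I$ as the identity if $m=0$, as $\Delta_{\iota_0,\iota_1,\iota_2}$ if $m=1$, and as $(\Delta_{\{\iota_0,\iota_m\},I\setminus\{\iota_{m+1}\}}\otimes\mathrm{id}_{\mathcal{A}_{\iota_m,\iota_{m+1}}})\Delta_{\iota_0,\iota_m,\iota_{m+1}}$ if $m\ge2$; for $I\subseteq J$ put $\Delta_{I,J}=\Delta_{\{\iota_0,\iota_1\},I_0}\otimes\cdots\otimes\Delta_{\{\iota_m,\iota_{m+1}\},I_m}:\mathcal{A}_I\to\mathcal{A}_J$. $\mathcal{A}^\sharp_{s,t}$ is the $C^*$-inductive limit of the inductive system $\{(\mathcal{A}_I,\Delta_{I,J})\,|\,I\subseteq J\in\mathcal{P}_{s,t}\}$, with connecting $*$-monomorphisms $\Delta^\sharp_I:\mathcal{A}_I\to\mathcal{A}^\sharp_{s,t}$; write $\Delta^\sharp_{s,t}=\Delta^\sharp_{\{s,t\}}$.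 For $0<r<s<t$, $\Delta^\sharp_{r,s,t}:\mathcal{A}^\sharp_{r,t}\to\mathcal{A}^\sharp_{r,s}\otimes\mathcal{A}^\sharp_{s,t}$ is the unique $*$-isomorphism with $\Delta^\sharp_{r,s,t}\Delta^\sharp_{I\cup J}=\Delta^\sharp_I\otimes\Delta^\sharp_J$ for all $I\in\mathcal{P}_{r,s}$, $J\in\mathcal{P}_{s,t}$. The pair $\mathscr{A}^\sharp=(\{\mathcal{A}^\sharp_{s,t}\},\{\Delta^\sharp_{r,s,t}\})$ is a $C^*$-product system. The co-unit dilation $\{\varphi^\sharp_{s,t}\}_{0<s<t}$ of $\{\varphi_{s,t}\}$ is the unique co-unit of $\mathscr{A}^\sharp$ with $\varphi^\sharp_{s,t}\circ\Delta^\sharp_{s,t}=\varphi_{s,t}$ for all $0<s<t$; it satisfies $\varphi^\sharp_{s,t}\circ\Delta^\sharp_I=\varphi_{\iota_0,\iota_1}\otimes\cdots\otimes\varphi_{\iota_m,\iota_{m+1}}$ for $I\in\mathcal{P}_{s,t}$. Bhat-Mukherjee dilation. For a Tsirelson subproduct system $\mathscr{H}=(\{H_{s,t}\},\{V_{r,s,t}\})$, put $H_I=H_{\iota_0,\iota_1}\otimes\cdots\otimes H_{\iota_m,\iota_{m+1}}$, and define isometries $V_{\{s,t\},I}:H_{s,t}\to H_I$ and $V_{I,J}:H_I\to H_J$ by the same formulas as $\Delta_{\{s,t\},I}$ and $\Delta_{I,J}$ with $V$ in place of $\Delta$ and identity operators in place of identity homomorphisms. $H^\sharp_{s,t}$ is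 the Hilbert space inductive limit of $\{(H_I,V_{I,J})\,|\,I\subseteq J\in\mathcal{P}_{s,t}\}$ with connecting isometries $V^\sharp_I:H_I\to H^\sharp_{s,t}$, and $V^\sharp_{r,s,t}:H^\sharp_{r,t}\to H^\sharp_{r,s}\otimes H^\sharp_{s,t}$ is the unique unitary with $V^\sharp_{r,s,t}V^\sharp_{I\cup J}=V^\sharp_I\otimes V^\sharp_J$ for all $I\in\mathcal{P}_{r,s}$, $J\in\mathcal{P}_{s,t}$. The Tsirelson product system $\mathscr{H}^\sharp=(\{H^\sharp_{s,t}\},\{V^\sharp_{r,s,t}\})$ is the Bhat-Mukherjee dilation of $\mathscr{H}$. *)

theory Defs
  imports "HOL-Analysis.Analysis"
begin

text \<open>
  Conventions.  Types do not depend on parameters, so a family of C*-algebras (Hilbert spaces)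
  is a family of C*-subalgebras (closed subspaces) of one ambient C*-algebra (Hilbert space) type,
  which is an arbitrary type of the respective class.  This loses no generality, because every
  family of C*-algebras embeds into its \<open>\<ell>\<^sup>\<infinity>\<close>-product and every family of Hilbert spaces into
  its \<open>\<ell>\<^sup>2\<close>-sum.  A map between such objects is a function on the ambient types of which only the
  values on the source matter.

  Objects that are determined up to canonical isomorphism (tensor products, GNS spaces, inductive
  limits) are given by an arbitrary realization, and maps that are uniquely determined by density
  and continuity (tensor products of maps) by their defining property.
\<close>

subsection \<open>C*-algebras and Hilbert spaces\<close>

class complex_vector = real_vector +
  fixes scaleC :: "complex \<Rightarrow> 'a \<Rightarrow> 'a" (infixr "*\<^sub>C" 75)
  assumes scaleC_add_right: "c *\<^sub>C (x + y) = c *\<^sub>C x + c *\<^sub>C y"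
    and scaleC_add_left: "(c + d) *\<^sub>C x = c *\<^sub>C x + d *\<^sub>C x"
    and scaleC_scaleC: "c *\<^sub>C d *\<^sub>C x = (c * d) *\<^sub>C x"
    and scaleR_scaleC: "r *\<^sub>R x = complex_of_real r *\<^sub>C x"

class complex_banach = complex_vector + real_normed_vector + complete_space +
  assumes norm_scaleC: "norm (c *\<^sub>C x) = cmod c * norm x"

class cstar_algebra = complex_banach + real_normed_algebra +
  fixes star :: "'a \<Rightarrow> 'a"
  assumes mult_scaleC_left: "(c *\<^sub>C x) * y = c *\<^sub>C (x * y)"
    and mult_scaleC_right: "x * (c *\<^sub>C y) = c *\<^sub>C (x * y)"
    and star_add: "star (x + y) = star x + star y"
    and star_scaleC: "star (c *\<^sub>C x) = cnj c *\<^sub>C star x"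
    and star_mult: "star (x * y) = star y * star x"
    and star_star: "star (star x) = x"
    and cstar_identity: "norm (star x * x) = (norm x)\<^sup>2"

text \<open>Inner products are linear in the first argument, as in \<open>\<langle>\<eta> x, \<eta> y\<rangle> = \<phi> (y\<^sup>* x)\<close>.\<close>

class hilbert_space = complex_banach +
  fixes cinner :: "'a \<Rightarrow> 'a \<Rightarrow> complex"
  assumes cinner_add_left: "cinner (x + y) z = cinner x z + cinner y z"
    and cinner_scaleC_left: "cinner (c *\<^sub>C x) y = c * cinner x y"
    and cinner_commute: "cinner x y = cnj (cinner y x)"
    and cinner_self: "cinner x x = complex_of_real ((norm x)\<^sup>2)"

definition closed_csubspace :: "'a::complex_banach set \<Rightarrow> bool" where
  "closed_csubspace S \<longleftrightarrow> closed S \<and> 0 \<in> S \<and> (\<forall>x\<in>S. \<forall>y\<in>S. x + y \<in> S) \<and> (\<forall>c. \<forall>x\<in>S. c *\<^sub>C x \<in> S)"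

definition cstar_subalgebra :: "'a::cstar_algebra set \<Rightarrow> bool" where
  "cstar_subalgebra S \<longleftrightarrow> closed_csubspace S \<and> (\<forall>x\<in>S. \<forall>y\<in>S. x * y \<in> S) \<and> (\<forall>x\<in>S. star x \<in> S)"

definition clinear_map :: "'a::complex_banach set \<Rightarrow> 'b::complex_banach set \<Rightarrow> ('a \<Rightarrow> 'b) \<Rightarrow> bool" where
  "clinear_map S T f \<longleftrightarrow> f ` S \<subseteq> T \<and> (\<forall>x\<in>S. \<forall>y\<in>S. f (x + y) = f x + f y)
     \<and> (\<forall>c. \<forall>x\<in>S. f (c *\<^sub>C x) = c *\<^sub>C f x)"

definition bounded_clinear_map :: "'a::complex_banach set \<Rightarrow> 'b::complex_banach set \<Rightarrow> ('a \<Rightarrow> 'b) \<Rightarrow> bool" where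
  "bounded_clinear_map S T f \<longleftrightarrow> clinear_map S T f \<and> (\<exists>M. \<forall>x\<in>S. norm (f x) \<le> M * norm x)"

definition isometry_map :: "'a::hilbert_space set \<Rightarrow> 'b::hilbert_space set \<Rightarrow> ('a \<Rightarrow> 'b) \<Rightarrow> bool" where
  "isometry_map S T f \<longleftrightarrow> clinear_map S T f \<and> (\<forall>x\<in>S. norm (f x) = norm x)"

definition unitary_map :: "'a::hilbert_space set \<Rightarrow> 'b::hilbert_space set \<Rightarrow> ('a \<Rightarrow> 'b) \<Rightarrow> bool" where
  "unitary_map S T f \<longleftrightarrow> isometry_map S T f \<and> f ` S = T"

definition star_hom :: "'a::cstar_algebra set \<Rightarrow> 'b::cstar_algebra set \<Rightarrow> ('a \<Rightarrow> 'b) \<Rightarrow> bool" where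
  "star_hom S T f \<longleftrightarrow> clinear_map S T f \<and> (\<forall>x\<in>S. \<forall>y\<in>S. f (x * y) = f x * f y)
     \<and> (\<forall>x\<in>S. f (star x) = star (f x))"

definition star_mono :: "'a::cstar_algebra set \<Rightarrow> 'b::cstar_algebra set \<Rightarrow> ('a \<Rightarrow> 'b) \<Rightarrow> bool" where
  "star_mono S T f \<longleftrightarrow> star_hom S T f \<and> inj_on f S"

definition star_iso :: "'a::cstar_algebra set \<Rightarrow> 'b::cstar_algebra set \<Rightarrow> ('a \<Rightarrow> 'b) \<Rightarrow> bool" where
  "star_iso S T f \<longleftrightarrow> star_hom S T f \<and> bij_betw f S T"

definition bounded_functional :: "'a::complex_banach set \<Rightarrow> ('a \<Rightarrow> complex) \<Rightarrow> bool" where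
  "bounded_functional S \<phi> \<longleftrightarrow> (\<forall>x\<in>S. \<forall>y\<in>S. \<phi> (x + y) = \<phi> x + \<phi> y)
     \<and> (\<forall>c. \<forall>x\<in>S. \<phi> (c *\<^sub>C x) = c * \<phi> x) \<and> (\<exists>M. \<forall>x\<in>S. cmod (\<phi> x) \<le> M * norm x)"

definition state :: "'a::cstar_algebra set \<Rightarrow> ('a \<Rightarrow> complex) \<Rightarrow> bool" where
  "state S \<phi> \<longleftrightarrow> bounded_functional S \<phi>
     \<and> (\<forall>x\<in>S. Im (\<phi> (star x * x)) = 0 \<and> Re (\<phi> (star x * x)) \<ge> 0)
     \<and> Sup {cmod (\<phi> x) |x. x \<in> S \<and> norm x \<le> 1} = 1"

text \<open>
  \<open>H\<close> is the completion of \<open>S / {x. \<phi> (x\<^sup>* x) = 0}\<close>; the inner product formula makes \<open>\<eta>\<close> factor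
  through an isometric embedding of this quotient.
\<close>

definition gns_space :: "'a::cstar_algebra set \<Rightarrow> ('a \<Rightarrow> complex) \<Rightarrow> 'h::hilbert_space set \<Rightarrow> ('a \<Rightarrow> 'h) \<Rightarrow> bool" where
  "gns_space S \<phi> H \<eta> \<longleftrightarrow> closed_csubspace H \<and> clinear_map S H \<eta>
     \<and> (\<forall>x\<in>S. \<forall>y\<in>S. cinner (\<eta> x) (\<eta> y) = \<phi> (star y * x)) \<and> closure (\<eta> ` S) = H"


subsection \<open>Tensor products\<close>

definition bilinear_map ::
  "'a::complex_banach set \<Rightarrow> 'a set \<Rightarrow> 'a set \<Rightarrow> ('a \<Rightarrow> 'a \<Rightarrow> 'a) \<Rightarrow> bool" where
  "bilinear_map A B T \<tau> \<longleftrightarrow> (\<forall>a\<in>A. clinear_map B T (\<tau> a)) \<and> (\<forall>b\<in>B. clinear_map A T (\<lambda>a. \<tau> a b))"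

definition tensor_sums :: "'a::complex_banach set \<Rightarrow> 'a set \<Rightarrow> ('a \<Rightarrow> 'a \<Rightarrow> 'a) \<Rightarrow> 'a set" where
  "tensor_sums A B \<tau> = {\<Sum>i<n. \<tau> (a i) (b i) |(n::nat) a b. \<forall>i<n. a i \<in> A \<and> b i \<in> B}"

definition hilbert_tensor ::
  "'h::hilbert_space set \<Rightarrow> 'h set \<Rightarrow> 'h set \<Rightarrow> ('h \<Rightarrow> 'h \<Rightarrow> 'h) \<Rightarrow> bool" where
  "hilbert_tensor H K L u \<longleftrightarrow> closed_csubspace L \<and> bilinear_map H K L u
     \<and> (\<forall>x\<in>H. \<forall>y\<in>K. \<forall>x'\<in>H. \<forall>y'\<in>K. cinner (u x y) (u x' y') = cinner x x' * cinner y y')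
     \<and> closure (tensor_sums H K u) = L"

definition ell2 :: "('i \<Rightarrow> complex) set" where
  "ell2 = {f. (\<lambda>i. (cmod (f i))\<^sup>2) summable_on UNIV}"

definition ell2_norm :: "('i \<Rightarrow> complex) \<Rightarrow> real" where
  "ell2_norm f = sqrt (\<Sum>\<^sub>\<infinity>i. (cmod (f i))\<^sup>2)"

definition ell2_inner :: "('i \<Rightarrow> complex) \<Rightarrow> ('i \<Rightarrow> complex) \<Rightarrow> complex" where
  "ell2_inner f g = (\<Sum>\<^sub>\<infinity>i. f i * cnj (g i))"

definition ell2_operator :: "(('i \<Rightarrow> complex) \<Rightarrow> ('i \<Rightarrow> complex)) \<Rightarrow> bool" where
  "ell2_operator F \<longleftrightarrow> F ` ell2 \<subseteq> ell2
     \<and> (\<forall>f\<in>ell2. \<forall>g\<in>ell2. F (\<lambda>i. f i + g i) = (\<lambda>i. F f i + F g i))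
     \<and> (\<forall>c. \<forall>f\<in>ell2. F (\<lambda>i. c * f i) = (\<lambda>i. c * F f i))
     \<and> (\<exists>M. \<forall>f\<in>ell2. ell2_norm (F f) \<le> M * ell2_norm f)"

text \<open>
  The representation may be degenerate, and its space is indexed by the ambient type \<open>'a\<close>.  Every
  C*-algebra \<open>S\<close> has such a representation: choosing for each \<open>x \<in> S\<close> a state \<open>\<phi>\<close> with
  \<open>\<phi> (x\<^sup>* x) = \<parallel>x\<parallel>\<^sup>2\<close>, the direct sum of the GNS representations has dimension at most \<open>|S|\<close>, because
  \<open>S\<close> is infinite unless it is \<open>{0}\<close>.
\<close>

definition faithful_rep ::
  "'a::cstar_algebra set \<Rightarrow> ('a \<Rightarrow> ('a \<Rightarrow> complex) \<Rightarrow> ('a \<Rightarrow> complex)) \<Rightarrow> bool" where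
  "faithful_rep S \<pi> \<longleftrightarrow> (\<forall>x\<in>S. ell2_operator (\<pi> x))
     \<and> (\<forall>x\<in>S. \<forall>y\<in>S. \<forall>f\<in>ell2. \<pi> (x + y) f = (\<lambda>i. \<pi> x f i + \<pi> y f i))
     \<and> (\<forall>c. \<forall>x\<in>S. \<forall>f\<in>ell2. \<pi> (c *\<^sub>C x) f = (\<lambda>i. c * \<pi> x f i))
     \<and> (\<forall>x\<in>S. \<forall>y\<in>S. \<forall>f\<in>ell2. \<pi> (x * y) f = \<pi> x (\<pi> y f))
     \<and> (\<forall>x\<in>S. \<forall>f\<in>ell2. \<forall>g\<in>ell2. ell2_inner (\<pi> (star x) f) g = ell2_inner f (\<pi> x g))
     \<and> (\<forall>x\<in>S. (\<forall>f\<in>ell2. \<pi> x f = (\<lambda>i. 0)) \<longrightarrow> x = 0)"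

text \<open>
  The norm of the operator \<open>\<Sum>i<n. \<pi> (a i) \<otimes> \<rho> (b i)\<close> on \<open>\<ell>\<^sup>2 \<otimes> \<ell>\<^sup>2 = \<ell>\<^sup>2('i \<times> 'i)\<close>, computed on the unit
  ball of the dense subspace of finite sums \<open>\<Sum>k<m. f k \<otimes> g k\<close>.
\<close>

definition spatial_norm ::
  "('a \<Rightarrow> ('i \<Rightarrow> complex) \<Rightarrow> ('i \<Rightarrow> complex)) \<Rightarrow> ('a \<Rightarrow> ('i \<Rightarrow> complex) \<Rightarrow> ('i \<Rightarrow> complex))
     \<Rightarrow> nat \<Rightarrow> (nat \<Rightarrow> 'a) \<Rightarrow> (nat \<Rightarrow> 'a) \<Rightarrow> real" where
  "spatial_norm \<pi> \<rho> n a b =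
     Sup {ell2_norm (\<lambda>(p, q). \<Sum>i<n. \<Sum>k<m. \<pi> (a i) (f k) p * \<rho> (b i) (g k) q) |(m::nat) f g.
            (\<forall>k<m. f k \<in> ell2 \<and> g k \<in> ell2) \<and> ell2_norm (\<lambda>(p, q). \<Sum>k<m. f k p * g k q) \<le> 1}"

definition min_tensor ::
  "'a::cstar_algebra set \<Rightarrow> 'a set \<Rightarrow> 'a set \<Rightarrow> ('a \<Rightarrow> 'a \<Rightarrow> 'a) \<Rightarrow> bool" where
  "min_tensor A B T \<tau> \<longleftrightarrow> cstar_subalgebra T \<and> bilinear_map A B T \<tau>
     \<and> (\<forall>a\<in>A. \<forall>b\<in>B. \<forall>a'\<in>A. \<forall>b'\<in>B. \<tau> a b * \<tau> a' b' = \<tau> (a * a') (b * b'))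
     \<and> (\<forall>a\<in>A. \<forall>b\<in>B. star (\<tau> a b) = \<tau> (star a) (star b))
     \<and> (\<exists>\<pi> \<rho>. faithful_rep A \<pi> \<and> faithful_rep B \<rho>
          \<and> (\<forall>n a b. (\<forall>i<n. a i \<in> A \<and> b i \<in> B)
               \<longrightarrow> norm (\<Sum>i<n. \<tau> (a i) (b i)) = spatial_norm \<pi> \<rho> n a b))
     \<and> closure (tensor_sums A B \<tau>) = T"

text \<open>
  \<open>h = f \<otimes> g\<close>, resp. \<open>\<omega> = \<phi> \<otimes> \<psi>\<close>, where \<open>(T, \<tau>)\<close> is the tensor product of \<open>A\<close> and \<open>B\<close>, and
  \<open>(T', \<tau>')\<close> that of the targets of \<open>f\<close> and \<open>g\<close>.
\<close>

definition tensor_hom ::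
  "'a::cstar_algebra set \<Rightarrow> 'a set \<Rightarrow> 'a set \<Rightarrow> ('a \<Rightarrow> 'a \<Rightarrow> 'a) \<Rightarrow> 'b::cstar_algebra set \<Rightarrow> ('b \<Rightarrow> 'b \<Rightarrow> 'b)
     \<Rightarrow> ('a \<Rightarrow> 'b) \<Rightarrow> ('a \<Rightarrow> 'b) \<Rightarrow> ('a \<Rightarrow> 'b) \<Rightarrow> bool" where
  "tensor_hom A B T \<tau> T' \<tau>' f g h \<longleftrightarrow> star_hom T T' h \<and> (\<forall>a\<in>A. \<forall>b\<in>B. h (\<tau> a b) = \<tau>' (f a) (g b))"

definition tensor_operator ::
  "'h::hilbert_space set \<Rightarrow> 'h set \<Rightarrow> 'h set \<Rightarrow> ('h \<Rightarrow> 'h \<Rightarrow> 'h) \<Rightarrow> 'k::hilbert_space set \<Rightarrow> ('k \<Rightarrow> 'k \<Rightarrow> 'k)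
     \<Rightarrow> ('h \<Rightarrow> 'k) \<Rightarrow> ('h \<Rightarrow> 'k) \<Rightarrow> ('h \<Rightarrow> 'k) \<Rightarrow> bool" where
  "tensor_operator H K L u L' u' f g h \<longleftrightarrow>
     bounded_clinear_map L L' h \<and> (\<forall>x\<in>H. \<forall>y\<in>K. h (u x y) = u' (f x) (g y))"

definition tensor_functional ::
  "'a::cstar_algebra set \<Rightarrow> 'a set \<Rightarrow> 'a set \<Rightarrow> ('a \<Rightarrow> 'a \<Rightarrow> 'a)
     \<Rightarrow> ('a \<Rightarrow> complex) \<Rightarrow> ('a \<Rightarrow> complex) \<Rightarrow> ('a \<Rightarrow> complex) \<Rightarrow> bool" where
  "tensor_functional A B T \<tau> \<phi> \<psi> \<omega> \<longleftrightarrow>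
     bounded_functional T \<omega> \<and> (\<forall>a\<in>A. \<forall>b\<in>B. \<omega> (\<tau> a b) = \<phi> a * \<psi> b)"


subsection \<open>Partitions and tensor products along partitions\<close>

text \<open>A partition is the finite set of its points; it is empty unless \<open>0 < s < t\<close>.\<close>

definition parts :: "real \<Rightarrow> real \<Rightarrow> real set set" where
  "parts s t = {I. 0 < s \<and> s < t \<and> finite I \<and> {s, t} \<subseteq> I \<and> I \<subseteq> {s..t}}"

text \<open>
  \<open>A {s, t}\<close> is the algebra \<open>\<A>\<^sub>s\<^sub>,\<^sub>t\<close> and, for a general partition, \<open>A I\<close> realizes the tensor product
  \<open>\<A>\<^sub>I\<close>.  The identification of \<open>\<A>\<^sub>I \<otimes> \<A>\<^sub>J\<close> with \<open>\<A>\<^sub>I\<^sub>\<union>\<^sub>J\<close>, for partitions \<open>I\<close> of \<open>[r, s]\<close> and \<open>J\<close> of \<open>[s, t]\<close>,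
  is given by the elementary tensors \<open>\<tau> I J a b\<close>; the third clause says that these
  identifications are compatible with the associativity of the tensor product.  In particular
  \<open>\<A>\<^sub>r\<^sub>,\<^sub>s \<otimes> \<A>\<^sub>s\<^sub>,\<^sub>t\<close> is \<open>A {r, s, t}\<close>, with elementary tensors \<open>\<tau> {r, s} {s, t} a b\<close>.
\<close>

definition cstar_tensor_system ::
  "(real set \<Rightarrow> 'a::cstar_algebra set) \<Rightarrow> (real set \<Rightarrow> real set \<Rightarrow> 'a \<Rightarrow> 'a \<Rightarrow> 'a) \<Rightarrow> bool" where
  "cstar_tensor_system A \<tau> \<longleftrightarrow>
     (\<forall>s t. \<forall>I\<in>parts s t. cstar_subalgebra (A I))
     \<and> (\<forall>r s t. \<forall>I\<in>parts r s. \<forall>J\<in>parts s t. min_tensor (A I) (A J) (A (I \<union> J)) (\<tau> I J))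
     \<and> (\<forall>r s t u. \<forall>I\<in>parts r s. \<forall>J\<in>parts s t. \<forall>K\<in>parts t u. \<forall>a\<in>A I. \<forall>b\<in>A J. \<forall>c\<in>A K.
          \<tau> (I \<union> J) K (\<tau> I J a b) c = \<tau> I (J \<union> K) a (\<tau> J K b c))"

definition hilbert_tensor_system ::
  "(real set \<Rightarrow> 'h::hilbert_space set) \<Rightarrow> (real set \<Rightarrow> real set \<Rightarrow> 'h \<Rightarrow> 'h \<Rightarrow> 'h) \<Rightarrow> bool" where
  "hilbert_tensor_system H u \<longleftrightarrow>
     (\<forall>s t. \<forall>I\<in>parts s t. closed_csubspace (H I))
     \<and> (\<forall>r s t. \<forall>I\<in>parts r s. \<forall>J\<in>parts s t. hilbert_tensor (H I) (H J) (H (I \<union> J)) (u I J))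
     \<and> (\<forall>r s t v. \<forall>I\<in>parts r s. \<forall>J\<in>parts s t. \<forall>K\<in>parts t v. \<forall>x\<in>H I. \<forall>y\<in>H J. \<forall>z\<in>H K.
          u (I \<union> J) K (u I J x y) z = u I (J \<union> K) x (u J K y z))"


subsection \<open>C*-subproduct systems and Tsirelson systems\<close>

definition cstar_subproduct_system ::
  "(real set \<Rightarrow> 'a::cstar_algebra set) \<Rightarrow> (real set \<Rightarrow> real set \<Rightarrow> 'a \<Rightarrow> 'a \<Rightarrow> 'a)
     \<Rightarrow> (real \<Rightarrow> real \<Rightarrow> real \<Rightarrow> 'a \<Rightarrow> 'a) \<Rightarrow> bool" where
  "cstar_subproduct_system A \<tau> \<Delta> \<longleftrightarrow> cstar_tensor_system A \<tau>
     \<and> (\<forall>r s t. 0 < r \<and> r < s \<and> s < t \<longrightarrow> star_mono (A {r, t}) (A {r, s, t}) (\<Delta> r s t))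
     \<and> (\<forall>r s t u. 0 < r \<and> r < s \<and> s < t \<and> t < u \<longrightarrow>
          (\<exists>F G. tensor_hom (A {r, s}) (A {s, u}) (A {r, s, u}) (\<tau> {r, s} {s, u})
                   (A {r, s, t, u}) (\<tau> {r, s} {s, t, u}) id (\<Delta> s t u) F
               \<and> tensor_hom (A {r, t}) (A {t, u}) (A {r, t, u}) (\<tau> {r, t} {t, u})
                   (A {r, s, t, u}) (\<tau> {r, s, t} {t, u}) (\<Delta> r s t) id G
               \<and> (\<forall>x\<in>A {r, u}. F (\<Delta> r s u x) = G (\<Delta> r t u x))))"

definition counit ::
  "(real set \<Rightarrow> 'a::cstar_algebra set) \<Rightarrow> (real set \<Rightarrow> real set \<Rightarrow> 'a \<Rightarrow> 'a \<Rightarrow> 'a)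
     \<Rightarrow> (real \<Rightarrow> real \<Rightarrow> real \<Rightarrow> 'a \<Rightarrow> 'a) \<Rightarrow> (real \<Rightarrow> real \<Rightarrow> 'a \<Rightarrow> complex) \<Rightarrow> bool" where
  "counit A \<tau> \<Delta> \<phi> \<longleftrightarrow>
     (\<forall>s t. 0 < s \<and> s < t \<longrightarrow> state (A {s, t}) (\<phi> s t))
     \<and> (\<forall>r s t. 0 < r \<and> r < s \<and> s < t \<longrightarrow>
          (\<exists>\<omega>. tensor_functional (A {r, s}) (A {s, t}) (A {r, s, t}) (\<tau> {r, s} {s, t}) (\<phi> r s) (\<phi> s t) \<omega>
             \<and> (\<forall>x\<in>A {r, t}. \<phi> r t x = \<omega> (\<Delta> r s t x))))"

definition tsirelson_product_system ::
  "(real set \<Rightarrow> 'h::hilbert_space set) \<Rightarrow> (real set \<Rightarrow> real set \<Rightarrow> 'h \<Rightarrow> 'h \<Rightarrow> 'h)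
     \<Rightarrow> (real \<Rightarrow> real \<Rightarrow> real \<Rightarrow> 'h \<Rightarrow> 'h) \<Rightarrow> bool" where
  "tsirelson_product_system H u V \<longleftrightarrow> hilbert_tensor_system H u
     \<and> (\<forall>r s t. 0 < r \<and> r < s \<and> s < t \<longrightarrow> unitary_map (H {r, t}) (H {r, s, t}) (V r s t))
     \<and> (\<forall>r s t v. 0 < r \<and> r < s \<and> s < t \<and> t < v \<longrightarrow>
          (\<exists>F G. tensor_operator (H {r, s}) (H {s, v}) (H {r, s, v}) (u {r, s} {s, v})
                   (H {r, s, t, v}) (u {r, s} {s, t, v}) id (V s t v) F
               \<and> tensor_operator (H {r, t}) (H {t, v}) (H {r, t, v}) (u {r, t} {t, v})
                   (H {r, s, t, v}) (u {r, s, t} {t, v}) (V r s t) id G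
               \<and> (\<forall>x\<in>H {r, v}. F (V r s v x) = G (V r t v x))))"

definition tsirelson_isomorphic ::
  "(real set \<Rightarrow> 'h::hilbert_space set) \<Rightarrow> (real set \<Rightarrow> real set \<Rightarrow> 'h \<Rightarrow> 'h \<Rightarrow> 'h)
     \<Rightarrow> (real \<Rightarrow> real \<Rightarrow> real \<Rightarrow> 'h \<Rightarrow> 'h)
     \<Rightarrow> (real set \<Rightarrow> 'k::hilbert_space set) \<Rightarrow> (real set \<Rightarrow> real set \<Rightarrow> 'k \<Rightarrow> 'k \<Rightarrow> 'k)
     \<Rightarrow> (real \<Rightarrow> real \<Rightarrow> real \<Rightarrow> 'k \<Rightarrow> 'k) \<Rightarrow> bool" where
  "tsirelson_isomorphic H u V K w W \<longleftrightarrow>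
     (\<exists>Z. (\<forall>s t. 0 < s \<and> s < t \<longrightarrow> unitary_map (H {s, t}) (K {s, t}) (Z s t))
        \<and> (\<forall>r s t. 0 < r \<and> r < s \<and> s < t \<longrightarrow>
             (\<exists>F. tensor_operator (H {r, s}) (H {s, t}) (H {r, s, t}) (u {r, s} {s, t})
                    (K {r, s, t}) (w {r, s} {s, t}) (Z r s) (Z s t) F
                \<and> (\<forall>x\<in>H {r, t}. F (V r s t x) = W r s t (Z r t x)))))"

text \<open>
  In the last clause \<open>\<omega>\<close> is \<open>\<phi>\<^sub>r\<^sub>,\<^sub>s \<otimes> \<phi>\<^sub>s\<^sub>,\<^sub>t\<close> and \<open>E\<close> its GNS map \<open>\<eta>\<^sub>\<omega>\<close>, taking values in
  \<open>H\<^sub>r\<^sub>,\<^sub>s \<otimes> H\<^sub>s\<^sub>,\<^sub>t\<close> under the identification \<open>\<eta> x \<otimes> \<eta> y \<mapsto> \<eta>\<^sub>\<omega> (x \<otimes> y)\<close>.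
\<close>

definition associated_system ::
  "(real set \<Rightarrow> 'a::cstar_algebra set) \<Rightarrow> (real set \<Rightarrow> real set \<Rightarrow> 'a \<Rightarrow> 'a \<Rightarrow> 'a)
     \<Rightarrow> (real \<Rightarrow> real \<Rightarrow> real \<Rightarrow> 'a \<Rightarrow> 'a) \<Rightarrow> (real \<Rightarrow> real \<Rightarrow> 'a \<Rightarrow> complex)
     \<Rightarrow> (real set \<Rightarrow> 'h::hilbert_space set) \<Rightarrow> (real set \<Rightarrow> real set \<Rightarrow> 'h \<Rightarrow> 'h \<Rightarrow> 'h)
     \<Rightarrow> (real \<Rightarrow> real \<Rightarrow> real \<Rightarrow> 'h \<Rightarrow> 'h) \<Rightarrow> bool" where
  "associated_system A \<tau> \<Delta> \<phi> H u V \<longleftrightarrow> hilbert_tensor_system H u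
     \<and> (\<exists>\<eta>. (\<forall>s t. 0 < s \<and> s < t \<longrightarrow> gns_space (A {s, t}) (\<phi> s t) (H {s, t}) (\<eta> s t))
         \<and> (\<forall>r s t. 0 < r \<and> r < s \<and> s < t \<longrightarrow>
              isometry_map (H {r, t}) (H {r, s, t}) (V r s t)
              \<and> (\<exists>\<omega> E. tensor_functional (A {r, s}) (A {s, t}) (A {r, s, t}) (\<tau> {r, s} {s, t}) (\<phi> r s) (\<phi> s t) \<omega>
                     \<and> gns_space (A {r, s, t}) \<omega> (H {r, s, t}) E
                     \<and> (\<forall>x\<in>A {r, s}. \<forall>y\<in>A {s, t}.
                          E (\<tau> {r, s} {s, t} x y) = u {r, s} {s, t} (\<eta> r s x) (\<eta> s t y))
                     \<and> (\<forall>x\<in>A {r, t}. V r s t (\<eta> r t x) = E (\<Delta> r s t x)))))"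


subsection \<open>Inductive dilations\<close>

text \<open>
  \<open>D I J\<close> is \<open>\<Delta>\<^sub>I\<^sub>,\<^sub>J\<close>.  With \<open>p = Max (I - {t})\<close> the last interior point of \<open>I\<close> (or \<open>s\<close>), the third
  clause is the recursion for \<open>\<Delta>\<^bsub>{s,t},I\<^esub>\<close>, and the fourth clause determines
  \<open>\<Delta>\<^sub>I\<^sub>,\<^sub>J = \<Delta>\<^bsub>{\<iota>\<^sub>0,\<iota>\<^sub>1},I\<^sub>0\<^esub> \<otimes> \<dots> \<otimes> \<Delta>\<^bsub>{\<iota>\<^sub>m,\<iota>\<^sub>m\<^sub>+\<^sub>1},I\<^sub>m\<^esub>\<close> by splitting off the last tensor factor.
\<close>

definition connecting_homs ::
  "(real set \<Rightarrow> 'a::cstar_algebra set) \<Rightarrow> (real set \<Rightarrow> real set \<Rightarrow> 'a \<Rightarrow> 'a \<Rightarrow> 'a)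
     \<Rightarrow> (real \<Rightarrow> real \<Rightarrow> real \<Rightarrow> 'a \<Rightarrow> 'a) \<Rightarrow> (real set \<Rightarrow> real set \<Rightarrow> 'a \<Rightarrow> 'a) \<Rightarrow> bool" where
  "connecting_homs A \<tau> \<Delta> D \<longleftrightarrow>
     (\<forall>s t. 0 < s \<and> s < t \<longrightarrow> (\<forall>x\<in>A {s, t}. D {s, t} {s, t} x = x))
     \<and> (\<forall>r s t. 0 < r \<and> r < s \<and> s < t \<longrightarrow> (\<forall>x\<in>A {r, t}. D {r, t} {r, s, t} x = \<Delta> r s t x))
     \<and> (\<forall>s t. \<forall>I\<in>parts s t. card I \<ge> 4 \<longrightarrow>
          (let p = Max (I - {t}) in
           \<exists>F. tensor_hom (A {s, p}) (A {p, t}) (A {s, p, t}) (\<tau> {s, p} {p, t})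
                 (A I) (\<tau> (I - {t}) {p, t}) (D {s, p} (I - {t})) id F
             \<and> (\<forall>x\<in>A {s, t}. D {s, t} I x = F (\<Delta> s p t x))))
     \<and> (\<forall>s t. \<forall>I\<in>parts s t. \<forall>J\<in>parts s t. I \<subseteq> J \<and> card I \<ge> 3 \<longrightarrow>
          (let p = Max (I - {t}) in
           tensor_hom (A (I - {t})) (A {p, t}) (A I) (\<tau> (I - {t}) {p, t})
             (A J) (\<tau> (J \<inter> {s..p}) (J \<inter> {p..t})) (D (I - {t}) (J \<inter> {s..p})) (D {p, t} (J \<inter> {p..t})) (D I J)))"

definition connecting_isometries ::
  "(real set \<Rightarrow> 'h::hilbert_space set) \<Rightarrow> (real set \<Rightarrow> real set \<Rightarrow> 'h \<Rightarrow> 'h \<Rightarrow> 'h)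
     \<Rightarrow> (real \<Rightarrow> real \<Rightarrow> real \<Rightarrow> 'h \<Rightarrow> 'h) \<Rightarrow> (real set \<Rightarrow> real set \<Rightarrow> 'h \<Rightarrow> 'h) \<Rightarrow> bool" where
  "connecting_isometries H u V W \<longleftrightarrow>
     (\<forall>s t. 0 < s \<and> s < t \<longrightarrow> (\<forall>x\<in>H {s, t}. W {s, t} {s, t} x = x))
     \<and> (\<forall>r s t. 0 < r \<and> r < s \<and> s < t \<longrightarrow> (\<forall>x\<in>H {r, t}. W {r, t} {r, s, t} x = V r s t x))
     \<and> (\<forall>s t. \<forall>I\<in>parts s t. card I \<ge> 4 \<longrightarrow>
          (let p = Max (I - {t}) in
           \<exists>F. tensor_operator (H {s, p}) (H {p, t}) (H {s, p, t}) (u {s, p} {p, t})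
                 (H I) (u (I - {t}) {p, t}) (W {s, p} (I - {t})) id F
             \<and> (\<forall>x\<in>H {s, t}. W {s, t} I x = F (V s p t x))))
     \<and> (\<forall>s t. \<forall>I\<in>parts s t. \<forall>J\<in>parts s t. I \<subseteq> J \<and> card I \<ge> 3 \<longrightarrow>
          (let p = Max (I - {t}) in
           tensor_operator (H (I - {t})) (H {p, t}) (H I) (u (I - {t}) {p, t})
             (H J) (u (J \<inter> {s..p}) (J \<inter> {p..t})) (W (I - {t}) (J \<inter> {s..p})) (W {p, t} (J \<inter> {p..t})) (W I J)))"

text \<open>
  \<open>As {s, t}\<close> is the inductive limit \<open>\<A>\<^sup>\<sharp>\<^sub>s\<^sub>,\<^sub>t\<close> with connecting maps \<open>\<kappa> I\<close> (written \<open>\<Delta>\<^sup>\<sharp>\<^sub>I\<close> in the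
  literature; \<open>I\<close> determines \<open>s\<close> and \<open>t\<close>), and the family \<open>\<Delta>s\<close> consists of the isomorphisms
  characterized by \<open>\<Delta>\<^sup>\<sharp>\<^sub>r\<^sub>,\<^sub>s\<^sub>,\<^sub>t \<Delta>\<^sup>\<sharp>\<^sub>I\<^sub>\<union>\<^sub>J = \<Delta>\<^sup>\<sharp>\<^sub>I \<otimes> \<Delta>\<^sup>\<sharp>\<^sub>J\<close>.  As the maps \<open>D I J\<close> are injective, an inductive limit
  is a C*-algebra with compatible *-monomorphisms whose ranges have dense union.
\<close>

definition inductive_dilation ::
  "(real set \<Rightarrow> 'a::cstar_algebra set) \<Rightarrow> (real set \<Rightarrow> real set \<Rightarrow> 'a \<Rightarrow> 'a \<Rightarrow> 'a)
     \<Rightarrow> (real \<Rightarrow> real \<Rightarrow> real \<Rightarrow> 'a \<Rightarrow> 'a)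
     \<Rightarrow> (real set \<Rightarrow> 'b::cstar_algebra set) \<Rightarrow> (real set \<Rightarrow> real set \<Rightarrow> 'b \<Rightarrow> 'b \<Rightarrow> 'b)
     \<Rightarrow> (real \<Rightarrow> real \<Rightarrow> real \<Rightarrow> 'b \<Rightarrow> 'b) \<Rightarrow> (real set \<Rightarrow> 'a \<Rightarrow> 'b) \<Rightarrow> bool" where
  "inductive_dilation A \<tau> \<Delta> As \<tau>s \<Delta>s \<kappa> \<longleftrightarrow> cstar_tensor_system As \<tau>s
     \<and> (\<exists>D. connecting_homs A \<tau> \<Delta> D
          \<and> (\<forall>s t. 0 < s \<and> s < t \<longrightarrow>
               (\<forall>I\<in>parts s t. star_mono (A I) (As {s, t}) (\<kappa> I))
               \<and> (\<forall>I\<in>parts s t. \<forall>J\<in>parts s t. I \<subseteq> J \<longrightarrow> (\<forall>x\<in>A I. \<kappa> J (D I J x) = \<kappa> I x))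
               \<and> closure (\<Union>I\<in>parts s t. \<kappa> I ` A I) = As {s, t}))
     \<and> (\<forall>r s t. 0 < r \<and> r < s \<and> s < t \<longrightarrow>
          star_iso (As {r, t}) (As {r, s, t}) (\<Delta>s r s t)
          \<and> (\<forall>I\<in>parts r s. \<forall>J\<in>parts s t.
               tensor_hom (A I) (A J) (A (I \<union> J)) (\<tau> I J) (As {r, s, t}) (\<tau>s {r, s} {s, t})
                 (\<kappa> I) (\<kappa> J) (\<Delta>s r s t \<circ> \<kappa> (I \<union> J))))"

definition counit_dilation ::
  "(real set \<Rightarrow> 'a::cstar_algebra set) \<Rightarrow> (real \<Rightarrow> real \<Rightarrow> 'a \<Rightarrow> complex)
     \<Rightarrow> (real set \<Rightarrow> 'b::cstar_algebra set) \<Rightarrow> (real set \<Rightarrow> real set \<Rightarrow> 'b \<Rightarrow> 'b \<Rightarrow> 'b)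
     \<Rightarrow> (real \<Rightarrow> real \<Rightarrow> real \<Rightarrow> 'b \<Rightarrow> 'b) \<Rightarrow> (real set \<Rightarrow> 'a \<Rightarrow> 'b)
     \<Rightarrow> (real \<Rightarrow> real \<Rightarrow> 'b \<Rightarrow> complex) \<Rightarrow> bool" where
  "counit_dilation A \<phi> As \<tau>s \<Delta>s \<kappa> \<phi>s \<longleftrightarrow> counit As \<tau>s \<Delta>s \<phi>s
     \<and> (\<forall>s t. 0 < s \<and> s < t \<longrightarrow> (\<forall>x\<in>A {s, t}. \<phi>s s t (\<kappa> {s, t} x) = \<phi> s t x))"

definition bhat_mukherjee_dilation ::
  "(real set \<Rightarrow> 'h::hilbert_space set) \<Rightarrow> (real set \<Rightarrow> real set \<Rightarrow> 'h \<Rightarrow> 'h \<Rightarrow> 'h)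
     \<Rightarrow> (real \<Rightarrow> real \<Rightarrow> real \<Rightarrow> 'h \<Rightarrow> 'h)
     \<Rightarrow> (real set \<Rightarrow> 'k::hilbert_space set) \<Rightarrow> (real set \<Rightarrow> real set \<Rightarrow> 'k \<Rightarrow> 'k \<Rightarrow> 'k)
     \<Rightarrow> (real \<Rightarrow> real \<Rightarrow> real \<Rightarrow> 'k \<Rightarrow> 'k) \<Rightarrow> bool" where
  "bhat_mukherjee_dilation H u V Hs us Vs \<longleftrightarrow> hilbert_tensor_system Hs us
     \<and> (\<exists>W \<nu>. connecting_isometries H u V W
          \<and> (\<forall>s t. 0 < s \<and> s < t \<longrightarrow>
               (\<forall>I\<in>parts s t. isometry_map (H I) (Hs {s, t}) (\<nu> I))
               \<and> (\<forall>I\<in>parts s t. \<forall>J\<in>parts s t. I \<subseteq> J \<longrightarrow> (\<forall>x\<in>H I. \<nu> J (W I J x) = \<nu> I x))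
               \<and> closure (\<Union>I\<in>parts s t. \<nu> I ` H I) = Hs {s, t})
          \<and> (\<forall>r s t. 0 < r \<and> r < s \<and> s < t \<longrightarrow>
               unitary_map (Hs {r, t}) (Hs {r, s, t}) (Vs r s t)
               \<and> (\<forall>I\<in>parts r s. \<forall>J\<in>parts s t.
                    tensor_operator (H I) (H J) (H (I \<union> J)) (u I J) (Hs {r, s, t}) (us {r, s} {s, t})
                      (\<nu> I) (\<nu> J) (Vs r s t \<circ> \<nu> (I \<union> J)))))"

end

theory Submission
  imports Defs
begin

text \<open>
  Both systems are inductive limits of the tensor products \<open>H I\<close> along the connecting isometries
  \<open>V\<^sub>I\<^sub>,\<^sub>J\<close>, and two such limits are isomorphic because their dense subspaces \<open>\<Union>I. Y I ` H I\<close> have the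
  same Gram matrices.  To see this for the GNS spaces \<open>H'\<close> of the dilated co-unit, map
  \<open>\<eta> a\<^sub>0 \<otimes> \<dots> \<otimes> \<eta> a\<^sub>m\<close> to \<open>\<eta>' (\<kappa> I (a\<^sub>0 \<otimes> \<dots> \<otimes> a\<^sub>m))\<close>.  This is isometric since \<open>\<phi>s \<circ> \<kappa> I\<close> is the product of
  the states \<open>\<phi>\<close>, which also avoids constructing product states on longer tensor products.
  Compatibility with the connecting maps is checked after applying the isometries \<open>V'\<close>, which turn
  it into a statement about tensor factors.  The comparison of bounded linear maps on dense subspaces
  needs that *-homomorphisms are contractive.
\<close>

section \<open>Complex vector spaces\<close>

text \<open>Elementary tensors alone do not settle the compatibility:
  \<open>\<Delta> r s t a\<close> is only a limit of sums of elementary tensors, so the identity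
  \<open>X {r, s, t} (E c) = \<eta>' r t (\<kappa> {r, s, t} c)\<close> is needed for all
  \<open>c\<close> in \<open>A {r, s, t}\<close>. It passes from elementary tensors to their closed
  span because \<open>\<eta>'\<close> composed with \<open>\<kappa>\<close> is bounded, and this is
  where contractivity enters. It has to come from the bare axioms of an algebra without a unit;
  hence quasi-inverses instead of inverses and spectra. A second obstacle is that the connecting
  maps \<open>W\<close> are hidden in the Bhat-Mukherjee dilation, while the comparison requires two
  limits over the same \<open>W\<close>. The GNS side is therefore built for every \<open>W\<close>
  that satisfies the defining recursion. What the two realizations share is collected in the locale
  \<open>hilbert_limit\<close>, from which the product system property and the isomorphism are each
  derived once.\<close>

lemma scaleC_zero_left [simp]: "0 *\<^sub>C (x::'a::complex_vector) = 0"
  using scaleC_add_left[of 0 0 x] by simp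

lemma scaleC_zero_right [simp]: "c *\<^sub>C (0::'a::complex_vector) = 0"
  using scaleC_add_right[of c 0 "0::'a"] by simp

lemma scaleC_one [simp]: "1 *\<^sub>C (x::'a::complex_vector) = x"
  using scaleR_scaleC[of 1 x] by simp

lemma scaleC_minus_left [simp]: "(- c) *\<^sub>C (x::'a::complex_vector) = - (c *\<^sub>C x)"
  using scaleC_add_left[of c "-c" x] by (simp add: eq_neg_iff_add_eq_0 add.commute)

lemma scaleC_minus_right: "c *\<^sub>C (- x) = - (c *\<^sub>C (x::'a::complex_vector))"
  using scaleC_add_right[of c x "-x"] by (simp add: eq_neg_iff_add_eq_0 add.commute)

lemma scaleC_diff_right: "c *\<^sub>C (x - y) = c *\<^sub>C x - c *\<^sub>C (y::'a::complex_vector)"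
  using scaleC_add_right[of c x "-y"] by (simp add: scaleC_minus_right)

lemma scaleC_diff_left: "(c - d) *\<^sub>C x = c *\<^sub>C x - d *\<^sub>C (x::'a::complex_vector)"
  using scaleC_add_left[of c "-d" x] by simp

section \<open>Contractivity of *-homomorphisms\<close>

text \<open>\<open>quasi_inverse x y\<close> says that \<open>1 + y\<close> is the inverse of \<open>1 - x\<close> in the unitization.\<close>

definition quasi_inverse :: "'a::cstar_algebra \<Rightarrow> 'a \<Rightarrow> bool" where
  "quasi_inverse x y \<longleftrightarrow> y = x + x * y \<and> y = x + y * x"

text \<open>In the unitization, \<open>1 + y\<close> and \<open>1 + z\<close> are the inverses of
  \<open>1 - x\<close> and \<open>1 + x\<close>, and the inverse of \<open>1 - x * x\<close> is the
  mean of these two.\<close>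

lemma quasi_inverse_square:
  assumes "quasi_inverse x y" "quasi_inverse (- x) z"
  shows "quasi_inverse (x * x) ((1/2::real) *\<^sub>R (y + z))"
proof -
  have y: "x * y = y - x" "y * x = y - x" and "(- x) * z = z - (- x)" "z * (- x) = z - (- x)"
    using assms unfolding quasi_inverse_def by (metis add_diff_cancel_left')+
  then have z: "x * z = - x - z" "z * x = - x - z"
    by (metis add_uminus_conv_diff diff_minus_eq_add minus_add minus_minus mult_minus_left mult_minus_right add.commute)+
  have "x * x * y = y - x - x * x"
    by (simp add: mult.assoc y algebra_simps)
  moreover have "x * x * z = - (x * x) + x + z"
    by (simp add: mult.assoc z algebra_simps)
  ultimately have 1: "x * x * (y + z) = (y + z) - 2 *\<^sub>R (x * x)"
    by (simp add: algebra_simps scaleR_2)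
  have "y * (x * x) = y - x - x * x"
    by (simp add: mult.assoc[symmetric] y left_diff_distrib)
  moreover have "z * (x * x) = - (x * x) + x + z"
    by (simp add: mult.assoc[symmetric] z left_diff_distrib)
  ultimately have 2: "(y + z) * (x * x) = (y + z) - 2 *\<^sub>R (x * x)"
    by (simp add: algebra_simps scaleR_2)
  show ?thesis
    unfolding quasi_inverse_def mult_scaleR_right mult_scaleR_left 1 2
    by (simp add: scaleR_diff_right)
qed

text \<open>Banach's fixed point theorem in the complete set \<open>S\<close> replaces the Neumann
  series and keeps \<open>y\<close> inside \<open>S\<close>.\<close>

lemma quasi_inverse_exists:
  assumes S: "cstar_subalgebra S" and x: "x \<in> S" "norm x < 1"
  obtains y where "y \<in> S" "quasi_inverse x y"
proof -
  have cl: "complete S"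
    using S by (simp add: cstar_subalgebra_def closed_csubspace_def complete_eq_closed)
  \<comment> \<open>The constant term stays free because the claim is used twice:
    \<open>a = x\<close> produces \<open>y\<close>, and \<open>a = x * x\<close> gives
    \<open>x * y = y * x\<close>, since both are fixed points of that contraction.\<close>
  have fp: "\<exists>!y\<in>S. a + x * y = y" if "a \<in> S" for a
  proof (rule Banach_fix[OF cl, of "norm x"])
    show "S \<noteq> {}" using x by auto
    show "(\<lambda>y. a + x * y) ` S \<subseteq> S"
      using S x that by (auto simp: cstar_subalgebra_def closed_csubspace_def)
    show "dist (a + x * y) (a + x * z) \<le> norm x * dist y z" if "y \<in> S" "z \<in> S" for y z
      by (simp add: dist_norm right_diff_distrib[symmetric] norm_mult_ineq)
  qed (use x in auto)
  obtain y where y: "y \<in> S" "x + x * y = y"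
    using fp x by blast
  have "x * x \<in> S" "x * y \<in> S" "y * x \<in> S"
    using S x y by (auto simp: cstar_subalgebra_def)
  moreover have "x * x + x * (x * y) = x * y"
    using y by (metis distrib_left)
  moreover have "x * x + x * (y * x) = y * x"
    using y by (metis distrib_right mult.assoc)
  ultimately have "x * y = y * x"
    using fp by blast
  with y show thesis
    using that by (auto simp: quasi_inverse_def)
qed

text \<open>This is the resolvent identity: if \<open>r c = 1 + R c\<close> denotes the inverse of
  \<open>1 - c *\<^sub>C b\<close> in the unitization, then \<open>R d - R c\<close> is
  \<open>d - c\<close> times the product of \<open>r d\<close>, \<open>b\<close> and
  \<open>r c\<close>.\<close>

lemma quasi_inverse_continuous:
  assumes "\<And>c. c \<in> C \<Longrightarrow> quasi_inverse (c *\<^sub>C b) (R c)"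
  shows "continuous_on C R"
  unfolding continuous_on_iff
proof safe
  fix c and e :: real assume c: "c \<in> C" and e: "0 < e"
  define m where "m = 1 + norm (R c)"
  define n where "n = 1 + norm b"
  have m: "m \<ge> 1" and n: "n \<ge> 1" by (simp_all add: m_def n_def)
  \<comment> \<open>No bound on \<open>R d\<close> is known beforehand. The first term of the
    minimum gives \<open>2 * D \<le> k\<close>, so that \<open>k \<le> m + D\<close> becomes
    \<open>k \<le> 2 * m\<close>; with this bound the second term gives
    \<open>D \<le> e / 2\<close>.\<close>
  define \<delta> where "\<delta> = min (1 / (2 * m * n)) (e / (4 * m * m * n))"
  have \<delta>: "\<delta> > 0"
    using m n e by (simp add: \<delta>_def)
  have "dist (R d) (R c) < e" if d: "d \<in> C" "dist d c < \<delta>" for d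
  proof -
    define k where "k = 1 + norm (R d)"
    have k: "k \<ge> 1" by (simp add: k_def)
    define D where "D = norm (R d - R c)"
    define g where "g = cmod (d - c)"
    have g: "0 \<le> g" "g < \<delta>" using d by (simp_all add: g_def dist_norm)
    have Rd: "R d * (d *\<^sub>C b) = R d - d *\<^sub>C b" and Rc: "(c *\<^sub>C b) * R c = R c - c *\<^sub>C b"
      using assms[OF c] assms[OF d(1)] unfolding quasi_inverse_def by (metis add_diff_cancel_left')+
    have "(d - c) *\<^sub>C (R d * b * R c) = (R d * (d *\<^sub>C b)) * R c - R d * ((c *\<^sub>C b) * R c)"
      by (simp add: mult_scaleC_left mult_scaleC_right scaleC_diff_left mult.assoc)
    also have "\<dots> = R d * (c *\<^sub>C b) - (d *\<^sub>C b) * R c"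
      unfolding Rd Rc by (simp add: algebra_simps)
    finally have id: "R d - R c = (d - c) *\<^sub>C (R d * b * R c + R d * b + b * R c + b)"
      using Rd Rc
      by (simp add: scaleC_add_right scaleC_diff_left mult_scaleC_left mult_scaleC_right algebra_simps)
    have "norm (R d * b * R c + R d * b + b * R c + b)
      \<le> norm (R d) * norm b * norm (R c) + norm (R d) * norm b + norm b * norm (R c) + norm b"
      by (intro norm_triangle_mono order_refl norm_mult_ineq
          order_trans[OF norm_mult_ineq] mult_right_mono norm_ge_zero)
    also have "\<dots> = k * norm b * m"
      by (simp add: k_def m_def algebra_simps)
    also have "\<dots> \<le> k * n * m"
      using k m by (intro mult_right_mono mult_left_mono) (auto simp: n_def)
    finally have D: "D \<le> g * (k * n * m)"
      unfolding D_def id norm_scaleC g_def by (rule mult_left_mono) simp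
    have kD: "k \<le> m + D"
      using norm_triangle_ineq2[of "R d" "R c"] by (simp add: k_def m_def D_def)
    have "g \<le> 1 / (2 * m * n)" using g by (simp add: \<delta>_def)
    then have "g * (2 * m * n) \<le> 1"
      using m n by (simp add: field_simps)
    then have "(g * (2 * m * n)) * k \<le> 1 * k"
      using k by (intro mult_right_mono) auto
    then have "2 * D \<le> k"
      using D by (simp add: algebra_simps)
    with kD have k2: "k \<le> 2 * m" by simp
    have "D \<le> g * (2 * m * n * m)"
      by (rule order_trans[OF D]) (use k2 m n g in \<open>intro mult_left_mono mult_right_mono; simp\<close>)
    also have "\<dots> \<le> (e / (4 * m * m * n)) * (2 * m * n * m)"
      using g m n by (intro mult_right_mono) (auto simp: \<delta>_def)
    also have "\<dots> = e / 2"
      using m n by (simp add: field_simps)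
    finally show ?thesis
      using e by (simp add: D_def dist_norm)
  qed
  with \<delta> show "\<exists>d>0. \<forall>x'\<in>C. dist x' c < d \<longrightarrow> dist (R x') (R c) < e"
    by blast
qed

text \<open>The power of \<open>x\<close> with exponent \<open>2 ^ k\<close>. The algebra has no
  unit, and both the C*-identity and \<open>quasi_inverse_square\<close> act on squares.\<close>

primrec iterated_square :: "nat \<Rightarrow> 'a::cstar_algebra \<Rightarrow> 'a" where
  "iterated_square 0 x = x"
| "iterated_square (Suc k) x = iterated_square k x * iterated_square k x"

lemma iterated_square_scaleC: "iterated_square k (c *\<^sub>C x) = (c ^ 2 ^ k) *\<^sub>C iterated_square k x"
  by (induction k) (simp_all add: mult_scaleC_left mult_scaleC_right scaleC_scaleC power_add[symmetric] mult_2)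

lemma norm_iterated_square:
  assumes "star x = x"
  shows "norm (iterated_square k x) = norm x ^ 2 ^ k"
proof -
  have sa: "star (iterated_square k x) = iterated_square k x" for k
    by (induction k) (simp_all add: assms star_mult)
  show ?thesis
  proof (induction k)
    case (Suc k)
    have "norm (iterated_square (Suc k) x) = (norm (iterated_square k x))\<^sup>2"
      using cstar_identity[of "iterated_square k x"] by (simp add: sa)
    then show ?case
      by (simp add: Suc power2_eq_square power_add[symmetric] mult_2)
  qed simp
qed

text \<open>
  Rickart's argument: on the circle of radius \<open>1 / \<parallel>f h\<parallel>\<close>, the quasi-inverses of \<open>c *\<^sub>C f h\<close> are
  uniformly continuous in \<open>c\<close>, and this modulus of continuity survives the averaging
  \<open>q (x\<^sup>2) = (q x + q (-x)) / 2\<close>.  So the quasi-inverses of \<open>(c *\<^sub>C f h) ^ 2 ^ k\<close> tend to 0 on the circle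
  as they do inside, although these powers have norm 1.
\<close>

lemma star_hom_selfadjoint_le:
  assumes f: "star_hom S T f" and S: "cstar_subalgebra S" and h: "h \<in> S" "star h = h"
  shows "norm (f h) \<le> norm h"
proof (rule ccontr)
  assume neg: "\<not> ?thesis"
  define b where "b = f h"
  define B where "B = norm b"
  have hB: "norm h < B" using neg by (simp add: B_def b_def)
  then have B: "B > 0" using norm_ge_zero[of h] by linarith
  have sub: "c *\<^sub>C h \<in> S" for c
    using S h by (auto simp: cstar_subalgebra_def closed_csubspace_def)
  have fs: "f (c *\<^sub>C h) = c *\<^sub>C b" for c
    using f h by (auto simp: star_hom_def clinear_map_def b_def)
  \<comment> \<open>Since \<open>norm h < B\<close>, the element \<open>c *\<^sub>C h\<close> lies
    in the open unit ball for every \<open>c\<close> of the closed disc of radius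
    \<open>1 / B\<close>. Its quasi-inverse in \<open>S\<close> is carried over by
    \<open>f\<close>.\<close>
  have ex: "\<exists>y. quasi_inverse (c *\<^sub>C b) y" if "c \<in> cball 0 (1 / B)" for c
  proof -
    have "cmod c * norm h \<le> norm h / B"
      using that B mult_right_mono[of "cmod c" "1/B" "norm h"] by simp
    also have "\<dots> < 1" using hB B by simp
    finally have "norm (c *\<^sub>C h) < 1"
      by (simp add: norm_scaleC)
    then obtain y where y: "y \<in> S" "quasi_inverse (c *\<^sub>C h) y"
      using quasi_inverse_exists[OF S sub] by blast
    have prods: "(c *\<^sub>C h) * y \<in> S" "y * (c *\<^sub>C h) \<in> S"
      using S y sub by (auto simp: cstar_subalgebra_def)
    have add: "f (v + w) = f v + f w" and mult: "f (v * w) = f v * f w" if "v \<in> S" "w \<in> S" for v w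
      using f that by (auto simp: star_hom_def clinear_map_def)
    note eqs = y(2)[unfolded quasi_inverse_def, THEN conjunct1, THEN arg_cong[where f = f]]
      y(2)[unfolded quasi_inverse_def, THEN conjunct2, THEN arg_cong[where f = f]]
    have "quasi_inverse (c *\<^sub>C b) (f y)"
      unfolding quasi_inverse_def
      by (rule conjI[OF eqs[unfolded add[OF sub prods(1)] add[OF sub prods(2)]
        mult[OF sub y(1)] mult[OF y(1) sub] fs]])
    then show ?thesis ..
  qed
  define R where "R c = (SOME y. quasi_inverse (c *\<^sub>C b) y)" for c
  have R: "quasi_inverse (c *\<^sub>C b) (R c)" if "c \<in> cball 0 (1 / B)" for c
    unfolding R_def using ex[OF that] by (rule someI_ex)
  have uc: "uniformly_continuous_on (cball 0 (1 / B)) R"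
    by (rule compact_uniformly_continuous[OF quasi_inverse_continuous[OF R] compact_cball])
  then obtain \<delta> where \<delta>: "\<delta> > 0"
    "\<And>c d. c \<in> cball 0 (1/B) \<Longrightarrow> d \<in> cball 0 (1/B) \<Longrightarrow> dist d c < \<delta> \<Longrightarrow> dist (R d) (R c) < 1/4"
    using uc[unfolded uniformly_continuous_on_def, THEN spec, of "1/4"] by fastforce
  \<comment> \<open>So close to 1 that \<open>c\<close> and \<open>t * c\<close> are at distance
    \<open>(1 - t) / B < \<delta>\<close> when \<open>cmod c = 1 / B\<close>; the 1/2 keeps
    \<open>t\<close> positive.\<close>
  define t where "t = max (1/2) (1 - \<delta> * B / 2)"
  have t: "0 < t" "t < 1" "(1 - t) / B < \<delta>"
    using \<delta>(1) B by (auto simp: t_def max_def field_simps)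
  have main: "\<forall>c. cmod c = 1 / B \<longrightarrow> (\<exists>q q'. quasi_inverse (iterated_square k (c *\<^sub>C b)) q
      \<and> quasi_inverse (iterated_square k ((of_real t * c) *\<^sub>C b)) q' \<and> norm (q - q') \<le> 1/4)" for k
  proof (induction k)
    case 0
    show ?case
    proof safe
      fix c :: complex assume c: "cmod c = 1 / B"
      have 1: "c \<in> cball 0 (1/B)" "of_real t * c \<in> cball 0 (1/B)"
        using c t B by (auto simp: norm_mult divide_right_mono)
      have "of_real t * c - c = of_real (t - 1) * c"
        by (simp add: algebra_simps)
      then have "dist (of_real t * c) c = (1 - t) / B"
        unfolding dist_norm using c t by (simp only: norm_mult norm_of_real) simp
      then have "dist (R (of_real t * c)) (R c) < 1/4"
        using \<delta>(2)[OF 1] t by simp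
      then have "norm (R c - R (of_real t * c)) \<le> 1/4"
        by (simp add: dist_norm norm_minus_commute)
      then show "\<exists>q q'. quasi_inverse (iterated_square 0 (c *\<^sub>C b)) q
          \<and> quasi_inverse (iterated_square 0 ((of_real t * c) *\<^sub>C b)) q' \<and> norm (q - q') \<le> 1/4"
        using R[OF 1(1)] R[OF 1(2)] by auto
    qed
  next
    case (Suc k)
    show ?case
    proof safe
      fix c :: complex assume c: "cmod c = 1 / B"
      \<comment> \<open>Rotation by \<open>z\<close> changes the sign of the power with exponent
        \<open>2 ^ k\<close>, which provides the pair of an element and its negative that the
        averaging needs. For this reason the induction runs over the whole circle.\<close>
      define z where "z = cis (pi / 2 ^ k)"
      have "z ^ 2 ^ k = cis (real (2 ^ k) * (pi / 2 ^ k))"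
        unfolding z_def by (rule Complex.DeMoivre)
      then have z: "z ^ 2 ^ k = -1"
        by simp
      have cz: "cmod (z * c) = 1 / B"
        using c by (simp add: z_def norm_mult)
      have neg: "iterated_square k ((z * d) *\<^sub>C b) = - iterated_square k (d *\<^sub>C b)" for d
        by (simp add: iterated_square_scaleC power_mult_distrib z)
      obtain q1 q1' where q1: "quasi_inverse (iterated_square k (c *\<^sub>C b)) q1"
        "quasi_inverse (iterated_square k ((of_real t * c) *\<^sub>C b)) q1'" "norm (q1 - q1') \<le> 1/4"
        using Suc c by blast
      obtain q2 q2' where q2: "quasi_inverse (iterated_square k ((z * c) *\<^sub>C b)) q2"
        "quasi_inverse (iterated_square k ((of_real t * (z * c)) *\<^sub>C b)) q2'" "norm (q2 - q2') \<le> 1/4"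
        using Suc cz by blast
      let ?q = "(1/2::real) *\<^sub>R (q1 + q2)" and ?q' = "(1/2::real) *\<^sub>R (q1' + q2')"
      have "quasi_inverse (iterated_square (Suc k) (c *\<^sub>C b)) ?q"
        using quasi_inverse_square q1(1) q2(1) by (simp add: neg)
      moreover have "quasi_inverse (iterated_square (Suc k) ((of_real t * c) *\<^sub>C b)) ?q'"
        using quasi_inverse_square q1(2) q2(2) neg[of "of_real t * c"] by (simp add: mult.left_commute)
      moreover have "norm (?q - ?q') \<le> 1/4"
      proof -
        have "?q - ?q' = (1/2::real) *\<^sub>R ((q1 - q1') + (q2 - q2'))"
          by (simp add: algebra_simps)
        then have "norm (?q - ?q') = (1/2) * norm ((q1 - q1') + (q2 - q2'))"
          by simp
        also have "\<dots> \<le> (1/2) * (1/4 + 1/4)"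
          by (intro mult_left_mono norm_triangle_mono q1 q2) simp
        finally show ?thesis by simp
      qed
      ultimately show "\<exists>q q'. quasi_inverse (iterated_square (Suc k) (c *\<^sub>C b)) q
          \<and> quasi_inverse (iterated_square (Suc k) ((of_real t * c) *\<^sub>C b)) q' \<and> norm (q - q') \<le> 1/4"
        by blast
    qed
  qed
  \<comment> \<open>A real point of the circle, so that \<open>c *\<^sub>C b\<close> is self-adjoint
    and all its iterated squares have norm 1.\<close>
  define c where "c = complex_of_real (1 / B)"
  have sa: "star b = b"
    using f h unfolding star_hom_def b_def by metis
  have "(\<lambda>k. t ^ 2 ^ k) \<longlonglongrightarrow> 0"
  proof (rule filterlim_compose[OF LIMSEQ_realpow_zero, of t "\<lambda>k. 2 ^ k"])
    show "filterlim (\<lambda>k. 2 ^ k :: nat) at_top sequentially"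
      by (rule filterlim_subseq) (simp add: strict_mono_def)
  qed (use t in auto)
  \<comment> \<open>The bound 1/8 gives \<open>norm q' \<le> 1/7\<close>, hence
    \<open>norm q \<le> 1/7 + 1/4 < 1/2\<close>, whereas \<open>x = q - x * q\<close> and
    \<open>norm x = 1\<close> force \<open>norm q \<ge> 1/2\<close>.\<close>
  then have "eventually (\<lambda>k. t ^ 2 ^ k < 1/8) sequentially"
    by (rule order_tendstoD) simp
  then obtain k where k: "t ^ 2 ^ k < 1/8"
    by (meson eventually_sequentially order_refl)
  have cB: "cmod c = 1 / B"
    using B by (simp add: c_def norm_divide)
  obtain q q' where q: "quasi_inverse (iterated_square k (c *\<^sub>C b)) q"
    "quasi_inverse (iterated_square k ((of_real t * c) *\<^sub>C b)) q'" "norm (q - q') \<le> 1/4"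
    using main[of k] cB by blast
  define x where "x = iterated_square k (c *\<^sub>C b)"
  define x' where "x' = iterated_square k ((of_real t * c) *\<^sub>C b)"
  have x: "norm x = 1"
  proof -
    have "star (c *\<^sub>C b) = c *\<^sub>C b"
      by (simp add: star_scaleC sa c_def)
    then show ?thesis
      using norm_iterated_square[of "c *\<^sub>C b" k] B by (simp add: x_def norm_scaleC cB B_def[symmetric])
  qed
  have "(of_real t * c) *\<^sub>C b = of_real t *\<^sub>C (c *\<^sub>C b)"
    by (simp add: scaleC_scaleC)
  then have x': "norm x' = t ^ 2 ^ k"
    using x t by (simp add: x'_def x_def iterated_square_scaleC norm_scaleC norm_power)
  have q'_eq: "q' = x' + x' * q'" and q_eq: "q = x + x * q"
    by (rule q(1,2)[unfolded quasi_inverse_def, THEN conjunct1, folded x_def x'_def])+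
  have "norm q' \<le> norm x' + norm x' * norm q'"
    using arg_cong[OF q'_eq, of norm] norm_triangle_ineq[of x' "x' * q'"] norm_mult_ineq[of x' q']
    by linarith
  also have "\<dots> \<le> 1/8 + 1/8 * norm q'"
    using k x' by (intro add_mono mult_right_mono) auto
  finally have "norm q' \<le> 1/7" by simp
  then have q2: "norm q < 1/2"
    using norm_triangle_sub[of q q'] q(3) by linarith
  have "x = q - x * q"
    using q_eq by (metis add_diff_cancel_right')
  from arg_cong[OF this, of norm] have "norm x \<le> norm q + norm x * norm q"
    using norm_triangle_ineq4[of q "x * q"] norm_mult_ineq[of x q] by linarith
  then show False
    using q2 x by simp
qed

text \<open>The C*-identity reduces the bound to the self-adjoint element
  \<open>star x * x\<close>.\<close>

lemma star_hom_norm_le: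
  assumes f: "star_hom S T f" and S: "cstar_subalgebra S" and x: "x \<in> S"
  shows "norm (f x) \<le> norm x"
proof -
  have sx: "star x \<in> S" "star x * x \<in> S"
    using S x by (auto simp: cstar_subalgebra_def)
  have "star (f x) * f x = f (star x * x)"
    using f x sx unfolding star_hom_def by metis
  then have "(norm (f x))\<^sup>2 = norm (f (star x * x))"
    by (metis cstar_identity)
  also have "\<dots> \<le> norm (star x * x)"
    by (rule star_hom_selfadjoint_le[OF f S]) (use sx in \<open>auto simp: star_mult star_star\<close>)
  also have "\<dots> = (norm x)\<^sup>2"
    by (rule cstar_identity)
  finally show ?thesis
    by (rule power2_le_imp_le) simp
qed

section \<open>Closed subspaces and total sets\<close>

inductive_set cspan :: "'a::complex_vector set \<Rightarrow> 'a set" for S where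
  zero: "0 \<in> cspan S"
| add: "x \<in> cspan S \<Longrightarrow> a \<in> S \<Longrightarrow> x + c *\<^sub>C a \<in> cspan S"

lemma closed_csubspaceD:
  assumes "closed_csubspace S"
  shows "closed S" "0 \<in> S" "\<And>x y. x \<in> S \<Longrightarrow> y \<in> S \<Longrightarrow> x + y \<in> S"
    "\<And>c x. x \<in> S \<Longrightarrow> c *\<^sub>C x \<in> S" "\<And>x y. x \<in> S \<Longrightarrow> y \<in> S \<Longrightarrow> x - y \<in> S"
proof -
  show "closed S" "0 \<in> S" "\<And>x y. x \<in> S \<Longrightarrow> y \<in> S \<Longrightarrow> x + y \<in> S" "\<And>c x. x \<in> S \<Longrightarrow> c *\<^sub>C x \<in> S"
    using assms by (auto simp: closed_csubspace_def)
  then show "x - y \<in> S" if "x \<in> S" "y \<in> S" for x y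
    using that scaleC_minus_left[of 1 y] by (metis diff_conv_add_uminus scaleC_one)
qed

text \<open>Totality is expressed by closed subspaces instead of closures of spans: a property that
  cuts out a closed subspace is then checked on generators, and replacing one generating set by
  another takes no approximation argument.\<close>

definition total_in :: "'a::complex_banach set \<Rightarrow> 'a set \<Rightarrow> bool" where
  "total_in S T \<longleftrightarrow> S \<subseteq> T \<and> (\<forall>C. closed_csubspace C \<longrightarrow> S \<subseteq> C \<longrightarrow> T \<subseteq> C)"

lemma total_in_induct:
  assumes "total_in S T" "x \<in> T" "closed_csubspace {x \<in> T. P x}" "\<And>x. x \<in> S \<Longrightarrow> P x"
  shows "P x"
  using assms unfolding total_in_def by blast

lemma cspan_base: "a \<in> S \<Longrightarrow> a \<in> cspan S"
  using cspan.add[OF cspan.zero, of a S 1] by simp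

lemma cspan_add:
  assumes "y \<in> cspan S" "x \<in> cspan S" shows "x + y \<in> cspan S"
  using assms by induction (auto simp: add.assoc[symmetric] intro: cspan.add)

lemma cspan_scaleC:
  assumes "x \<in> cspan S" shows "c *\<^sub>C x \<in> cspan S"
  using assms by induction (auto simp: scaleC_add_right scaleC_scaleC intro: cspan.intros)

lemma closed_csubspace_closure_cspan: "closed_csubspace (closure (cspan S))"
  unfolding closed_csubspace_def
proof (intro conjI ballI allI)
  show "0 \<in> closure (cspan S)"
    using cspan.zero closure_subset by blast
next
  fix x y assume "x \<in> closure (cspan S)" "y \<in> closure (cspan S)"
  then obtain f g where "\<forall>n. f n \<in> cspan S" "f \<longlonglongrightarrow> x" "\<forall>n. g n \<in> cspan S" "g \<longlonglongrightarrow> y"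
    unfolding closure_sequential by metis
  then show "x + y \<in> closure (cspan S)"
    unfolding closure_sequential by (intro exI[of _ "\<lambda>n. f n + g n"]) (auto intro: cspan_add tendsto_add)
next
  fix c x assume "x \<in> closure (cspan S)"
  then obtain f where f: "\<forall>n. f n \<in> cspan S" "f \<longlonglongrightarrow> x"
    unfolding closure_sequential by metis
  have "(\<lambda>n. f n - x) \<longlonglongrightarrow> 0"
    using f by (simp add: LIM_zero)
  then have "(\<lambda>n. cmod c * norm (f n - x)) \<longlonglongrightarrow> 0"
    by (intro tendsto_mult_right_zero tendsto_norm_zero)
  then have "(\<lambda>n. c *\<^sub>C f n - c *\<^sub>C x) \<longlonglongrightarrow> 0"
    by (simp add: scaleC_diff_right[symmetric] norm_scaleC[symmetric] tendsto_norm_zero_iff)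
  then have "(\<lambda>n. c *\<^sub>C f n) \<longlonglongrightarrow> c *\<^sub>C x"
    by (simp add: LIM_zero_iff)
  with f show "c *\<^sub>C x \<in> closure (cspan S)"
    unfolding closure_sequential by (intro exI[of _ "\<lambda>n. c *\<^sub>C f n"]) (auto intro: cspan_scaleC)
qed simp

lemma total_in_subset_closure_cspan: "total_in S T \<Longrightarrow> T \<subseteq> closure (cspan S)"
  unfolding total_in_def
  using closed_csubspace_closure_cspan closure_subset cspan_base by blast

lemma total_in_self: "total_in T T"
  by (simp add: total_in_def)

lemma total_in_dense: "S \<subseteq> T \<Longrightarrow> T \<subseteq> closure S \<Longrightarrow> total_in S T"
  unfolding total_in_def closed_csubspace_def by (meson closure_minimal subset_trans)

lemma total_in_trans:
  "S \<subseteq> T \<Longrightarrow> (\<And>C. closed_csubspace C \<Longrightarrow> S \<subseteq> C \<Longrightarrow> S' \<subseteq> C) \<Longrightarrow> total_in S' T \<Longrightarrow> total_in S T"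
  unfolding total_in_def by blast

section \<open>Bounded linear maps and isometries\<close>

lemma clinear_mapD:
  assumes "clinear_map S T f"
  shows "\<And>x. x \<in> S \<Longrightarrow> f x \<in> T" "\<And>x y. x \<in> S \<Longrightarrow> y \<in> S \<Longrightarrow> f (x + y) = f x + f y"
    "\<And>c x. x \<in> S \<Longrightarrow> f (c *\<^sub>C x) = c *\<^sub>C f x"
  using assms by (auto simp: clinear_map_def)

lemma clinear_map_0:
  assumes "clinear_map S T f" "0 \<in> S" shows "f 0 = 0"
  using clinear_mapD(3)[OF assms, of 0] by simp

lemma clinear_map_diff:
  assumes "clinear_map S T f" "closed_csubspace S" "x \<in> S" "y \<in> S"
  shows "f (x - y) = f x - f y"
proof -
  have "f ((x - y) + y) = f (x - y) + f y"
    using assms closed_csubspaceD by (intro clinear_mapD(2)) auto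
  then show ?thesis by simp
qed

lemma bounded_clinear_map_continuous:
  assumes "bounded_clinear_map S T f" "closed_csubspace S"
  shows "continuous_on S f"
proof -
  obtain M where f: "clinear_map S T f" and M: "\<And>x. x \<in> S \<Longrightarrow> norm (f x) \<le> M * norm x"
    using assms by (auto simp: bounded_clinear_map_def)
  have "norm (f x) \<le> \<bar>M\<bar> * norm x" if "x \<in> S" for x
    using M[OF that] mult_right_mono[OF abs_ge_self[of M] norm_ge_zero[of x]] by linarith
  then have "dist (f x) (f y) \<le> \<bar>M\<bar> * dist x y" if "x \<in> S" "y \<in> S" for x y
    unfolding dist_norm clinear_map_diff[OF f assms(2) that, symmetric]
    using closed_csubspaceD(5)[OF assms(2)] that by blast
  then have "\<bar>M\<bar>-lipschitz_on S f"
    by (intro lipschitz_onI) auto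
  then show ?thesis
    by (rule lipschitz_on_continuous_on)
qed

lemma bounded_clinear_map_clinear: "bounded_clinear_map S T f \<Longrightarrow> clinear_map S T f"
  by (simp add: bounded_clinear_map_def)

lemma bounded_clinear_map_mem: "bounded_clinear_map S T f \<Longrightarrow> x \<in> S \<Longrightarrow> f x \<in> T"
  using bounded_clinear_map_clinear clinear_mapD(1) by blast

lemma bounded_clinear_map_compose:
  assumes f: "bounded_clinear_map S T f" and g: "bounded_clinear_map T U g"
  shows "bounded_clinear_map S U (\<lambda>x. g (f x))"
proof -
  obtain M where M: "\<And>x. x \<in> S \<Longrightarrow> norm (f x) \<le> M * norm x"
    using f by (auto simp: bounded_clinear_map_def)
  obtain N where N: "\<And>x. x \<in> T \<Longrightarrow> norm (g x) \<le> N * norm x"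
    using g by (auto simp: bounded_clinear_map_def)
  have fT: "\<And>x. x \<in> S \<Longrightarrow> f x \<in> T"
    using f bounded_clinear_map_mem by blast
  have "norm (g (f x)) \<le> (\<bar>N\<bar> * M) * norm x" if "x \<in> S" for x
  proof -
    have "norm (g (f x)) \<le> \<bar>N\<bar> * norm (f x)"
      using N[OF fT[OF that]] mult_right_mono[OF abs_ge_self[of N] norm_ge_zero[of "f x"]] by linarith
    also have "\<dots> \<le> \<bar>N\<bar> * (M * norm x)"
      by (intro mult_left_mono M that) simp
    finally show ?thesis by (simp add: mult.assoc)
  qed
  moreover have "clinear_map S U (\<lambda>x. g (f x))"
    using f g by (auto simp: bounded_clinear_map_def clinear_map_def image_subset_iff)
  ultimately show ?thesis
    unfolding bounded_clinear_map_def by blast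
qed

lemma closed_csubspace_preimage:
  assumes f: "bounded_clinear_map S T f" and S: "closed_csubspace S" and C: "closed_csubspace C"
  shows "closed_csubspace {x \<in> S. f x \<in> C}"
proof -
  have "closed {x \<in> S. f x \<in> C}"
    using continuous_closed_preimage[OF bounded_clinear_map_continuous[OF f S], of C]
      closed_csubspaceD(1)[OF S] closed_csubspaceD(1)[OF C] by (simp add: vimage_def Int_def)
  then show ?thesis
    using closed_csubspaceD[OF S] closed_csubspaceD[OF C] bounded_clinear_map_clinear[OF f]
    by (auto simp: closed_csubspace_def clinear_mapD clinear_map_0)
qed

lemma closed_csubspace_equalizer:
  assumes f: "bounded_clinear_map S T f" and g: "bounded_clinear_map S T' g" and S: "closed_csubspace S"
  shows "closed_csubspace {x \<in> S. f x = g x}"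
proof -
  have "continuous_on S (\<lambda>x. f x - g x)"
    using f g S by (intro continuous_on_diff bounded_clinear_map_continuous)
  then have "closed {x \<in> S. f x = g x}"
    using continuous_closed_preimage[of S "\<lambda>x. f x - g x" "{0}"] closed_csubspaceD(1)[OF S]
    by (simp add: vimage_def Int_def)
  then show ?thesis
    using closed_csubspaceD[OF S] bounded_clinear_map_clinear[OF f] bounded_clinear_map_clinear[OF g]
    by (auto simp: closed_csubspace_def clinear_mapD clinear_map_0)
qed

lemma bounded_clinear_map_eqI:
  assumes "bounded_clinear_map S T f" "bounded_clinear_map S T' g" "closed_csubspace S"
    and "total_in D S" "\<And>x. x \<in> D \<Longrightarrow> f x = g x" "x \<in> S"
  shows "f x = g x"
  using total_in_induct[OF assms(4,6) closed_csubspace_equalizer[OF assms(1-3)]] assms(5) by blast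

lemma isometry_map_bounded: "isometry_map S T f \<Longrightarrow> bounded_clinear_map S T f"
  unfolding isometry_map_def bounded_clinear_map_def by (metis mult_1 order_refl)

lemma isometry_map_mem: "isometry_map S T f \<Longrightarrow> x \<in> S \<Longrightarrow> f x \<in> T"
  by (auto simp: isometry_map_def clinear_map_def)

lemma isometry_map_injD:
  assumes "isometry_map S T f" "closed_csubspace S" "x \<in> S" "y \<in> S" "f x = f y"
  shows "x = y"
proof -
  have "norm (f (x - y)) = norm (x - y)"
    using assms closed_csubspaceD(5) unfolding isometry_map_def by blast
  then show ?thesis
    using assms clinear_map_diff[of S T f x y] by (simp add: isometry_map_def)
qed

lemma isometry_map_id: "isometry_map S S id"
  by (simp add: isometry_map_def clinear_map_def)

text \<open>Cauchy sequences in the image pull back to Cauchy sequences. The purpose is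
  surjectivity: an isometry whose image contains a total set is onto.\<close>

lemma closed_csubspace_isometry_image:
  assumes f: "isometry_map S T f" and S: "closed_csubspace S"
  shows "closed_csubspace (f ` S)"
proof -
  have fl: "clinear_map S T f"
    using f by (simp add: isometry_map_def)
  have "complete (f ` S)"
    unfolding complete_def
  proof safe
    fix s assume s: "\<forall>n. s n \<in> f ` S" "Cauchy s"
    then obtain x where x: "\<And>n. x n \<in> S" "\<And>n. s n = f (x n)"
      unfolding image_iff by metis
    have "dist (s m) (s n) = dist (x m) (x n)" for m n
    proof -
      have "x m - x n \<in> S"
        using closed_csubspaceD(5)[OF S] x by blast
      then have "norm (f (x m - x n)) = norm (x m - x n)"
        using f by (simp add: isometry_map_def)
      then show ?thesis
        by (simp add: dist_norm x(2) clinear_map_diff[OF fl S x(1) x(1)])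
    qed
    then have "Cauchy x"
      using s by (simp add: Cauchy_def)
    then obtain l where l: "x \<longlonglongrightarrow> l"
      using Cauchy_convergent_iff convergent_def by blast
    then have lS: "l \<in> S"
      using closed_csubspaceD(1)[OF S] x closed_sequentially by blast
    have "(\<lambda>n. f (x n)) \<longlonglongrightarrow> f l"
      by (rule continuous_on_tendsto_compose[OF bounded_clinear_map_continuous[OF isometry_map_bounded[OF f] S] l lS])
        (simp add: x(1))
    moreover have "s = (\<lambda>n. f (x n))"
      using x(2) by (rule ext)
    ultimately have "s \<longlonglongrightarrow> f l"
      by simp
    then show "\<exists>l\<in>f ` S. s \<longlonglongrightarrow> l"
      using lS x(2) by auto
  qed
  then have "closed (f ` S)"
    by (rule complete_imp_closed)
  moreover have "0 \<in> f ` S"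
    using imageI[OF closed_csubspaceD(2)[OF S], of f] clinear_map_0[OF fl closed_csubspaceD(2)[OF S]]
    by simp
  moreover have "a + b \<in> f ` S" if "a \<in> f ` S" "b \<in> f ` S" for a b
    using that closed_csubspaceD(3)[OF S] by (auto simp: clinear_mapD(2)[OF fl, symmetric])
  moreover have "c *\<^sub>C a \<in> f ` S" if "a \<in> f ` S" for a c
    using that closed_csubspaceD(4)[OF S] by (auto simp: clinear_mapD(3)[OF fl, symmetric])
  ultimately show ?thesis
    unfolding closed_csubspace_def by blast
qed

lemma cinner_add_right: "cinner x (y + z) = cinner x y + cinner x (z::'a::hilbert_space)"
  by (metis cinner_add_left cinner_commute complex_cnj_add)

lemma cinner_scaleC_right: "cinner x (c *\<^sub>C y) = cnj c * cinner x (y::'a::hilbert_space)"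
  by (metis cinner_scaleC_left cinner_commute complex_cnj_mult)

lemma cinner_zero_left [simp]: "cinner 0 (x::'a::hilbert_space) = 0"
  using cinner_scaleC_left[of 0 x x] by simp

lemma cinner_zero_right [simp]: "cinner x (0::'a::hilbert_space) = 0"
  using cinner_scaleC_right[of x 0 x] by simp

text \<open>Polarization: comparing the norms of \<open>x + c *\<^sub>C y\<close> and its image for
  \<open>c = 1\<close> and \<open>c = \<i>\<close> gives the sum and the difference of the inner
  product and its conjugate.\<close>

lemma isometry_map_cinner:
  assumes f: "isometry_map S T f" and S: "closed_csubspace S" and x: "x \<in> S" and y: "y \<in> S"
  shows "cinner (f x) (f y) = cinner x y"
proof -
  have n: "cinner (f z) (f z) = cinner z z" if "z \<in> S" for z
    using f that by (simp add: isometry_map_def cinner_self)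
  have fl: "clinear_map S T f"
    using f by (simp add: isometry_map_def)
  have *: "cinner (f x) (f y) * cnj c + cinner (f y) (f x) * c = cinner x y * cnj c + cinner y x * c" for c
  proof -
    have "x + c *\<^sub>C y \<in> S"
      using closed_csubspaceD[OF S] x y by blast
    then have "cinner (f x + c *\<^sub>C f y) (f x + c *\<^sub>C f y) = cinner (x + c *\<^sub>C y) (x + c *\<^sub>C y)"
      using n[of "x + c *\<^sub>C y"] clinear_mapD[OF fl] closed_csubspaceD[OF S] x y by simp
    then show ?thesis
      by (simp add: cinner_add_left cinner_add_right cinner_scaleC_left cinner_scaleC_right n x y algebra_simps)
  qed
  have 1: "cinner (f x) (f y) + cinner (f y) (f x) = cinner x y + cinner y x"
    using *[of 1] by simp
  have "\<i> * (cinner (f y) (f x) - cinner (f x) (f y)) = \<i> * (cinner y x - cinner x y)"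
    using *[of \<i>] by (simp add: right_diff_distrib mult.commute)
  then have 2: "cinner (f y) (f x) - cinner (f x) (f y) = cinner y x - cinner x y"
    by simp
  have "2 * cinner (f x) (f y) = (cinner (f x) (f y) + cinner (f y) (f x)) - (cinner (f y) (f x) - cinner (f x) (f y))"
    by simp
  also have "\<dots> = 2 * cinner x y"
    unfolding 1 2 by simp
  finally show ?thesis by simp
qed

section \<open>Isometries from equal Gram matrices\<close>

text \<open>A linear relation and not a map, because an assignment on generators need not be well
  defined on their linear combinations until the Gram matrices have been compared.\<close>

inductive_set cspan_pairs :: "('h::complex_vector \<times> 'k::complex_vector) set \<Rightarrow> ('h \<times> 'k) set" for P where
  zero: "(0, 0) \<in> cspan_pairs P"
| add: "(x, y) \<in> cspan_pairs P \<Longrightarrow> (a, b) \<in> P \<Longrightarrow> (x + c *\<^sub>C a, y + c *\<^sub>C b) \<in> cspan_pairs P"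

lemma cspan_pairs_add:
  "(x', y') \<in> cspan_pairs P \<Longrightarrow> (x, y) \<in> cspan_pairs P \<Longrightarrow> (x + x', y + y') \<in> cspan_pairs P"
  by (induction rule: cspan_pairs.induct) (auto simp: add.assoc[symmetric] intro: cspan_pairs.add)

lemma cspan_pairs_scaleC: "(x, y) \<in> cspan_pairs P \<Longrightarrow> (c *\<^sub>C x, c *\<^sub>C y) \<in> cspan_pairs P"
  by (induction rule: cspan_pairs.induct) (auto simp: scaleC_add_right scaleC_scaleC intro: cspan_pairs.intros)

text \<open>The Gram condition extends to linear combinations in one argument of the inner product
  after the other; the norms are its diagonal case.\<close>

lemma cspan_pairs_norm:
  fixes P :: "('h::hilbert_space \<times> 'k::hilbert_space) set"
  assumes gram: "\<And>x y x' y'. (x, y) \<in> P \<Longrightarrow> (x', y') \<in> P \<Longrightarrow> cinner x x' = cinner y y'"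
    and "(x, y) \<in> cspan_pairs P"
  shows "norm x = norm y"
proof -
  have 1: "cinner x a = cinner y b" if "(x, y) \<in> cspan_pairs P" "(a, b) \<in> P" for x y a b
    using that by (induction rule: cspan_pairs.induct)
      (auto simp: cinner_add_left cinner_scaleC_left gram)
  have 2: "cinner x z = cinner y w" if "(z, w) \<in> cspan_pairs P" "(x, y) \<in> cspan_pairs P" for x y z w
    using that by (induction rule: cspan_pairs.induct)
      (auto simp: cinner_add_right cinner_scaleC_right 1)
  have "complex_of_real ((norm x)\<^sup>2) = complex_of_real ((norm y)\<^sup>2)"
    using 2[OF assms(2,2)] by (simp only: cinner_self)
  then show ?thesis
    by (simp only: of_real_eq_iff) simp
qed

text \<open>The relation \<open>G\<close> is the closure of \<open>cspan_pairs P\<close>. As it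
  preserves norms, it is single-valued and, by completeness, defined on all of \<open>S\<close>; the
  isometry is the function with this graph.\<close>

lemma isometric_extension:
  fixes P :: "('h::hilbert_space \<times> 'k::hilbert_space) set"
  assumes gram: "\<And>x y x' y'. (x, y) \<in> P \<Longrightarrow> (x', y') \<in> P \<Longrightarrow> cinner x x' = cinner y y'"
    and S: "closed_csubspace S" and T: "closed_csubspace T"
    and tot: "total_in (fst ` P) S" and PT: "snd ` P \<subseteq> T"
  obtains f where "isometry_map S T f" "\<And>x y. (x, y) \<in> P \<Longrightarrow> f x = y"
proof -
  define G where "G x y \<longleftrightarrow> (\<exists>s t. (\<forall>n::nat. (s n, t n) \<in> cspan_pairs P) \<and> s \<longlonglongrightarrow> x \<and> t \<longlonglongrightarrow> y)" for x y
  have QT: "y \<in> T" if "(x, y) \<in> cspan_pairs P" for x y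
    using that by (induction rule: cspan_pairs.induct)
      (use PT closed_csubspaceD[OF T] in \<open>auto simp: image_subset_iff\<close>)
  have GT: "y \<in> T" if g: "G x y" for x y
  proof -
    obtain s t where st: "\<forall>n. (s n, t n) \<in> cspan_pairs P" "s \<longlonglongrightarrow> x" "t \<longlonglongrightarrow> y"
      using g unfolding G_def by blast
    show ?thesis
      by (rule closed_sequentially[OF closed_csubspaceD(1)[OF T] _ st(3)]) (use st(1) QT in blast)
  qed
  have Gadd: "G (x + x') (y + y')" if xy: "G x y" "G x' y'" for x x' y y'
  proof -
    obtain s t where st: "\<forall>n. (s n, t n) \<in> cspan_pairs P" "s \<longlonglongrightarrow> x" "t \<longlonglongrightarrow> y"
      using xy(1) unfolding G_def by blast
    obtain s' t' where st': "\<forall>n. (s' n, t' n) \<in> cspan_pairs P" "s' \<longlonglongrightarrow> x'" "t' \<longlonglongrightarrow> y'"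
      using xy(2) unfolding G_def by blast
    show ?thesis
      unfolding G_def
      by (rule exI[of _ "\<lambda>n. s n + s' n"], rule exI[of _ "\<lambda>n. t n + t' n"])
        (intro conjI allI tendsto_add st st' cspan_pairs_add; use st st' in blast)
  qed
  have sc: "(\<lambda>n. c *\<^sub>C s n) \<longlonglongrightarrow> c *\<^sub>C l" if "s \<longlonglongrightarrow> l" for s and l :: "'z::complex_banach" and c
  proof -
    have "bounded_clinear_map UNIV UNIV (\<lambda>x::'z. c *\<^sub>C x)"
      unfolding bounded_clinear_map_def clinear_map_def
      by (auto simp: scaleC_add_right scaleC_scaleC mult.commute norm_scaleC intro!: exI[of _ "cmod c"])
    then have "continuous_on UNIV (\<lambda>x::'z. c *\<^sub>C x)"
      by (rule bounded_clinear_map_continuous) (simp add: closed_csubspace_def)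
    then show ?thesis
      using that unfolding continuous_on_sequentially by (simp add: o_def)
  qed
  have Gsc: "G (c *\<^sub>C x) (c *\<^sub>C y)" if g: "G x y" for x y c
  proof -
    obtain s t where st: "\<forall>n. (s n, t n) \<in> cspan_pairs P" "s \<longlonglongrightarrow> x" "t \<longlonglongrightarrow> y"
      using g unfolding G_def by blast
    show ?thesis
      unfolding G_def
      by (rule exI[of _ "\<lambda>n. c *\<^sub>C s n"], rule exI[of _ "\<lambda>n. c *\<^sub>C t n"])
        (intro conjI allI sc st cspan_pairs_scaleC; use st in blast)
  qed
  have Gnorm: "norm x = norm y" if g: "G x y" for x y
  proof -
    obtain s t where st: "\<forall>n. (s n, t n) \<in> cspan_pairs P" "s \<longlonglongrightarrow> x" "t \<longlonglongrightarrow> y"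
      using g unfolding G_def by blast
    have "norm (s n) = norm (t n)" for n
      by (rule cspan_pairs_norm[OF gram]) (use st(1) in auto)
    then have "(\<lambda>n. norm (t n)) \<longlonglongrightarrow> norm x"
      using tendsto_norm[OF st(2)] by simp
    then show ?thesis
      using tendsto_norm[OF st(3)] by (rule LIMSEQ_unique)
  qed
  have ex: "\<exists>y. G x y" if x: "x \<in> S" for x
  proof -
    have "x \<in> closure (cspan (fst ` P))"
      using total_in_subset_closure_cspan[OF tot] x by blast
    then obtain s where s: "\<forall>n. s n \<in> cspan (fst ` P)" "s \<longlonglongrightarrow> x"
      unfolding closure_sequential by blast
    have "\<exists>y. (z, y) \<in> cspan_pairs P" if "z \<in> cspan (fst ` P)" for z
      using that
    proof induction
      case zero
      show ?case using cspan_pairs.zero by blast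
    next
      case (add x a c)
      then obtain y b where "(x, y) \<in> cspan_pairs P" "(a, b) \<in> P" by auto
      then show ?case by (blast intro: cspan_pairs.add)
    qed
    then have "\<forall>n. \<exists>y. (s n, y) \<in> cspan_pairs P"
      using s(1) by blast
    then obtain t where t: "\<And>n. (s n, t n) \<in> cspan_pairs P"
      by metis
    \<comment> \<open>Differences of related pairs are related, so the partners of a convergent
      sequence form a Cauchy sequence.\<close>
    have "dist (t m) (t n) = dist (s m) (s n)" for m n
    proof -
      have "(s m + (-1) *\<^sub>C s n, t m + (-1) *\<^sub>C t n) \<in> cspan_pairs P"
        by (intro cspan_pairs_add cspan_pairs_scaleC t)
      then have "norm (s m + (-1) *\<^sub>C s n) = norm (t m + (-1) *\<^sub>C t n)"
        by (rule cspan_pairs_norm[OF gram, rotated 2])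
      then show ?thesis
        by (simp add: dist_norm)
    qed
    then have "Cauchy t"
      using LIMSEQ_imp_Cauchy[OF s(2)] by (simp add: Cauchy_def)
    then obtain y where "t \<longlonglongrightarrow> y"
      using Cauchy_convergent_iff convergent_def by blast
    then show ?thesis
      using s(2) t unfolding G_def by blast
  qed
  \<comment> \<open>The difference of the two pairs has first component 0, hence its second
    component has norm 0.\<close>
  have uniq: "y = y'" if "G x y" "G x y'" for x y y'
    using Gnorm[OF Gadd[OF that(1) Gsc[OF that(2), of "-1"]]] by simp
  obtain f where f: "\<And>x. x \<in> S \<Longrightarrow> G x (f x)"
    using ex by metis
  show thesis
  proof
    show "isometry_map S T f"
      unfolding isometry_map_def clinear_map_def
    proof (intro conjI ballI allI)
      show "f ` S \<subseteq> T" using f GT by blast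
      show "f (x + y) = f x + f y" if "x \<in> S" "y \<in> S" for x y
        using that closed_csubspaceD(3)[OF S] by (intro uniq[OF f Gadd] f) auto
      show "f (c *\<^sub>C x) = c *\<^sub>C f x" if "x \<in> S" for c x
        using that closed_csubspaceD(4)[OF S] by (intro uniq[OF f Gsc] f) auto
      show "norm (f x) = norm x" if "x \<in> S" for x
        using Gnorm[OF f[OF that]] by simp
    qed
    fix x y assume xy: "(x, y) \<in> P"
    then have "(x, y) \<in> cspan_pairs P"
      using cspan_pairs.add[OF cspan_pairs.zero xy, of 1] by simp
    then have "G x y"
      unfolding G_def by (intro exI[of _ "\<lambda>_. x"] exI[of _ "\<lambda>_. y"] conjI allI tendsto_const)
    moreover have "x \<in> S"
      using xy tot by (force simp: total_in_def)
    ultimately show "f x = y"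
      using uniq f by blast
  qed
qed

section \<open>Hilbert space tensor products\<close>

lemma bilinear_map_mem: "bilinear_map A B L \<tau> \<Longrightarrow> a \<in> A \<Longrightarrow> b \<in> B \<Longrightarrow> \<tau> a b \<in> L"
  unfolding bilinear_map_def using clinear_mapD(1) by blast

lemma total_in_tensor_sums:
  assumes "closure (tensor_sums A B \<tau>) = L" "closed_csubspace L" "bilinear_map A B L \<tau>"
  shows "total_in {\<tau> a b |a b. a \<in> A \<and> b \<in> B} L"
proof -
  have sub: "{\<tau> a b |a b. a \<in> A \<and> b \<in> B} \<subseteq> L"
    using bilinear_map_mem[OF assms(3)] by auto
  have "tensor_sums A B \<tau> \<subseteq> C" if C: "closed_csubspace C" "{\<tau> a b |a b. a \<in> A \<and> b \<in> B} \<subseteq> C" for C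
  proof -
    have "(\<Sum>i<n. \<tau> (a i) (b i)) \<in> C" if "\<forall>i<n. a i \<in> A \<and> b i \<in> B" for n and a b :: "nat \<Rightarrow> 'a"
      using that by (induction n) (use C closed_csubspaceD[OF C(1)] in auto)
    then show ?thesis
      by (auto simp: tensor_sums_def)
  qed
  then have "L \<subseteq> C" if "closed_csubspace C" "{\<tau> a b |a b. a \<in> A \<and> b \<in> B} \<subseteq> C" for C
    unfolding assms(1)[symmetric] using that closed_csubspaceD(1) by (intro closure_minimal)
  then show ?thesis
    unfolding total_in_def using sub by blast
qed

lemma hilbert_tensor_bounded:
  assumes u: "hilbert_tensor H K L u"
  shows "x \<in> H \<Longrightarrow> bounded_clinear_map K L (u x)"
    and "y \<in> K \<Longrightarrow> bounded_clinear_map H L (\<lambda>x. u x y)"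
proof -
  have n: "norm (u x y) = norm x * norm y" if "x \<in> H" "y \<in> K" for x y
  proof -
    have "cinner (u x y) (u x y) = cinner x x * cinner y y"
      using u that unfolding hilbert_tensor_def by blast
    then have "complex_of_real ((norm (u x y))\<^sup>2) = complex_of_real ((norm x * norm y)\<^sup>2)"
      by (simp only: cinner_self power_mult_distrib of_real_mult)
    then show ?thesis
      unfolding of_real_eq_iff by (rule power2_eq_imp_eq) simp_all
  qed
  show "bounded_clinear_map K L (u x)" if "x \<in> H"
    unfolding bounded_clinear_map_def
  proof
    show "clinear_map K L (u x)"
      using u that unfolding hilbert_tensor_def bilinear_map_def by blast
    show "\<exists>M. \<forall>y\<in>K. norm (u x y) \<le> M * norm y"
      by (rule exI[of _ "norm x"]) (simp add: n that)
  qed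
  show "bounded_clinear_map H L (\<lambda>x. u x y)" if "y \<in> K"
    unfolding bounded_clinear_map_def
  proof
    show "clinear_map H L (\<lambda>x. u x y)"
      using u that unfolding hilbert_tensor_def bilinear_map_def by blast
    show "\<exists>M. \<forall>x\<in>H. norm (u x y) \<le> M * norm x"
      by (rule exI[of _ "norm y"]) (simp add: n that mult.commute)
  qed
qed

lemma hilbert_tensor_mem: "hilbert_tensor H K L u \<Longrightarrow> x \<in> H \<Longrightarrow> y \<in> K \<Longrightarrow> u x y \<in> L"
  using hilbert_tensor_bounded(1) bounded_clinear_map_mem by blast

text \<open>The factors are enlarged one at a time, first the right one from \<open>S'\<close> to
  \<open>K\<close> and then the left one from \<open>S\<close> to \<open>H\<close>, by continuity of
  \<open>u\<close> in each argument.\<close>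

lemma hilbert_tensor_total:
  assumes u: "hilbert_tensor H K L u" and H: "closed_csubspace H" and K: "closed_csubspace K"
    and S: "total_in S H" and S': "total_in S' K"
  shows "total_in {u x y |x y. x \<in> S \<and> y \<in> S'} L"
proof (rule total_in_trans)
  show "total_in {u x y |x y. x \<in> H \<and> y \<in> K} L"
    using u by (intro total_in_tensor_sums) (auto simp: hilbert_tensor_def)
  show "{u x y |x y. x \<in> S \<and> y \<in> S'} \<subseteq> L"
    using hilbert_tensor_mem[OF u] S S' by (auto simp: total_in_def subset_iff)
  fix C assume C: "closed_csubspace C" and sub: "{u x y |x y. x \<in> S \<and> y \<in> S'} \<subseteq> C"
  have 1: "u x y \<in> C" if x: "x \<in> S" and y: "y \<in> K" for x y
    using S' y
  proof (rule total_in_induct)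
    show "closed_csubspace {y \<in> K. u x y \<in> C}"
      using x S by (intro closed_csubspace_preimage[OF hilbert_tensor_bounded(1)[OF u] K C]) (auto simp: total_in_def)
  qed (use x sub in blast)
  have "u x y \<in> C" if x: "x \<in> H" and y: "y \<in> K" for x y
    using S x
  proof (rule total_in_induct)
    show "closed_csubspace {x \<in> H. u x y \<in> C}"
      by (intro closed_csubspace_preimage[OF hilbert_tensor_bounded(2)[OF u y] H C])
  qed (use y 1 in blast)
  then show "{u x y |x y. x \<in> H \<and> y \<in> K} \<subseteq> C"
    by blast
qed

text \<open>Inner products of elementary tensors are products of inner products, so tensoring
  \<open>f\<close> and \<open>g\<close> preserves the Gram matrix and
  \<open>isometric_extension\<close> applies.\<close>

lemma tensor_operator_isometries:
  assumes u: "hilbert_tensor H K L u" and H: "closed_csubspace H" and K: "closed_csubspace K"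
    and u': "hilbert_tensor H' K' L' u'"
    and f: "isometry_map H H' f" and g: "isometry_map K K' g"
  obtains h where "tensor_operator H K L u L' u' f g h"
proof -
  define P where "P = {(u x y, u' (f x) (g y)) |x y. x \<in> H \<and> y \<in> K}"
  have fm: "\<And>x. x \<in> H \<Longrightarrow> f x \<in> H'" and gm: "\<And>x. x \<in> K \<Longrightarrow> g x \<in> K'"
    using f g isometry_map_mem by blast+
  have L: "closed_csubspace L" and L': "closed_csubspace L'"
    using u u' by (auto simp: hilbert_tensor_def)
  obtain h where h: "isometry_map L L' h" "\<And>x y. (x, y) \<in> P \<Longrightarrow> h x = y"
  proof (rule isometric_extension[OF _ L L', of P])
    fix x y x' y' assume "(x, y) \<in> P" "(x', y') \<in> P"
    then obtain a b a' b' where ab: "a \<in> H" "b \<in> K" "a' \<in> H" "b' \<in> K"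
      and xy: "x = u a b" "y = u' (f a) (g b)" "x' = u a' b'" "y' = u' (f a') (g b')"
      by (auto simp: P_def)
    have "cinner (u a b) (u a' b') = cinner a a' * cinner b b'"
      using u ab unfolding hilbert_tensor_def by blast
    also have "\<dots> = cinner (f a) (f a') * cinner (g b) (g b')"
      by (simp only: isometry_map_cinner[OF f H] isometry_map_cinner[OF g K] ab)
    also have "\<dots> = cinner (u' (f a) (g b)) (u' (f a') (g b'))"
      using u' fm[OF ab(1)] fm[OF ab(3)] gm[OF ab(2)] gm[OF ab(4)] unfolding hilbert_tensor_def by metis
    finally show "cinner x x' = cinner y y'"
      unfolding xy .
  next
    have "fst ` P = {u x y |x y. x \<in> H \<and> y \<in> K}"
      by (force simp: P_def)
    then show "total_in (fst ` P) L"
      using hilbert_tensor_total[OF u H K total_in_self total_in_self] by simp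
    show "snd ` P \<subseteq> L'"
      using hilbert_tensor_mem[OF u'] fm gm by (auto simp: P_def)
  qed blast
  have "tensor_operator H K L u L' u' f g h"
    unfolding tensor_operator_def using isometry_map_bounded[OF h(1)] h(2) by (auto simp: P_def)
  then show thesis by (rule that)
qed

section \<open>Partitions\<close>

lemma partsD:
  assumes "I \<in> parts s t"
  shows "0 < s" "s < t" "finite I" "s \<in> I" "t \<in> I" "\<And>x. x \<in> I \<Longrightarrow> s \<le> x" "\<And>x. x \<in> I \<Longrightarrow> x \<le> t"
  using assms by (auto simp: parts_def)

lemma parts_pair: "0 < s \<Longrightarrow> s < t \<Longrightarrow> {s, t} \<in> parts s t"
  by (auto simp: parts_def)

lemma parts_triple: "0 < r \<Longrightarrow> r < s \<Longrightarrow> s < t \<Longrightarrow> {r, s, t} \<in> parts r t"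
  by (auto simp: parts_def)

lemma parts_Un: "I \<in> parts r s \<Longrightarrow> J \<in> parts s t \<Longrightarrow> I \<union> J \<in> parts r t"
  by (auto simp: parts_def)

lemma parts_restrict:
  assumes "I \<in> parts s t" "p \<in> I" "s < p" "p < t"
  shows "I \<inter> {s..p} \<in> parts s p" "I \<inter> {p..t} \<in> parts p t" "(I \<inter> {s..p}) \<union> (I \<inter> {p..t}) = I"
  using assms by (auto simp: parts_def)

text \<open>This allows families such as \<open>X\<close> to be indexed by the partition
  alone.\<close>

lemma parts_unique:
  assumes "I \<in> parts s t" "I \<in> parts s' t'"
  shows "s = s'" "t = t'"
  using partsD(4-7)[OF assms(1)] partsD(4-7)[OF assms(2)] by (meson antisym)+

text \<open>The recursion for the connecting maps is written with \<open>Max (I - {t})\<close>;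
  these facts turn it into the form in which the interval from \<open>p\<close> to \<open>t\<close>
  is appended to a partition \<open>I\<close>.\<close>

lemma parts_last:
  assumes "I \<in> parts s p" "p < t"
  shows "(I \<union> {p, t}) - {t} = I" "Max I = p" "card (I \<union> {p, t}) \<ge> 3" "I \<union> {p, t} \<in> parts s t"
proof -
  note I = partsD[OF assms(1)]
  have t: "t \<notin> I" using I(7) assms(2) by force
  then show "(I \<union> {p, t}) - {t} = I"
    using I(5) assms(2) by auto
  show "Max I = p"
    using I by (intro Max_eqI) auto
  have "card {s, p, t} \<le> card (I \<union> {p, t})"
    using I by (intro card_mono) auto
  then show "card (I \<union> {p, t}) \<ge> 3"
    using I(2) assms(2) by simp
  show "I \<union> {p, t} \<in> parts s t"
    using I assms(2) by (intro parts_Un[OF assms(1) parts_pair]) auto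
qed

lemma parts_split_last:
  assumes I: "I \<in> parts s t" and ne: "I \<noteq> {s, t}"
  obtains p where "I - {t} \<in> parts s p" "p < t" "I = (I - {t}) \<union> {p, t}"
proof -
  note D = partsD[OF I]
  define p where "p = Max (I - {t})"
  have s: "s \<in> I - {t}" using D by auto
  have fin: "finite (I - {t})" using D by auto
  have p: "p \<in> I - {t}"
    unfolding p_def using fin s by (intro Max_in) auto
  obtain q where q: "q \<in> I" "q \<noteq> s" "q \<noteq> t"
    using ne D by blast
  then have "q \<le> p" "s < q"
    using fin D(6)[OF q(1)] by (auto simp: p_def)
  moreover have "\<forall>x\<in>I - {t}. x \<le> p"
    using fin by (simp add: p_def)
  moreover have "p < t"
    using p D(7)[of p] by auto
  ultimately have "I - {t} \<in> parts s p"
    using D s p unfolding parts_def by auto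
  then show thesis
    using \<open>p < t\<close> p D(5) by (intro that[of p]) auto
qed

text \<open>Induction in the direction of the recursion for the connecting maps: the last interval
  is appended, so the left endpoint stays fixed while the right one moves.\<close>

lemma parts_induct [consumes 1, case_names pair last]:
  assumes "I \<in> parts s t"
    and "\<And>s t. 0 < s \<Longrightarrow> s < t \<Longrightarrow> P s t {s, t}"
    and "\<And>s p t I. I \<in> parts s p \<Longrightarrow> p < t \<Longrightarrow> P s p I \<Longrightarrow> P s t (I \<union> {p, t})"
  shows "P s t I"
  using assms(1)
proof (induction "card I" arbitrary: s t I rule: less_induct)
  case less
  show ?case
  proof (cases "I = {s, t}")
    case True
    then show ?thesis using assms(2) partsD[OF less.prems] by simp
  next
    case False
    then obtain p where p: "I - {t} \<in> parts s p" "p < t" "I = (I - {t}) \<union> {p, t}"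
      using parts_split_last[OF less.prems] by metis
    have "card (I - {t}) < card I"
      using partsD[OF less.prems] by (intro psubset_card_mono) auto
    then have "P s p (I - {t})"
      using less.hyps p(1) by blast
    then have "P s t ((I - {t}) \<union> {p, t})"
      by (rule assms(3)[OF p(1,2)])
    then show ?thesis
      using p(3) by simp
  qed
qed

section \<open>Realizations of the inductive limit of a system of Hilbert spaces\<close>

lemma hilbert_tensor_systemD:
  assumes "hilbert_tensor_system H u"
  shows "\<And>s t I. I \<in> parts s t \<Longrightarrow> closed_csubspace (H I)"
    and "\<And>r s t I J. I \<in> parts r s \<Longrightarrow> J \<in> parts s t \<Longrightarrow> hilbert_tensor (H I) (H J) (H (I \<union> J)) (u I J)"
    and "\<And>r s t v I J L x y z. I \<in> parts r s \<Longrightarrow> J \<in> parts s t \<Longrightarrow> L \<in> parts t v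
      \<Longrightarrow> x \<in> H I \<Longrightarrow> y \<in> H J \<Longrightarrow> z \<in> H L \<Longrightarrow> u (I \<union> J) L (u I J x y) z = u I (J \<union> L) x (u J L y z)"
  using assms unfolding hilbert_tensor_system_def by blast+

lemma hilbert_tensor_system_pairs:
  assumes "hilbert_tensor_system H u" "0 < r" "r < s" "s < t"
  shows "hilbert_tensor (H {r, s}) (H {s, t}) (H {r, s, t}) (u {r, s} {s, t})"
proof -
  have "{r, s} \<union> {s, t} = {r, s, t}" by auto
  then show ?thesis
    using hilbert_tensor_systemD(2)[OF assms(1) parts_pair parts_pair, of r s t] assms(2-4) by simp
qed

lemma total_in_image:
  assumes "bounded_clinear_map S T f" "closed_csubspace S" "closed_csubspace C" "total_in D S"
    and "\<And>x. x \<in> D \<Longrightarrow> f x \<in> C" "x \<in> S"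
  shows "f x \<in> C"
  by (rule total_in_induct[OF assms(4,6) closed_csubspace_preimage[OF assms(1-3)]]) (rule assms(5))

locale hilbert_inductive_system =
  fixes H :: "real set \<Rightarrow> 'h::hilbert_space set" and u and W
  assumes tensor_system: "hilbert_tensor_system H u"
    and W_mem: "\<And>s t I J x. I \<in> parts s t \<Longrightarrow> J \<in> parts s t \<Longrightarrow> I \<subseteq> J \<Longrightarrow> x \<in> H I \<Longrightarrow> W I J x \<in> H J"
begin

lemmas H_closed = hilbert_tensor_systemD(1)[OF tensor_system]
lemmas H_tensor = hilbert_tensor_systemD(2)[OF tensor_system]
lemmas u_assoc = hilbert_tensor_systemD(3)[OF tensor_system]

lemma u_mem: "I \<in> parts r s \<Longrightarrow> J \<in> parts s t \<Longrightarrow> x \<in> H I \<Longrightarrow> y \<in> H J \<Longrightarrow> u I J x y \<in> H (I \<union> J)"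
  using hilbert_tensor_mem[OF H_tensor] .

lemma u_total:
  "I \<in> parts r s \<Longrightarrow> J \<in> parts s t \<Longrightarrow> total_in S (H I) \<Longrightarrow> total_in S' (H J)
    \<Longrightarrow> total_in {u I J x y |x y. x \<in> S \<and> y \<in> S'} (H (I \<union> J))"
  by (rule hilbert_tensor_total[OF H_tensor H_closed H_closed])

end

text \<open>An arbitrary realization of the limit over \<open>W\<close>. The maps \<open>N\<close>
  are only assumed isometric with a product formula on elementary tensors; their surjectivity and
  coassociativity, and the uniqueness of the realization, are consequences.\<close>

locale hilbert_limit = hilbert_inductive_system H u W
  for H :: "real set \<Rightarrow> 'h::hilbert_space set" and u W +
  fixes K :: "real set \<Rightarrow> 'k::hilbert_space set" and w N Y
  assumes limit_tensor_system: "hilbert_tensor_system K w"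
    and Y_isometry: "\<And>s t I. I \<in> parts s t \<Longrightarrow> isometry_map (H I) (K {s, t}) (Y I)"
    and Y_W: "\<And>s t I J x. I \<in> parts s t \<Longrightarrow> J \<in> parts s t \<Longrightarrow> I \<subseteq> J \<Longrightarrow> x \<in> H I \<Longrightarrow> Y J (W I J x) = Y I x"
    and Y_dense: "\<And>s t. 0 < s \<Longrightarrow> s < t \<Longrightarrow> K {s, t} \<subseteq> closure (\<Union>I\<in>parts s t. Y I ` H I)"
    and N_isometry: "\<And>r s t. 0 < r \<Longrightarrow> r < s \<Longrightarrow> s < t \<Longrightarrow> isometry_map (K {r, t}) (K {r, s, t}) (N r s t)"
    and N_Y: "\<And>r s t I J x y. I \<in> parts r s \<Longrightarrow> J \<in> parts s t \<Longrightarrow> x \<in> H I \<Longrightarrow> y \<in> H J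
      \<Longrightarrow> N r s t (Y (I \<union> J) (u I J x y)) = w {r, s} {s, t} (Y I x) (Y J y)"
begin

lemmas K_closed = hilbert_tensor_systemD(1)[OF limit_tensor_system]
lemmas K_tensor = hilbert_tensor_systemD(2)[OF limit_tensor_system]
lemmas w_assoc = hilbert_tensor_systemD(3)[OF limit_tensor_system]

lemma K_pair_closed: "0 < s \<Longrightarrow> s < t \<Longrightarrow> closed_csubspace (K {s, t})"
  by (rule K_closed[OF parts_pair])

lemma Y_mem: "I \<in> parts s t \<Longrightarrow> x \<in> H I \<Longrightarrow> Y I x \<in> K {s, t}"
  by (rule isometry_map_mem[OF Y_isometry])

text \<open>Since \<open>Y I x = Y (I \<union> E) (W I (I \<union> E) x)\<close>, prescribing
  finitely many partition points loses no vector. A prescribed point is one where the tensor product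
  can be split; \<open>E = {}\<close> gives the plain union.\<close>

lemma Y_total:
  assumes st: "0 < s" "s < t" and E: "finite E" "E \<subseteq> {s..t}"
  shows "total_in {Y I x |I x. I \<in> parts s t \<and> E \<subseteq> I \<and> x \<in> H I} (K {s, t})"
proof (rule total_in_dense)
  show "{Y I x |I x. I \<in> parts s t \<and> E \<subseteq> I \<and> x \<in> H I} \<subseteq> K {s, t}"
    using Y_mem by auto
  have "Y I x \<in> {Y I x |I x. I \<in> parts s t \<and> E \<subseteq> I \<and> x \<in> H I}" if I: "I \<in> parts s t" and x: "x \<in> H I" for I x
  proof -
    have J: "I \<union> E \<in> parts s t"
      using I E by (auto simp: parts_def)
    have "Y (I \<union> E) (W I (I \<union> E) x) = Y I x" "W I (I \<union> E) x \<in> H (I \<union> E)"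
      using Y_W[OF I J _ x] W_mem[OF I J _ x] by auto
    then show ?thesis
      using J by (intro CollectI exI[of _ "I \<union> E"] exI[of _ "W I (I \<union> E) x"]) auto
  qed
  then have "(\<Union>I\<in>parts s t. Y I ` H I) \<subseteq> {Y I x |I x. I \<in> parts s t \<and> E \<subseteq> I \<and> x \<in> H I}"
    by blast
  then show "K {s, t} \<subseteq> closure {Y I x |I x. I \<in> parts s t \<and> E \<subseteq> I \<and> x \<in> H I}"
    using Y_dense[OF st] closure_mono by blast
qed

lemma Y_total_split:
  assumes "0 < r" "r < s" "s < t"
  shows "total_in {Y (I \<union> J) (u I J x y) |I J x y. I \<in> parts r s \<and> J \<in> parts s t \<and> x \<in> H I \<and> y \<in> H J} (K {r, t})"
proof (rule total_in_trans[OF _ _ Y_total[of r t "{s}"]])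
  show "{Y (I \<union> J) (u I J x y) |I J x y. I \<in> parts r s \<and> J \<in> parts s t \<and> x \<in> H I \<and> y \<in> H J} \<subseteq> K {r, t}"
    using Y_mem[OF parts_Un u_mem] by auto
  fix C assume C: "closed_csubspace C"
    "{Y (I \<union> J) (u I J x y) |I J x y. I \<in> parts r s \<and> J \<in> parts s t \<and> x \<in> H I \<and> y \<in> H J} \<subseteq> C"
  have "Y M z \<in> C" if M: "M \<in> parts r t" "s \<in> M" and z: "z \<in> H M" for M z
  proof -
    define I where "I = M \<inter> {r..s}"
    define J where "J = M \<inter> {s..t}"
    have IJ: "I \<in> parts r s" "J \<in> parts s t" and Meq: "I \<union> J = M"
      using parts_restrict[OF M] assms by (auto simp: I_def J_def)
    have tot: "total_in {u I J x y |x y. x \<in> H I \<and> y \<in> H J} (H M)"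
      using u_total[OF IJ total_in_self total_in_self] by (simp add: Meq)
    show ?thesis
    proof (rule total_in_image[OF isometry_map_bounded[OF Y_isometry[OF M(1)]] H_closed[OF M(1)] C(1) tot _ z])
      fix a assume "a \<in> {u I J x y |x y. x \<in> H I \<and> y \<in> H J}"
      then show "Y M a \<in> C"
        using C(2) IJ unfolding Meq[symmetric] by blast
    qed
  qed
  then show "{Y I x |I x. I \<in> parts r t \<and> {s} \<subseteq> I \<and> x \<in> H I} \<subseteq> C"
    by auto
qed (use assms in auto)

text \<open>Generators for testing coassociativity: every partition is refined to contain
  \<open>s\<close> and \<open>t\<close>, and its tensor product is then split at both
  points.\<close>

lemma Y_total_split3:
  assumes "0 < r" "r < s" "s < t" "t < v"
  shows "total_in {Y (I \<union> (J \<union> L)) (u I (J \<union> L) x (u J L y z)) |I J L x y z.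
      I \<in> parts r s \<and> J \<in> parts s t \<and> L \<in> parts t v \<and> x \<in> H I \<and> y \<in> H J \<and> z \<in> H L} (K {r, v})"
    (is "total_in ?S _")
proof (rule total_in_trans[OF _ _ Y_total[of r v "{s, t}"]])
  show "?S \<subseteq> K {r, v}"
    using Y_mem[OF parts_Un[OF _ parts_Un] u_mem[OF _ parts_Un _ u_mem]] by auto
  fix C assume C: "closed_csubspace C" "?S \<subseteq> C"
  have "Y M a \<in> C" if M: "M \<in> parts r v" "s \<in> M" "t \<in> M" and a: "a \<in> H M" for M a
  proof -
    define I where "I = M \<inter> {r..s}"
    define Q where "Q = M \<inter> {s..v}"
    define J where "J = Q \<inter> {s..t}"
    define L where "L = Q \<inter> {t..v}"
    have IQ: "I \<in> parts r s" "Q \<in> parts s v" "I \<union> Q = M"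
      using parts_restrict[OF M(1,2)] assms by (auto simp: I_def Q_def)
    have "t \<in> Q" using M assms by (auto simp: Q_def)
    then have JL: "J \<in> parts s t" "L \<in> parts t v" "J \<union> L = Q"
      using parts_restrict[OF IQ(2), of t] assms by (auto simp: J_def L_def)
    have "total_in {u J L y z |y z. y \<in> H J \<and> z \<in> H L} (H Q)"
      using u_total[OF JL(1,2) total_in_self total_in_self] by (simp add: JL(3))
    from u_total[OF IQ(1,2) total_in_self this]
    have tot: "total_in {u I Q x b |x b. x \<in> H I \<and> b \<in> {u J L y z |y z. y \<in> H J \<and> z \<in> H L}} (H M)"
      by (simp only: IQ(3))
    show ?thesis
    proof (rule total_in_image[OF isometry_map_bounded[OF Y_isometry[OF M(1)]] H_closed[OF M(1)] C(1) tot _ a])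
      fix a assume "a \<in> {u I Q x b |x b. x \<in> H I \<and> b \<in> {u J L y z |y z. y \<in> H J \<and> z \<in> H L}}"
      then obtain x y z where "x \<in> H I" "y \<in> H J" "z \<in> H L" and a: "a = u I Q x (u J L y z)"
        by blast
      then have "Y (I \<union> (J \<union> L)) (u I (J \<union> L) x (u J L y z)) \<in> C"
        using IQ JL C(2) by blast
      then show "Y M a \<in> C"
        by (simp only: JL(3) IQ(3) a)
    qed
  qed
  then show "{Y I x |I x. I \<in> parts r v \<and> {s, t} \<subseteq> I \<and> x \<in> H I} \<subseteq> C"
    by auto
qed (use assms in auto)

text \<open>The range of \<open>N r s t\<close> is a closed subspace and contains, by
  \<open>N_Y\<close>, all tensors of vectors \<open>Y I x\<close> and \<open>Y J y\<close>, which
  are total.\<close>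

lemma N_unitary:
  assumes "0 < r" "r < s" "s < t"
  shows "unitary_map (K {r, t}) (K {r, s, t}) (N r s t)"
proof -
  note N = N_isometry[OF assms]
  have st: "0 < s" using assms by simp
  have "total_in {w {r, s} {s, t} x y |x y. x \<in> {Y I x |I x. I \<in> parts r s \<and> {} \<subseteq> I \<and> x \<in> H I}
      \<and> y \<in> {Y I x |I x. I \<in> parts s t \<and> {} \<subseteq> I \<and> x \<in> H I}} (K {r, s, t})"
    by (intro hilbert_tensor_total[OF hilbert_tensor_system_pairs[OF limit_tensor_system assms]]
        K_pair_closed Y_total) (use assms st in auto)
  moreover have "closed_csubspace (N r s t ` K {r, t})"
    using assms by (intro closed_csubspace_isometry_image[OF N] K_pair_closed) auto
  moreover have "w {r, s} {s, t} (Y I x) (Y J y) \<in> N r s t ` K {r, t}"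
    if "I \<in> parts r s" "J \<in> parts s t" "x \<in> H I" "y \<in> H J" for I J x y
    using N_Y[OF that] Y_mem[OF parts_Un[OF that(1,2)] u_mem[OF that]] by (metis imageI)
  ultimately have "K {r, s, t} \<subseteq> N r s t ` K {r, t}"
    unfolding total_in_def by (elim conjE allE[of _ "N r s t ` K {r, t}"] impE) auto
  then show ?thesis
    using N isometry_map_mem[OF N] unfolding unitary_map_def by blast
qed

text \<open>On a generator over \<open>I\<close>, \<open>J\<close>, \<open>L\<close> both sides
  reduce to the threefold tensor of \<open>Y I x\<close>, \<open>Y J y\<close>,
  \<open>Y L z\<close>, bracketed differently; associativity of \<open>w\<close> identifies
  them.\<close>

lemma N_coassociative:
  assumes o: "0 < r" "r < s" "s < t" "t < v"
  shows "\<exists>F G. tensor_operator (K {r, s}) (K {s, v}) (K {r, s, v}) (w {r, s} {s, v})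
            (K {r, s, t, v}) (w {r, s} {s, t, v}) id (N s t v) F
        \<and> tensor_operator (K {r, t}) (K {t, v}) (K {r, t, v}) (w {r, t} {t, v})
            (K {r, s, t, v}) (w {r, s, t} {t, v}) (N r s t) id G
        \<and> (\<forall>x\<in>K {r, v}. F (N r s v x) = G (N r t v x))"
proof -
  have o': "0 < s" "0 < t" "r < t" "s < v" "r < v" using o by auto
  have eqs: "{r, s} \<union> {s, t, v} = {r, s, t, v}" "{r, s, t} \<union> {t, v} = {r, s, t, v}"
    "{r, s} \<union> {s, t} = {r, s, t}" "{s, t} \<union> {t, v} = {s, t, v}"
    by auto
  have p: "{r, s} \<in> parts r s" "{s, t} \<in> parts s t" "{t, v} \<in> parts t v"
    "{s, t, v} \<in> parts s v" "{r, s, t} \<in> parts r t"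
    using o o' by (auto intro: parts_pair parts_triple)
  note T1 = hilbert_tensor_system_pairs[OF limit_tensor_system o(1,2) o'(4)]
  note T2 = hilbert_tensor_system_pairs[OF limit_tensor_system o(1) o'(3) o(4)]
  note T3 = K_tensor[OF p(1,4), unfolded eqs]
  note T4 = K_tensor[OF p(5,3), unfolded eqs]
  obtain F where F: "tensor_operator (K {r, s}) (K {s, v}) (K {r, s, v}) (w {r, s} {s, v})
      (K {r, s, t, v}) (w {r, s} {s, t, v}) id (N s t v) F"
    by (rule tensor_operator_isometries[OF T1 K_pair_closed[OF o(1,2)] K_pair_closed[OF o'(1,4)] T3
        isometry_map_id N_isometry[OF o'(1) o(3,4)]])
  obtain G where G: "tensor_operator (K {r, t}) (K {t, v}) (K {r, t, v}) (w {r, t} {t, v})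
      (K {r, s, t, v}) (w {r, s, t} {t, v}) (N r s t) id G"
    by (rule tensor_operator_isometries[OF T2 K_pair_closed[OF o(1) o'(3)] K_pair_closed[OF o'(2) o(4)] T4
        N_isometry[OF o(1-3)] isometry_map_id])
  have Fb: "bounded_clinear_map (K {r, s, v}) (K {r, s, t, v}) F"
    and Fw: "\<And>x y. x \<in> K {r, s} \<Longrightarrow> y \<in> K {s, v} \<Longrightarrow> F (w {r, s} {s, v} x y) = w {r, s} {s, t, v} x (N s t v y)"
    using F by (auto simp: tensor_operator_def)
  have Gb: "bounded_clinear_map (K {r, t, v}) (K {r, s, t, v}) G"
    and Gw: "\<And>x y. x \<in> K {r, t} \<Longrightarrow> y \<in> K {t, v} \<Longrightarrow> G (w {r, t} {t, v} x y) = w {r, s, t} {t, v} (N r s t x) y"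
    using G by (auto simp: tensor_operator_def)
  have "F (N r s v a) = G (N r t v a)" if a: "a \<in> K {r, v}" for a
  proof (rule bounded_clinear_map_eqI[OF
        bounded_clinear_map_compose[OF isometry_map_bounded[OF N_isometry[OF o(1,2) o'(4)]] Fb]
        bounded_clinear_map_compose[OF isometry_map_bounded[OF N_isometry[OF o(1) o'(3) o(4)]] Gb]
        K_pair_closed[OF o(1) o'(5)] Y_total_split3[OF o] _ a])
    fix b assume "b \<in> {Y (I \<union> (J \<union> L)) (u I (J \<union> L) x (u J L y z)) |I J L x y z.
      I \<in> parts r s \<and> J \<in> parts s t \<and> L \<in> parts t v \<and> x \<in> H I \<and> y \<in> H J \<and> z \<in> H L}"
    then obtain I J L x y z where IJL: "I \<in> parts r s" "J \<in> parts s t" "L \<in> parts t v"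
      and xyz: "x \<in> H I" "y \<in> H J" "z \<in> H L"
      and b: "b = Y (I \<union> (J \<union> L)) (u I (J \<union> L) x (u J L y z))"
      by blast
    have JL: "J \<union> L \<in> parts s v" and IJ: "I \<union> J \<in> parts r t"
      by (rule parts_Un[OF IJL(2,3)], rule parts_Un[OF IJL(1,2)])
    note yz = u_mem[OF IJL(2,3) xyz(2,3)] and xy = u_mem[OF IJL(1,2) xyz(1,2)]
    \<comment> \<open>Splitting at \<open>t\<close> first requires the same generator with the other
      bracketing.\<close>
    have b': "b = Y ((I \<union> J) \<union> L) (u (I \<union> J) L (u I J x y) z)"
      by (simp only: b u_assoc[OF IJL xyz] Un_assoc)
    have "F (N r s v b) = w {r, s} {s, t, v} (Y I x) (w {s, t} {t, v} (Y J y) (Y L z))"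
      unfolding b N_Y[OF IJL(1) JL xyz(1) yz]
      by (simp only: Fw[OF Y_mem[OF IJL(1) xyz(1)] Y_mem[OF JL yz]] N_Y[OF IJL(2,3) xyz(2,3)])
    moreover have "G (N r t v b) = w {r, s, t} {t, v} (w {r, s} {s, t} (Y I x) (Y J y)) (Y L z)"
      unfolding b' N_Y[OF IJ IJL(3) xy xyz(3)]
      by (simp only: Gw[OF Y_mem[OF IJ xy] Y_mem[OF IJL(3) xyz(3)]] N_Y[OF IJL(1,2) xyz(1,2)])
    moreover have "w {r, s, t} {t, v} (w {r, s} {s, t} (Y I x) (Y J y)) (Y L z)
        = w {r, s} {s, t, v} (Y I x) (w {s, t} {t, v} (Y J y) (Y L z))"
      using w_assoc[OF p(1-3) Y_mem[OF IJL(1) xyz(1)] Y_mem[OF IJL(2) xyz(2)] Y_mem[OF IJL(3) xyz(3)]]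
      by (simp only: eqs)
    ultimately show "F (N r s v b) = G (N r t v b)"
      by simp
  qed
  with F G show ?thesis
    by blast
qed

theorem tsirelson_product_system_limit: "tsirelson_product_system K w N"
  unfolding tsirelson_product_system_def
  using limit_tensor_system N_unitary N_coassociative by blast

end

section \<open>Uniqueness of the limit up to isomorphism\<close>

text \<open>The unitaries \<open>Z\<close> send \<open>Y I x\<close> to \<open>Y' I x\<close>.
  Intertwining is then checked on the vectors of \<open>Y_total_split\<close>, where
  \<open>N_Y\<close> evaluates both sides.\<close>

theorem hilbert_limits_isomorphic:
  assumes "hilbert_limit H u W K w N Y" and "hilbert_limit H u W K' w' N' Y'"
  shows "tsirelson_isomorphic K w N K' w' N'"
proof -
  interpret A: hilbert_limit H u W K w N Y by fact
  interpret B: hilbert_limit H u W K' w' N' Y' by fact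
  have ex: "\<exists>Z. unitary_map (K {s, t}) (K' {s, t}) Z \<and> (\<forall>I\<in>parts s t. \<forall>x\<in>H I. Z (Y I x) = Y' I x)"
    if st: "0 < s" "s < t" for s t
  proof -
    define P where "P = {(Y I x, Y' I x) |I x. I \<in> parts s t \<and> x \<in> H I}"
    obtain Z where Z: "isometry_map (K {s, t}) (K' {s, t}) Z" "\<And>x y. (x, y) \<in> P \<Longrightarrow> Z x = y"
    proof (rule isometric_extension[OF _ A.K_pair_closed[OF st] B.K_pair_closed[OF st], of P])
      fix a b a' b' assume "(a, b) \<in> P" "(a', b') \<in> P"
      then obtain I x J y where I: "I \<in> parts s t" "x \<in> H I" and J: "J \<in> parts s t" "y \<in> H J"
        and ab: "a = Y I x" "b = Y' I x" "a' = Y J y" "b' = Y' J y"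
        by (auto simp: P_def)
      \<comment> \<open>Vectors over different partitions are moved to a common refinement, where
        both inner products equal the one in \<open>H M\<close>.\<close>
      define M where "M = I \<union> J"
      have M: "M \<in> parts s t" "I \<subseteq> M" "J \<subseteq> M"
        using I J by (auto simp: M_def parts_def)
      note Wx = A.W_mem[OF I(1) M(1,2) I(2)] and Wy = A.W_mem[OF J(1) M(1,3) J(2)]
      have "cinner a a' = cinner (Y M (W I M x)) (Y M (W J M y))"
        unfolding ab A.Y_W[OF I(1) M(1,2) I(2)] A.Y_W[OF J(1) M(1,3) J(2)] ..
      also have "\<dots> = cinner (Y' M (W I M x)) (Y' M (W J M y))"
        unfolding isometry_map_cinner[OF A.Y_isometry[OF M(1)] A.H_closed[OF M(1)] Wx Wy]
          isometry_map_cinner[OF B.Y_isometry[OF M(1)] A.H_closed[OF M(1)] Wx Wy] ..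
      also have "\<dots> = cinner b b'"
        unfolding ab B.Y_W[OF I(1) M(1,2) I(2)] B.Y_W[OF J(1) M(1,3) J(2)] ..
      finally show "cinner a a' = cinner b b'" .
    next
      have "fst ` P = {Y I x |I x. I \<in> parts s t \<and> {} \<subseteq> I \<and> x \<in> H I}"
        by (force simp: P_def)
      then show "total_in (fst ` P) (K {s, t})"
        using A.Y_total[OF st, of "{}"] by simp
      show "snd ` P \<subseteq> K' {s, t}"
        using B.Y_mem by (auto simp: P_def)
    qed blast
    have ZY: "Z (Y I x) = Y' I x" if "I \<in> parts s t" "x \<in> H I" for I x
      using Z(2) that by (auto simp: P_def)
    have "K' {s, t} \<subseteq> Z ` K {s, t}"
    proof -
      have "Y' I x \<in> Z ` K {s, t}" if "I \<in> parts s t" "x \<in> H I" for I x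
        using ZY[OF that] A.Y_mem[OF that] by (metis imageI)
      then have "{Y' I x |I x. I \<in> parts s t \<and> {} \<subseteq> I \<and> x \<in> H I} \<subseteq> Z ` K {s, t}"
        by blast
      then show ?thesis
        using B.Y_total[OF st, of "{}"] closed_csubspace_isometry_image[OF Z(1) A.K_pair_closed[OF st]]
        unfolding total_in_def by auto
    qed
    then have "unitary_map (K {s, t}) (K' {s, t}) Z"
      using Z(1) isometry_map_mem[OF Z(1)] unfolding unitary_map_def by blast
    with ZY show ?thesis by blast
  qed
  define Z where "Z s t = (SOME Z. unitary_map (K {s, t}) (K' {s, t}) Z
    \<and> (\<forall>I\<in>parts s t. \<forall>x\<in>H I. Z (Y I x) = Y' I x))" for s t
  have Z: "unitary_map (K {s, t}) (K' {s, t}) (Z s t) \<and> (\<forall>I\<in>parts s t. \<forall>x\<in>H I. Z s t (Y I x) = Y' I x)"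
    if "0 < s" "s < t" for s t
    unfolding Z_def by (rule someI_ex[OF ex[OF that]])
  have Ziso: "isometry_map (K {s, t}) (K' {s, t}) (Z s t)" if "0 < s" "s < t" for s t
    using Z[OF that] by (simp add: unitary_map_def)
  have ZY: "Z s t (Y I x) = Y' I x" if "I \<in> parts s t" "x \<in> H I" for s t I x
    using Z[OF partsD(1,2)[OF that(1)]] that by blast
  have "\<exists>F. tensor_operator (K {r, s}) (K {s, t}) (K {r, s, t}) (w {r, s} {s, t})
          (K' {r, s, t}) (w' {r, s} {s, t}) (Z r s) (Z s t) F
      \<and> (\<forall>x\<in>K {r, t}. F (N r s t x) = N' r s t (Z r t x))"
    if o: "0 < r" "r < s" "s < t" for r s t
  proof -
    have o': "0 < s" "r < t" using o by auto
    obtain F where F: "tensor_operator (K {r, s}) (K {s, t}) (K {r, s, t}) (w {r, s} {s, t})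
          (K' {r, s, t}) (w' {r, s} {s, t}) (Z r s) (Z s t) F"
      by (rule tensor_operator_isometries[OF hilbert_tensor_system_pairs[OF A.limit_tensor_system o]
            A.K_pair_closed[OF o(1,2)] A.K_pair_closed[OF o'(1) o(3)]
            hilbert_tensor_system_pairs[OF B.limit_tensor_system o] Ziso[OF o(1,2)] Ziso[OF o'(1) o(3)]])
    have Fb: "bounded_clinear_map (K {r, s, t}) (K' {r, s, t}) F"
      and Fw: "\<And>x y. x \<in> K {r, s} \<Longrightarrow> y \<in> K {s, t} \<Longrightarrow> F (w {r, s} {s, t} x y) = w' {r, s} {s, t} (Z r s x) (Z s t y)"
      using F by (auto simp: tensor_operator_def)
    have "F (N r s t x) = N' r s t (Z r t x)" if x: "x \<in> K {r, t}" for x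
    proof (rule bounded_clinear_map_eqI[OF
          bounded_clinear_map_compose[OF isometry_map_bounded[OF A.N_isometry[OF o]] Fb]
          bounded_clinear_map_compose[OF isometry_map_bounded[OF Ziso[OF o(1) o'(2)]]
            isometry_map_bounded[OF B.N_isometry[OF o]]]
          A.K_pair_closed[OF o(1) o'(2)] A.Y_total_split[OF o] _ x])
      fix a assume "a \<in> {Y (I \<union> J) (u I J x y) |I J x y. I \<in> parts r s \<and> J \<in> parts s t \<and> x \<in> H I \<and> y \<in> H J}"
      then obtain I J x y where IJ: "I \<in> parts r s" "J \<in> parts s t" and xy: "x \<in> H I" "y \<in> H J"
        and a: "a = Y (I \<union> J) (u I J x y)"
        by blast
      show "F (N r s t a) = N' r s t (Z r t a)"
        unfolding a A.N_Y[OF IJ xy] ZY[OF parts_Un[OF IJ] A.u_mem[OF IJ xy]] B.N_Y[OF IJ xy]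
        by (simp only: Fw[OF A.Y_mem[OF IJ(1) xy(1)] A.Y_mem[OF IJ(2) xy(2)]] ZY[OF IJ(1) xy(1)] ZY[OF IJ(2) xy(2)])
    qed
    with F show ?thesis by blast
  qed
  with Z show ?thesis
    unfolding tsirelson_isomorphic_def by blast
qed

section \<open>The isometries from the tensor products into the GNS spaces of the dilated co-unit\<close>

lemma total_in_mono: "total_in S T \<Longrightarrow> S \<subseteq> S' \<Longrightarrow> S' \<subseteq> T \<Longrightarrow> total_in S' T"
  unfolding total_in_def by blast

lemma gns_space_bounded:
  assumes g: "gns_space S \<phi> H \<eta>" and \<phi>: "bounded_functional S \<phi>" and S: "cstar_subalgebra S"
  shows "bounded_clinear_map S H \<eta>"
proof -
  obtain M where M: "\<And>x. x \<in> S \<Longrightarrow> cmod (\<phi> x) \<le> M * norm x"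
    using \<phi> unfolding bounded_functional_def by blast
  have "norm (\<eta> x) \<le> sqrt \<bar>M\<bar> * norm x" if x: "x \<in> S" for x
  proof -
    have sx: "star x * x \<in> S"
      using S x by (auto simp: cstar_subalgebra_def)
    have "cinner (\<eta> x) (\<eta> x) = \<phi> (star x * x)"
      using g x unfolding gns_space_def by blast
    then have "(norm (\<eta> x))\<^sup>2 = cmod (\<phi> (star x * x))"
      by (metis cinner_self norm_of_real abs_power2)
    also have "\<dots> \<le> M * norm (star x * x)"
      by (rule M[OF sx])
    also have "\<dots> \<le> \<bar>M\<bar> * (norm x)\<^sup>2"
      unfolding cstar_identity by (intro mult_right_mono) auto
    also have "\<dots> = (sqrt \<bar>M\<bar> * norm x)\<^sup>2"
      by (simp add: power_mult_distrib)
    finally show ?thesis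
      by (rule power2_le_imp_le) simp
  qed
  then show ?thesis
    using g unfolding bounded_clinear_map_def gns_space_def by blast
qed

lemma cstar_tensor_systemD:
  assumes "cstar_tensor_system A \<tau>"
  shows "\<And>s t I. I \<in> parts s t \<Longrightarrow> cstar_subalgebra (A I)"
    and "\<And>r s t I J. I \<in> parts r s \<Longrightarrow> J \<in> parts s t \<Longrightarrow> min_tensor (A I) (A J) (A (I \<union> J)) (\<tau> I J)"
    and "\<And>r s t v I J L x y z. I \<in> parts r s \<Longrightarrow> J \<in> parts s t \<Longrightarrow> L \<in> parts t v
      \<Longrightarrow> x \<in> A I \<Longrightarrow> y \<in> A J \<Longrightarrow> z \<in> A L \<Longrightarrow> \<tau> (I \<union> J) L (\<tau> I J x y) z = \<tau> I (J \<union> L) x (\<tau> J L y z)"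
  using assms unfolding cstar_tensor_system_def by blast+

lemma cstar_subalgebra_closed_csubspace: "cstar_subalgebra S \<Longrightarrow> closed_csubspace S"
  by (simp add: cstar_subalgebra_def)

lemma min_tensorD:
  assumes "min_tensor A B T \<tau>"
  shows "a \<in> A \<Longrightarrow> b \<in> B \<Longrightarrow> \<tau> a b \<in> T"
    and "cstar_subalgebra A \<Longrightarrow> cstar_subalgebra B \<Longrightarrow> a \<in> A \<Longrightarrow> b \<in> B \<Longrightarrow> a' \<in> A \<Longrightarrow> b' \<in> B
      \<Longrightarrow> star (\<tau> a' b') * \<tau> a b = \<tau> (star a' * a) (star b' * b)"
    and "total_in {\<tau> a b |a b. a \<in> A \<and> b \<in> B} T"
proof -
  show "\<tau> a b \<in> T" if "a \<in> A" "b \<in> B" for a b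
    using assms that bilinear_map_mem unfolding min_tensor_def by blast
  show "total_in {\<tau> a b |a b. a \<in> A \<and> b \<in> B} T"
    using assms unfolding min_tensor_def cstar_subalgebra_def by (intro total_in_tensor_sums) auto
  assume sub: "cstar_subalgebra A" "cstar_subalgebra B"
  assume ab: "a \<in> A" "b \<in> B" "a' \<in> A" "b' \<in> B"
  then have s: "star a' \<in> A" "star b' \<in> B"
    using sub by (auto simp: cstar_subalgebra_def)
  have "star (\<tau> a' b') = \<tau> (star a') (star b')"
    using assms ab unfolding min_tensor_def by blast
  moreover have "\<tau> (star a') (star b') * \<tau> a b = \<tau> (star a' * a) (star b' * b)"
    using assms ab s unfolding min_tensor_def by blast
  ultimately show "star (\<tau> a' b') * \<tau> a b = \<tau> (star a' * a) (star b' * b)"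
    by simp
qed

text \<open>The recursion restated for partitions with an appended interval, matching the cases of
  \<open>parts_induct\<close>.\<close>

lemma connecting_isometriesD:
  assumes W: "connecting_isometries H u V W"
  shows "\<And>s t x. 0 < s \<Longrightarrow> s < t \<Longrightarrow> x \<in> H {s, t} \<Longrightarrow> W {s, t} {s, t} x = x"
    and "\<And>r s t x. 0 < r \<Longrightarrow> r < s \<Longrightarrow> s < t \<Longrightarrow> x \<in> H {r, t} \<Longrightarrow> W {r, t} {r, s, t} x = V r s t x"
    and "\<And>s p t I. I \<in> parts s p \<Longrightarrow> p < t \<Longrightarrow> I \<noteq> {s, p} \<Longrightarrow>
      \<exists>F. tensor_operator (H {s, p}) (H {p, t}) (H {s, p, t}) (u {s, p} {p, t})
            (H (I \<union> {p, t})) (u I {p, t}) (W {s, p} I) id F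
          \<and> (\<forall>x\<in>H {s, t}. W {s, t} (I \<union> {p, t}) x = F (V s p t x))"
    and "\<And>s p t I J. I \<in> parts s p \<Longrightarrow> p < t \<Longrightarrow> J \<in> parts s t \<Longrightarrow> I \<union> {p, t} \<subseteq> J \<Longrightarrow>
      tensor_operator (H I) (H {p, t}) (H (I \<union> {p, t})) (u I {p, t})
        (H J) (u (J \<inter> {s..p}) (J \<inter> {p..t})) (W I (J \<inter> {s..p})) (W {p, t} (J \<inter> {p..t})) (W (I \<union> {p, t}) J)"
proof -
  note W' = W[unfolded connecting_isometries_def]
  note W1 = W'[THEN conjunct1, rule_format]
    and W2 = W'[THEN conjunct2, THEN conjunct1, rule_format]
    and W3 = W'[THEN conjunct2, THEN conjunct2, THEN conjunct1, rule_format]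
  show "W {s, t} {s, t} x = x" if "0 < s" "s < t" "x \<in> H {s, t}" for s t x
    by (rule W1) (use that in auto)
  show "W {r, t} {r, s, t} x = V r s t x" if "0 < r" "r < s" "s < t" "x \<in> H {r, t}" for r s t x
    by (rule W2) (use that in auto)
  fix s p t I assume I: "I \<in> parts s p" "p < t" and ne: "I \<noteq> {s, p}"
  note last = parts_last[OF I]
  obtain q where q: "q \<in> I" "q \<noteq> s" "q \<noteq> p"
    using partsD(4,5)[OF I(1)] ne by blast
  \<comment> \<open>An interior point \<open>q\<close> of \<open>I\<close> yields four distinct
    points \<open>s < q < p < t\<close>, the threshold at which the recursion starts.\<close>
  have "card {s, q, p, t} \<le> card (I \<union> {p, t})"
    using partsD[OF I(1)] q by (intro card_mono) auto
  moreover have "q < p"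
    using partsD(7)[OF I(1) q(1)] q(3) by simp
  ultimately have c: "4 \<le> card (I \<union> {p, t})"
    using partsD(2)[OF I(1)] I(2) q by simp
  show "\<exists>F. tensor_operator (H {s, p}) (H {p, t}) (H {s, p, t}) (u {s, p} {p, t})
            (H (I \<union> {p, t})) (u I {p, t}) (W {s, p} I) id F
          \<and> (\<forall>x\<in>H {s, t}. W {s, t} (I \<union> {p, t}) x = F (V s p t x))"
    using W3[OF last(4) c] unfolding Let_def last(1,2) .
next
  note W4 = W[unfolded connecting_isometries_def, THEN conjunct2, THEN conjunct2, THEN conjunct2, rule_format]
  fix s p t I J assume I: "I \<in> parts s p" "p < t" and J: "J \<in> parts s t" "I \<union> {p, t} \<subseteq> J"
  note last = parts_last[OF I]
  show "tensor_operator (H I) (H {p, t}) (H (I \<union> {p, t})) (u I {p, t})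
        (H J) (u (J \<inter> {s..p}) (J \<inter> {p..t})) (W I (J \<inter> {s..p})) (W {p, t} (J \<inter> {p..t})) (W (I \<union> {p, t}) J)"
    using W4[OF last(4) J(1) conjI[OF J(2) last(3)]] unfolding Let_def last(1,2) .
qed

text \<open>Names the data that the definitions bind existentially, so that maps can be built from
  them. \<open>V'_\<eta>'\<close> and \<open>\<phi>s_\<tau>\<close> are stated on images of
  \<open>\<kappa>\<close>; in this form the tensor products of the dilated algebras and their
  isomorphisms no longer occur.\<close>

locale dilated_counit =
  fixes A :: "real set \<Rightarrow> 'a::cstar_algebra set" and \<tau> \<Delta> \<phi>
    and H :: "real set \<Rightarrow> 'h::hilbert_space set" and u V W \<eta>
    and As :: "real set \<Rightarrow> 'b::cstar_algebra set" and \<kappa> \<phi>s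
    and H' :: "real set \<Rightarrow> 'l::hilbert_space set" and u' V' \<eta>'
  assumes A_system: "cstar_tensor_system A \<tau>"
    and As_subalgebra: "\<And>s t. 0 < s \<Longrightarrow> s < t \<Longrightarrow> cstar_subalgebra (As {s, t})"
    and H_system: "hilbert_tensor_system H u"
    and H'_system: "hilbert_tensor_system H' u'"
    and W: "connecting_isometries H u V W"
    and V_isometry: "\<And>r s t. 0 < r \<Longrightarrow> r < s \<Longrightarrow> s < t \<Longrightarrow> isometry_map (H {r, t}) (H {r, s, t}) (V r s t)"
    and V'_isometry: "\<And>r s t. 0 < r \<Longrightarrow> r < s \<Longrightarrow> s < t \<Longrightarrow> isometry_map (H' {r, t}) (H' {r, s, t}) (V' r s t)"
    and \<eta>: "\<And>s t. 0 < s \<Longrightarrow> s < t \<Longrightarrow> gns_space (A {s, t}) (\<phi> s t) (H {s, t}) (\<eta> s t)"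
    and \<eta>': "\<And>s t. 0 < s \<Longrightarrow> s < t \<Longrightarrow> gns_space (As {s, t}) (\<phi>s s t) (H' {s, t}) (\<eta>' s t)"
    and \<phi>s_bounded: "\<And>s t. 0 < s \<Longrightarrow> s < t \<Longrightarrow> bounded_functional (As {s, t}) (\<phi>s s t)"
    and V_\<eta>: "\<And>r s t. 0 < r \<Longrightarrow> r < s \<Longrightarrow> s < t \<Longrightarrow>
      \<exists>E. bounded_clinear_map (A {r, s, t}) (H {r, s, t}) E
        \<and> (\<forall>a\<in>A {r, s}. \<forall>b\<in>A {s, t}. E (\<tau> {r, s} {s, t} a b) = u {r, s} {s, t} (\<eta> r s a) (\<eta> s t b))
        \<and> (\<forall>a\<in>A {r, t}. V r s t (\<eta> r t a) = E (\<Delta> r s t a))"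
    and V'_\<eta>': "\<And>r s t I J a b. I \<in> parts r s \<Longrightarrow> J \<in> parts s t \<Longrightarrow> a \<in> A I \<Longrightarrow> b \<in> A J \<Longrightarrow>
      V' r s t (\<eta>' r t (\<kappa> (I \<union> J) (\<tau> I J a b))) = u' {r, s} {s, t} (\<eta>' r s (\<kappa> I a)) (\<eta>' s t (\<kappa> J b))"
    and \<kappa>_hom: "\<And>s t I. I \<in> parts s t \<Longrightarrow> star_hom (A I) (As {s, t}) (\<kappa> I)"
    and \<kappa>_dense: "\<And>s t. 0 < s \<Longrightarrow> s < t \<Longrightarrow> closure (\<Union>I\<in>parts s t. \<kappa> I ` A I) = As {s, t}"
    and \<Delta>_mem: "\<And>r s t a. 0 < r \<Longrightarrow> r < s \<Longrightarrow> s < t \<Longrightarrow> a \<in> A {r, t} \<Longrightarrow> \<Delta> r s t a \<in> A {r, s, t}"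
    and \<kappa>_\<Delta>: "\<And>r s t a. 0 < r \<Longrightarrow> r < s \<Longrightarrow> s < t \<Longrightarrow> a \<in> A {r, t} \<Longrightarrow> \<kappa> {r, s, t} (\<Delta> r s t a) = \<kappa> {r, t} a"
    and \<phi>s_\<kappa>: "\<And>s t a. 0 < s \<Longrightarrow> s < t \<Longrightarrow> a \<in> A {s, t} \<Longrightarrow> \<phi>s s t (\<kappa> {s, t} a) = \<phi> s t a"
    and \<phi>s_\<tau>: "\<And>r s t I J a b. I \<in> parts r s \<Longrightarrow> J \<in> parts s t \<Longrightarrow> a \<in> A I \<Longrightarrow> b \<in> A J \<Longrightarrow>
      \<phi>s r t (\<kappa> (I \<union> J) (\<tau> I J a b)) = \<phi>s r s (\<kappa> I a) * \<phi>s s t (\<kappa> J b)"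
begin

lemmas A_subalgebra = cstar_tensor_systemD(1)[OF A_system]
lemmas A_tensor = cstar_tensor_systemD(2)[OF A_system]
lemmas \<tau>_assoc = cstar_tensor_systemD(3)[OF A_system]
lemmas H_closed = hilbert_tensor_systemD(1)[OF H_system]
lemmas H_tensor = hilbert_tensor_systemD(2)[OF H_system]
lemmas u_assoc = hilbert_tensor_systemD(3)[OF H_system]
lemmas H'_closed = hilbert_tensor_systemD(1)[OF H'_system]

lemma \<tau>_mem: "I \<in> parts r s \<Longrightarrow> J \<in> parts s t \<Longrightarrow> a \<in> A I \<Longrightarrow> b \<in> A J \<Longrightarrow> \<tau> I J a b \<in> A (I \<union> J)"
  using min_tensorD(1)[OF A_tensor] .

lemma u_mem: "I \<in> parts r s \<Longrightarrow> J \<in> parts s t \<Longrightarrow> x \<in> H I \<Longrightarrow> y \<in> H J \<Longrightarrow> u I J x y \<in> H (I \<union> J)"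
  using hilbert_tensor_mem[OF H_tensor] .

lemma \<eta>_mem: "0 < s \<Longrightarrow> s < t \<Longrightarrow> a \<in> A {s, t} \<Longrightarrow> \<eta> s t a \<in> H {s, t}"
  using \<eta> unfolding gns_space_def clinear_map_def by blast

lemma \<kappa>_mem: "I \<in> parts s t \<Longrightarrow> a \<in> A I \<Longrightarrow> \<kappa> I a \<in> As {s, t}"
  using \<kappa>_hom unfolding star_hom_def clinear_map_def by blast

lemma \<eta>'_bounded: "0 < s \<Longrightarrow> s < t \<Longrightarrow> bounded_clinear_map (As {s, t}) (H' {s, t}) (\<eta>' s t)"
  by (rule gns_space_bounded[OF \<eta>' \<phi>s_bounded As_subalgebra])

text \<open>The point where contractivity of *-homomorphisms is used: it makes
  \<open>\<kappa> I\<close> bounded.\<close>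

lemma \<eta>'_\<kappa>_bounded:
  assumes I: "I \<in> parts s t"
  shows "bounded_clinear_map (A I) (H' {s, t}) (\<lambda>a. \<eta>' s t (\<kappa> I a))"
proof (rule bounded_clinear_map_compose[OF _ \<eta>'_bounded[OF partsD(1,2)[OF I]]])
  show "bounded_clinear_map (A I) (As {s, t}) (\<kappa> I)"
    unfolding bounded_clinear_map_def
    using \<kappa>_hom[OF I] star_hom_norm_le[OF \<kappa>_hom[OF I] A_subalgebra[OF I]]
    by (auto simp: star_hom_def intro!: exI[of _ 1])
qed

lemmas \<eta>'_\<kappa>_mem = bounded_clinear_map_mem[OF \<eta>'_\<kappa>_bounded]

text \<open>
  \<open>elementary s t I x a\<close>: \<open>x = \<eta> a\<^sub>0 \<otimes> \<dots> \<otimes> \<eta> a\<^sub>m\<close> and \<open>a = a\<^sub>0 \<otimes> \<dots> \<otimes> a\<^sub>m\<close> along the partition \<open>I\<close> of \<open>[s, t]\<close>.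
\<close>

inductive elementary :: "real \<Rightarrow> real \<Rightarrow> real set \<Rightarrow> 'h \<Rightarrow> 'a \<Rightarrow> bool" where
  pair: "0 < s \<Longrightarrow> s < t \<Longrightarrow> a \<in> A {s, t} \<Longrightarrow> elementary s t {s, t} (\<eta> s t a) a"
| last: "I \<in> parts s p \<Longrightarrow> p < t \<Longrightarrow> elementary s p I x a \<Longrightarrow> b \<in> A {p, t}
    \<Longrightarrow> elementary s t (I \<union> {p, t}) (u I {p, t} x (\<eta> p t b)) (\<tau> I {p, t} a b)"

lemma elementary_mem:
  "elementary s t I x a \<Longrightarrow> I \<in> parts s t \<and> x \<in> H I \<and> a \<in> A I"
proof (induction rule: elementary.induct)
  case (pair s t a)
  then show ?case
    using parts_pair \<eta>_mem by simp
next
  case (last I s p t x a b)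
  have p: "0 < p" "{p, t} \<in> parts p t"
    using last.hyps partsD(1,2)[OF last.hyps(1)] by (auto intro: parts_pair)
  show ?case
    using last parts_Un[OF last.hyps(1) p(2)] u_mem[OF last.hyps(1) p(2)] \<tau>_mem[OF last.hyps(1) p(2)]
      \<eta>_mem[OF p(1) last.hyps(2,4)] by simp
qed

text \<open>Elementary tensors are generated by appending single intervals on the right;
  associativity of \<open>u\<close> and \<open>\<tau>\<close> gives closure under tensoring with a
  longer right factor, by induction on that factor.\<close>

lemma elementary_tensor:
  assumes "elementary s t J y b" "elementary r s I x a"
  shows "elementary r t (I \<union> J) (u I J x y) (\<tau> I J a b)"
  using assms
proof (induction rule: elementary.induct)
  case (pair s t b)
  then show ?case
    using elementary_mem[OF pair.prems] by (intro elementary.last) auto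
next
  case (last J s p t y b c)
  note I = elementary_mem[OF last.prems] and J = elementary_mem[OF last.hyps(3)]
  have p: "0 < p" "{p, t} \<in> parts p t"
    using last.hyps partsD(1,2)[OF last.hyps(1)] by (auto intro: parts_pair)
  have "elementary r t (I \<union> J \<union> {p, t}) (u (I \<union> J) {p, t} (u I J x y) (\<eta> p t c)) (\<tau> (I \<union> J) {p, t} (\<tau> I J a b) c)"
    using last parts_Un[of I r s J p] I by (intro elementary.last) auto
  moreover have "u (I \<union> J) {p, t} (u I J x y) (\<eta> p t c) = u I (J \<union> {p, t}) x (u J {p, t} y (\<eta> p t c))"
    using I J p \<eta>_mem[OF p(1) last.hyps(2,4)] by (intro u_assoc) auto
  moreover have "\<tau> (I \<union> J) {p, t} (\<tau> I J a b) c = \<tau> I (J \<union> {p, t}) a (\<tau> J {p, t} b c)"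
    using I J p last.hyps(4) by (intro \<tau>_assoc) auto
  ultimately show ?case
    by (simp add: Un_assoc)
qed

text \<open>Both sides are multiplicative when the last interval is split off, the left by the
  Hilbert space tensor product and the right by \<open>\<phi>s_\<tau>\<close>. On a single interval
  the formula is the GNS inner product.\<close>

lemma elementary_gram:
  "elementary s t I x a \<Longrightarrow> elementary s t I x' a' \<Longrightarrow> cinner x x' = \<phi>s s t (\<kappa> I (star a' * a))"
proof (induction arbitrary: x' a' rule: elementary.induct)
  case (pair s t a)
  from pair.prems pair.hyps have "x' = \<eta> s t a' \<and> a' \<in> A {s, t}"
  proof (cases rule: elementary.cases)
    case (last I p x a b)
    \<comment> \<open>An appended interval would put a point strictly between \<open>s\<close> and
      \<open>t\<close> into \<open>{s, t}\<close>.\<close>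
    have "p \<in> {s, t}" using last(1) by auto
    then show ?thesis using last partsD(2)[OF last(4)] by auto
  qed auto
  moreover have "cinner (\<eta> s t a) (\<eta> s t a') = \<phi> s t (star a' * a)" if "a' \<in> A {s, t}"
    using \<eta>[OF pair.hyps(1,2)] pair.hyps(3) that unfolding gns_space_def by blast
  moreover have "star a' * a \<in> A {s, t}" if "a' \<in> A {s, t}"
    using A_subalgebra[OF parts_pair[OF pair.hyps(1,2)]] pair.hyps(3) that
    unfolding cstar_subalgebra_def by blast
  ultimately show ?case
    using \<phi>s_\<kappa>[OF pair.hyps(1,2)] by simp
next
  case (last I s p t x a b)
  have p: "0 < p" "{p, t} \<in> parts p t"
    using last.hyps partsD(1,2)[OF last.hyps(1)] by (auto intro: parts_pair)
  obtain y c d where e: "elementary s p I y c" "d \<in> A {p, t}"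
    and x': "x' = u I {p, t} y (\<eta> p t d)" "a' = \<tau> I {p, t} c d"
    using last.prems
  proof (cases rule: elementary.cases)
    case pair
    have "p \<in> {s, t}" using pair(1) by auto
    then show ?thesis using last.hyps(2) partsD(2)[OF last.hyps(1)] by auto
  next
    case (last J q y c d)
    \<comment> \<open>Removing \<open>t\<close> recovers the shorter partition, and its maximum is
      the splitting point, so both tensors are split at the same place.\<close>
    have eqs: "J = I" "q = p"
      using parts_last(1,2)[OF last(4,5)] parts_last(1,2)[OF \<open>I \<in> parts s p\<close> \<open>p < t\<close>] last(1) by auto
    show ?thesis
      using that last unfolding eqs by blast
  qed
  note I = elementary_mem[OF last.hyps(3)] and I' = elementary_mem[OF e(1)]
  have stars: "star c * a \<in> A I" "star d * b \<in> A {p, t}"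
    using A_subalgebra[OF last.hyps(1)] A_subalgebra[OF p(2)] I I' last.hyps(4) e(2)
    unfolding cstar_subalgebra_def by blast+
  have "cinner (u I {p, t} x (\<eta> p t b)) x' = cinner x y * cinner (\<eta> p t b) (\<eta> p t d)"
    using H_tensor[OF last.hyps(1) p(2)] I I' \<eta>_mem[OF p(1) last.hyps(2)] last.hyps(4) e(2)
    unfolding x' hilbert_tensor_def by blast
  also have "cinner (\<eta> p t b) (\<eta> p t d) = \<phi> p t (star d * b)"
    using \<eta>[OF p(1) last.hyps(2)] last.hyps(4) e(2) unfolding gns_space_def by blast
  also have "\<dots> = \<phi>s p t (\<kappa> {p, t} (star d * b))"
    by (rule \<phi>s_\<kappa>[OF p(1) last.hyps(2) stars(2), symmetric])
  also have "cinner x y = \<phi>s s p (\<kappa> I (star c * a))"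
    by (rule last.IH[OF e(1)])
  also have "\<phi>s s p (\<kappa> I (star c * a)) * \<phi>s p t (\<kappa> {p, t} (star d * b))
      = \<phi>s s t (\<kappa> (I \<union> {p, t}) (\<tau> I {p, t} (star c * a) (star d * b)))"
    by (rule \<phi>s_\<tau>[OF last.hyps(1) p(2) stars, symmetric])
  also have "\<tau> I {p, t} (star c * a) (star d * b) = star a' * \<tau> I {p, t} a b"
    unfolding x' using min_tensorD(2)[OF A_tensor[OF last.hyps(1) p(2)]
      A_subalgebra[OF last.hyps(1)] A_subalgebra[OF p(2)]] I I' last.hyps(4) e(2) by simp
  finally show ?case .
qed

lemma \<eta>_total: "0 < s \<Longrightarrow> s < t \<Longrightarrow> total_in (\<eta> s t ` A {s, t}) (H {s, t})"
  using \<eta>[of s t] closure_subset[of "\<eta> s t ` A {s, t}"]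
  by (intro total_in_dense) (auto simp: gns_space_def)

lemma elementary_total: "I \<in> parts s t \<Longrightarrow> total_in {x. \<exists>a. elementary s t I x a} (H I)"
proof (induction rule: parts_induct)
  case (pair s t)
  show ?case
    using elementary_mem
    by (intro total_in_mono[OF \<eta>_total[OF pair]]) (auto intro: elementary.pair[OF pair])
next
  case (last s p t I)
  have p: "0 < p" "{p, t} \<in> parts p t"
    using last.hyps partsD(1,2)[OF last.hyps(1)] by (auto intro: parts_pair)
  have "total_in {u I {p, t} x y |x y. x \<in> {x. \<exists>a. elementary s p I x a} \<and> y \<in> \<eta> p t ` A {p, t}} (H (I \<union> {p, t}))"
    by (rule hilbert_tensor_total[OF H_tensor[OF last.hyps(1) p(2)] H_closed[OF last.hyps(1)] H_closed[OF p(2)]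
        last.IH \<eta>_total[OF p(1) last.hyps(2)]])
  then show ?case
    using elementary_mem elementary.last[OF last.hyps]
    by (elim total_in_mono) blast+
qed

section \<open>The isometries \<open>X\<close> and tensor products\<close>

text \<open>By \<open>elementary_gram\<close> and the GNS formula for \<open>\<eta>'\<close>,
  elementary tensors and their prospective images have equal Gram matrices. This also settles that
  the image depends on \<open>x\<close> only and not on the chosen \<open>a\<close>.\<close>

lemma X_exists:
  assumes I: "I \<in> parts s t"
  shows "\<exists>X. isometry_map (H I) (H' {s, t}) X \<and> (\<forall>x a. elementary s t I x a \<longrightarrow> X x = \<eta>' s t (\<kappa> I a))"
proof -
  note st = partsD(1,2)[OF I]
  define P where "P = {(x, \<eta>' s t (\<kappa> I a)) |x a. elementary s t I x a}"
  obtain X where X: "isometry_map (H I) (H' {s, t}) X" "\<And>x y. (x, y) \<in> P \<Longrightarrow> X x = y"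
  proof (rule isometric_extension[OF _ H_closed[OF I] H'_closed[OF parts_pair[OF st]], of P])
    fix x y x' y' assume "(x, y) \<in> P" "(x', y') \<in> P"
    then obtain a a' where e: "elementary s t I x a" "elementary s t I x' a'"
      and y: "y = \<eta>' s t (\<kappa> I a)" "y' = \<eta>' s t (\<kappa> I a')"
      by (auto simp: P_def)
    note a = elementary_mem[OF e(1)] and a' = elementary_mem[OF e(2)]
    have sa': "star a' \<in> A I"
      using a' A_subalgebra[OF I] by (simp add: cstar_subalgebra_def)
    have "\<kappa> I (star a' * a) = star (\<kappa> I a') * \<kappa> I a"
      using \<kappa>_hom[OF I] a a' sa' unfolding star_hom_def by metis
    then have "cinner x x' = \<phi>s s t (star (\<kappa> I a') * \<kappa> I a)"
      using elementary_gram[OF e] by simp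
    also have "\<dots> = cinner y y'"
      using \<eta>'[OF st] \<kappa>_mem[OF I] a a' unfolding y gns_space_def by simp
    finally show "cinner x x' = cinner y y'" .
  next
    have "fst ` P = {x. \<exists>a. elementary s t I x a}"
      by (force simp: P_def)
    then show "total_in (fst ` P) (H I)"
      using elementary_total[OF I] by simp
    show "snd ` P \<subseteq> H' {s, t}"
      using elementary_mem \<eta>'_\<kappa>_mem[OF I] by (auto simp: P_def)
  qed blast
  then show ?thesis
    by (intro exI[of _ X]) (auto simp: P_def)
qed

text \<open>The endpoints are quantified inside the choice so that \<open>X\<close> depends on the
  partition alone, as the parameter \<open>Y\<close> of \<open>hilbert_limit\<close>
  requires.\<close>

definition X :: "real set \<Rightarrow> 'h \<Rightarrow> 'l" where
  "X I = (SOME f. \<forall>s t. I \<in> parts s t \<longrightarrow> isometry_map (H I) (H' {s, t}) f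
     \<and> (\<forall>x a. elementary s t I x a \<longrightarrow> f x = \<eta>' s t (\<kappa> I a)))"

lemma X:
  assumes I: "I \<in> parts s t"
  shows "isometry_map (H I) (H' {s, t}) (X I)" "elementary s t I x a \<Longrightarrow> X I x = \<eta>' s t (\<kappa> I a)"
proof -
  obtain f where "isometry_map (H I) (H' {s, t}) f \<and> (\<forall>x a. elementary s t I x a \<longrightarrow> f x = \<eta>' s t (\<kappa> I a))"
    using X_exists[OF I] by blast
  then have "\<exists>f. \<forall>s t. I \<in> parts s t \<longrightarrow> isometry_map (H I) (H' {s, t}) f
     \<and> (\<forall>x a. elementary s t I x a \<longrightarrow> f x = \<eta>' s t (\<kappa> I a))"
    using parts_unique[OF I] by (intro exI[of _ f]) auto
  from someI_ex[OF this] have "\<forall>s t. I \<in> parts s t \<longrightarrow> isometry_map (H I) (H' {s, t}) (X I)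
     \<and> (\<forall>x a. elementary s t I x a \<longrightarrow> X I x = \<eta>' s t (\<kappa> I a))"
    unfolding X_def .
  with I show "isometry_map (H I) (H' {s, t}) (X I)" "elementary s t I x a \<Longrightarrow> X I x = \<eta>' s t (\<kappa> I a)"
    by auto
qed

lemma X_mem: "I \<in> parts s t \<Longrightarrow> x \<in> H I \<Longrightarrow> X I x \<in> H' {s, t}"
  by (rule isometry_map_mem[OF X(1)])

text \<open>For two elementary tensors this is \<open>V'_\<eta>'\<close>. Boundedness extends it
  first in \<open>x\<close> with \<open>y\<close> elementary, then in \<open>y\<close>.\<close>

lemma X_tensor:
  assumes I: "I \<in> parts r s" and J: "J \<in> parts s t" and x: "x \<in> H I" and y: "y \<in> H J"
  shows "V' r s t (X (I \<union> J) (u I J x y)) = u' {r, s} {s, t} (X I x) (X J y)"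
proof -
  have o: "0 < r" "r < s" "s < t" "0 < s"
    using partsD(1,2)[OF I] partsD(1,2)[OF J] by auto
  note IJ = parts_Un[OF I J]
  note T' = hilbert_tensor_system_pairs[OF H'_system o(1-3)]
  note Vb = isometry_map_bounded[OF V'_isometry[OF o(1-3)]]
  note VX = bounded_clinear_map_compose[OF isometry_map_bounded[OF X(1)[OF IJ]] Vb]
  have 1: "V' r s t (X (I \<union> J) (u I J x y)) = u' {r, s} {s, t} (X I x) (X J y)"
    if y: "elementary s t J y b" and x: "x \<in> H I" for x y b
  proof (rule bounded_clinear_map_eqI[OF
        bounded_clinear_map_compose[OF hilbert_tensor_bounded(2)[OF H_tensor[OF I J]] VX]
        bounded_clinear_map_compose[OF isometry_map_bounded[OF X(1)[OF I]] hilbert_tensor_bounded(2)[OF T']]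
        H_closed[OF I] elementary_total[OF I] _ x])
    show yJ: "y \<in> H J"
      using elementary_mem[OF y] by blast
    show "X J y \<in> H' {s, t}"
      by (rule X_mem[OF J yJ])
    fix x assume "x \<in> {x. \<exists>a. elementary r s I x a}"
    then obtain a where x: "elementary r s I x a" by blast
    show "V' r s t (X (I \<union> J) (u I J x y)) = u' {r, s} {s, t} (X I x) (X J y)"
      unfolding X(2)[OF IJ elementary_tensor[OF y x]] X(2)[OF I x] X(2)[OF J y]
      using elementary_mem[OF x] elementary_mem[OF y] by (intro V'_\<eta>'[OF I J]) auto
  qed
  show ?thesis
  proof (rule bounded_clinear_map_eqI[OF
        bounded_clinear_map_compose[OF hilbert_tensor_bounded(1)[OF H_tensor[OF I J] x] VX]
        bounded_clinear_map_compose[OF isometry_map_bounded[OF X(1)[OF J]]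
          hilbert_tensor_bounded(1)[OF T' X_mem[OF I x]]]
        H_closed[OF J] elementary_total[OF J] _ y])
    fix y assume "y \<in> {y. \<exists>b. elementary s t J y b}"
    then show "V' r s t (X (I \<union> J) (u I J x y)) = u' {r, s} {s, t} (X I x) (X J y)"
      using 1 x by blast
  qed
qed

section \<open>Compatibility of \<open>X\<close> with the connecting maps\<close>

text \<open>The induction step for everything about \<open>W\<close>: the injective map
  \<open>V' r s t\<close> turns the claim for a tensor product of maps into the claims for its
  factors. Membership is carried along because the ranges of the maps \<open>W I J\<close> emerge
  from the same induction.\<close>

lemma X_tensor_operator:
  assumes I: "I \<in> parts r s" and J: "J \<in> parts s t" and I': "I' \<in> parts r s" and J': "J' \<in> parts s t"
    and h: "tensor_operator (H I) (H J) (H (I \<union> J)) (u I J) (H (I' \<union> J')) (u I' J') f g h"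
    and f: "\<And>x. x \<in> H I \<Longrightarrow> f x \<in> H I' \<and> X I' (f x) = X I x"
    and g: "\<And>y. y \<in> H J \<Longrightarrow> g y \<in> H J' \<and> X J' (g y) = X J y"
    and z: "z \<in> H (I \<union> J)"
  shows "h z \<in> H (I' \<union> J') \<and> X (I' \<union> J') (h z) = X (I \<union> J) z"
proof
  have o: "0 < r" "r < s" "s < t" "r < t"
    using partsD(1,2)[OF I] partsD(1,2)[OF J] by auto
  note IJ = parts_Un[OF I J] and IJ' = parts_Un[OF I' J']
  note V' = V'_isometry[OF o(1-3)]
  have hb: "bounded_clinear_map (H (I \<union> J)) (H (I' \<union> J')) h"
    and hu: "\<And>x y. x \<in> H I \<Longrightarrow> y \<in> H J \<Longrightarrow> h (u I J x y) = u I' J' (f x) (g y)"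
    using h by (auto simp: tensor_operator_def)
  note tot = hilbert_tensor_total[OF H_tensor[OF I J] H_closed[OF I] H_closed[OF J] total_in_self total_in_self]
  show hz: "h z \<in> H (I' \<union> J')"
    by (rule bounded_clinear_map_mem[OF hb z])
  have "V' r s t (X (I' \<union> J') (h z)) = V' r s t (X (I \<union> J) z)"
  proof (rule bounded_clinear_map_eqI[OF
        bounded_clinear_map_compose[OF hb bounded_clinear_map_compose[OF
          isometry_map_bounded[OF X(1)[OF IJ']] isometry_map_bounded[OF V']]]
        bounded_clinear_map_compose[OF isometry_map_bounded[OF X(1)[OF IJ]] isometry_map_bounded[OF V']]
        H_closed[OF IJ] tot _ z])
    fix c assume "c \<in> {u I J x y |x y. x \<in> H I \<and> y \<in> H J}"
    then obtain x y where xy: "x \<in> H I" "y \<in> H J" and c: "c = u I J x y"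
      by blast
    show "V' r s t (X (I' \<union> J') (h c)) = V' r s t (X (I \<union> J) c)"
      unfolding c hu[OF xy] X_tensor[OF I J xy]
      using X_tensor[OF I' J', of "f x" "g y"] f[OF xy(1)] g[OF xy(2)] by simp
  qed
  then show "X (I' \<union> J') (h z) = X (I \<union> J) z"
    by (rule isometry_map_injD[OF V' H'_closed[OF parts_pair[OF o(1,4)]] X_mem[OF IJ' hz] X_mem[OF IJ z]])
qed

text \<open>The base case of the recursion, with one interior point. It reflects
  \<open>\<kappa>_\<Delta>\<close>: on the algebra side, \<open>\<Delta>\<close> becomes invisible
  after applying \<open>\<kappa>\<close>.\<close>

lemma X_V:
  assumes o: "0 < r" "r < s" "s < t" and x: "x \<in> H {r, t}"
  shows "X {r, s, t} (V r s t x) = X {r, t} x"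
proof -
  have o': "r < t" "0 < s" using o by auto
  note p = parts_pair[OF o(1,2)] parts_pair[OF o'(2) o(3)]
  note p3 = parts_triple[OF o] and p2 = parts_pair[OF o(1) o'(1)]
  have un: "{r, s} \<union> {s, t} = {r, s, t}" by auto
  obtain E where E: "bounded_clinear_map (A {r, s, t}) (H {r, s, t}) E"
    and E\<tau>: "\<And>a b. a \<in> A {r, s} \<Longrightarrow> b \<in> A {s, t} \<Longrightarrow> E (\<tau> {r, s} {s, t} a b) = u {r, s} {s, t} (\<eta> r s a) (\<eta> s t b)"
    and E\<Delta>: "\<And>a. a \<in> A {r, t} \<Longrightarrow> V r s t (\<eta> r t a) = E (\<Delta> r s t a)"
    using V_\<eta>[OF o] by blast
  \<comment> \<open>\<open>\<Delta> r s t a\<close> need not be elementary, so the formula for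
    \<open>X\<close> is extended from elementary tensors to the whole algebra by
    boundedness.\<close>
  have XE: "X {r, s, t} (E c) = \<eta>' r t (\<kappa> {r, s, t} c)" if c: "c \<in> A {r, s, t}" for c
  proof (rule bounded_clinear_map_eqI[OF
        bounded_clinear_map_compose[OF E isometry_map_bounded[OF X(1)[OF p3]]] \<eta>'_\<kappa>_bounded[OF p3]
        cstar_subalgebra_closed_csubspace[OF A_subalgebra[OF p3]]
        min_tensorD(3)[OF A_tensor[OF p, unfolded un]] _ c])
    fix c assume "c \<in> {\<tau> {r, s} {s, t} a b |a b. a \<in> A {r, s} \<and> b \<in> A {s, t}}"
    then obtain a b where ab: "a \<in> A {r, s}" "b \<in> A {s, t}" and c: "c = \<tau> {r, s} {s, t} a b"
      by blast
    have "elementary r t {r, s, t} (E c) c"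
      using elementary_tensor[OF elementary.pair[OF o'(2) o(3) ab(2)] elementary.pair[OF o(1,2) ab(1)]]
      by (simp only: un c E\<tau>[OF ab])
    then show "X {r, s, t} (E c) = \<eta>' r t (\<kappa> {r, s, t} c)"
      by (rule X(2)[OF p3])
  qed
  show ?thesis
  proof (rule bounded_clinear_map_eqI[OF
        bounded_clinear_map_compose[OF isometry_map_bounded[OF V_isometry[OF o]] isometry_map_bounded[OF X(1)[OF p3]]]
        isometry_map_bounded[OF X(1)[OF p2]] H_closed[OF p2] \<eta>_total[OF o(1) o'(1)] _ x])
    fix y assume "y \<in> \<eta> r t ` A {r, t}"
    then obtain a where a: "a \<in> A {r, t}" and y: "y = \<eta> r t a"
      by blast
    show "X {r, s, t} (V r s t y) = X {r, t} y"
      unfolding y E\<Delta>[OF a] XE[OF \<Delta>_mem[OF o a]] \<kappa>_\<Delta>[OF o a]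
        X(2)[OF p2 elementary.pair[OF o(1) o'(1) a]] ..
  qed
qed

text \<open>Applying \<open>V\<close> splits off the last interval, which \<open>X_V\<close> covers;
  the remaining refinement of the left factor is the induction hypothesis, put together by
  \<open>X_tensor_operator\<close>.\<close>

lemma X_W_pair: "J \<in> parts s t \<Longrightarrow> \<forall>x\<in>H {s, t}. W {s, t} J x \<in> H J \<and> X J (W {s, t} J x) = X {s, t} x"
proof (induction rule: parts_induct)
  case (pair s t)
  then show ?case
    using connecting_isometriesD(1)[OF W] by simp
next
  case (last s p t I)
  have o: "0 < s" "s < p" "p < t" "0 < p"
    using last.hyps partsD(1,2)[OF last.hyps(1)] by auto
  note p = parts_pair[OF o(1,2)] parts_pair[OF o(4,3)]
  have un: "{s, p} \<union> {p, t} = {s, p, t}" by auto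
  note V = isometry_map_mem[OF V_isometry[OF o(1-3)]]
  show ?case
  \<comment> \<open>With three points the connecting map is \<open>V\<close> itself; the recursion
    applies from four points on.\<close>
  proof (cases "I = {s, p}")
    case True
    then have "I \<union> {p, t} = {s, p, t}" by auto
    then show ?thesis
      using connecting_isometriesD(2)[OF W o(1-3)] X_V[OF o(1-3)] V by simp
  next
    case False
    obtain F where F: "tensor_operator (H {s, p}) (H {p, t}) (H {s, p, t}) (u {s, p} {p, t})
            (H (I \<union> {p, t})) (u I {p, t}) (W {s, p} I) id F"
      and WF: "\<And>x. x \<in> H {s, t} \<Longrightarrow> W {s, t} (I \<union> {p, t}) x = F (V s p t x)"
      using connecting_isometriesD(3)[OF W last.hyps False] by blast
    show ?thesis
    proof
      fix x assume x: "x \<in> H {s, t}"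
      have "F (V s p t x) \<in> H (I \<union> {p, t}) \<and> X (I \<union> {p, t}) (F (V s p t x)) = X ({s, p} \<union> {p, t}) (V s p t x)"
        by (rule X_tensor_operator[OF p last.hyps(1) p(2) F[folded un]])
          (use last.IH V[OF x] un in auto)
      then show "W {s, t} (I \<union> {p, t}) x \<in> H (I \<union> {p, t}) \<and> X (I \<union> {p, t}) (W {s, t} (I \<union> {p, t}) x) = X {s, t} x"
        by (simp only: WF[OF x] un X_V[OF o(1-3) x])
    qed
  qed
qed

text \<open>Cutting \<open>J\<close> at the last interior point \<open>p\<close> of the smaller
  partition leaves the induction hypothesis on the left and the refinement of a single interval on
  the right.\<close>

lemma X_W:
  "I \<in> parts s t \<Longrightarrow> \<forall>J\<in>parts s t. I \<subseteq> J \<longrightarrow> (\<forall>x\<in>H I. W I J x \<in> H J \<and> X J (W I J x) = X I x)"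
proof (induction rule: parts_induct)
  case (pair s t)
  then show ?case
    using X_W_pair by blast
next
  case (last s p t I)
  have p: "0 < p" "{p, t} \<in> parts p t" "s < p"
    using last.hyps partsD(1,2)[OF last.hyps(1)] by (auto intro: parts_pair)
  show ?case
  proof (intro ballI impI)
    fix J x assume J: "J \<in> parts s t" "I \<union> {p, t} \<subseteq> J" and x: "x \<in> H (I \<union> {p, t})"
    have "p \<in> J" using J by auto
    note R = parts_restrict[OF J(1) this p(3) last.hyps(2)]
    have sub: "I \<subseteq> J \<inter> {s..p}"
      using J partsD(6,7)[OF last.hyps(1)] by auto
    have h: "tensor_operator (H I) (H {p, t}) (H (I \<union> {p, t})) (u I {p, t})
        (H ((J \<inter> {s..p}) \<union> (J \<inter> {p..t}))) (u (J \<inter> {s..p}) (J \<inter> {p..t}))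
        (W I (J \<inter> {s..p})) (W {p, t} (J \<inter> {p..t})) (W (I \<union> {p, t}) J)"
      unfolding R(3) by (rule connecting_isometriesD(4)[OF W last.hyps(1,2) J])
    have "W (I \<union> {p, t}) J x \<in> H ((J \<inter> {s..p}) \<union> (J \<inter> {p..t}))
        \<and> X ((J \<inter> {s..p}) \<union> (J \<inter> {p..t})) (W (I \<union> {p, t}) J x) = X (I \<union> {p, t}) x"
      by (rule X_tensor_operator[OF last.hyps(1) p(2) R(1,2) h
            last.IH[rule_format, OF R(1) sub] X_W_pair[OF R(2), rule_format] x])
    then show "W (I \<union> {p, t}) J x \<in> H J \<and> X J (W (I \<union> {p, t}) J x) = X (I \<union> {p, t}) x"
      by (simp only: R(3))
  qed
qed

section \<open>Density of the ranges of \<open>X\<close>\<close>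

text \<open>There is no GNS map on \<open>A I\<close> for a general \<open>I\<close> to supply
  preimages. Instead, the range of \<open>X I\<close> is a closed subspace, so elementary tensors
  suffice; for them a preimage is assembled from the factors and recognized after applying
  \<open>V'\<close>.\<close>

lemma \<eta>'_\<kappa>_in_range_X: "I \<in> parts s t \<Longrightarrow> \<forall>a\<in>A I. \<eta>' s t (\<kappa> I a) \<in> X I ` H I"
proof (induction rule: parts_induct)
  case (pair s t)
  show ?case
  proof
    fix a assume a: "a \<in> A {s, t}"
    show "\<eta>' s t (\<kappa> {s, t} a) \<in> X {s, t} ` H {s, t}"
      unfolding X(2)[OF parts_pair[OF pair] elementary.pair[OF pair a], symmetric]
      by (rule imageI[OF \<eta>_mem[OF pair a]])
  qed
next
  case (last s p t I)
  have o: "0 < s" "s < p" "p < t" "0 < p" "s < t"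
    using last.hyps partsD(1,2)[OF last.hyps(1)] by auto
  note p = parts_pair[OF o(4,3)]
  note J = parts_Un[OF last.hyps(1) p]
  show ?case
  proof
    fix c assume c: "c \<in> A (I \<union> {p, t})"
    show "\<eta>' s t (\<kappa> (I \<union> {p, t}) c) \<in> X (I \<union> {p, t}) ` H (I \<union> {p, t})"
    proof (rule total_in_image[OF \<eta>'_\<kappa>_bounded[OF J] cstar_subalgebra_closed_csubspace[OF A_subalgebra[OF J]]
          closed_csubspace_isometry_image[OF X(1)[OF J] H_closed[OF J]]
          min_tensorD(3)[OF A_tensor[OF last.hyps(1) p]] _ c])
      fix c assume "c \<in> {\<tau> I {p, t} a b |a b. a \<in> A I \<and> b \<in> A {p, t}}"
      then obtain a b where ab: "a \<in> A I" "b \<in> A {p, t}" and c: "c = \<tau> I {p, t} a b"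
        by blast
      obtain x where x: "x \<in> H I" "\<eta>' s p (\<kappa> I a) = X I x"
        using last.IH ab(1) by blast
      have b: "\<eta> p t b \<in> H {p, t}" "\<eta>' p t (\<kappa> {p, t} b) = X {p, t} (\<eta> p t b)"
        using \<eta>_mem[OF o(4,3) ab(2)] X(2)[OF p elementary.pair[OF o(4,3) ab(2)]] by auto
      note uxb = u_mem[OF last.hyps(1) p x(1) b(1)]
      have "V' s p t (\<eta>' s t (\<kappa> (I \<union> {p, t}) c)) = V' s p t (X (I \<union> {p, t}) (u I {p, t} x (\<eta> p t b)))"
        unfolding c V'_\<eta>'[OF last.hyps(1) p ab] X_tensor[OF last.hyps(1) p x(1) b(1)] x(2) b(2) ..
      moreover have "c \<in> A (I \<union> {p, t})"
        unfolding c by (rule \<tau>_mem[OF last.hyps(1) p ab])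
      ultimately have "\<eta>' s t (\<kappa> (I \<union> {p, t}) c) = X (I \<union> {p, t}) (u I {p, t} x (\<eta> p t b))"
        using isometry_map_injD[OF V'_isometry[OF o(1-3)] H'_closed[OF parts_pair[OF o(1,5)]]
            \<eta>'_\<kappa>_mem[OF J] X_mem[OF J uxb]] by blast
      then show "\<eta>' s t (\<kappa> (I \<union> {p, t}) c) \<in> X (I \<union> {p, t}) ` H (I \<union> {p, t})"
        using uxb by simp
    qed
  qed
qed

text \<open>Density passes from the images of \<open>\<kappa>\<close> in \<open>As {s, t}\<close> to
  \<open>H' {s, t}\<close> by continuity of \<open>\<eta>'\<close> and density of its range.\<close>

lemma X_dense:
  assumes st: "0 < s" "s < t"
  shows "H' {s, t} \<subseteq> closure (\<Union>I\<in>parts s t. X I ` H I)"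
proof -
  have "\<eta>' s t ` closure (\<Union>I\<in>parts s t. \<kappa> I ` A I) \<subseteq> closure (\<Union>I\<in>parts s t. X I ` H I)"
  proof (rule image_closure_subset)
    show "continuous_on (closure (\<Union>I\<in>parts s t. \<kappa> I ` A I)) (\<eta>' s t)"
      unfolding \<kappa>_dense[OF st]
      by (rule bounded_clinear_map_continuous[OF \<eta>'_bounded[OF st] cstar_subalgebra_closed_csubspace[OF As_subalgebra[OF st]]])
    have "\<eta>' s t ` (\<Union>I\<in>parts s t. \<kappa> I ` A I) \<subseteq> (\<Union>I\<in>parts s t. X I ` H I)"
    proof clarify
      fix I a assume "I \<in> parts s t" "a \<in> A I"
      then show "\<eta>' s t (\<kappa> I a) \<in> (\<Union>I\<in>parts s t. X I ` H I)"
        using \<eta>'_\<kappa>_in_range_X by (intro UN_I) auto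
    qed
    then show "\<eta>' s t ` (\<Union>I\<in>parts s t. \<kappa> I ` A I) \<subseteq> closure (\<Union>I\<in>parts s t. X I ` H I)"
      using closure_subset by (rule subset_trans)
  qed simp
  then have "closure (\<eta>' s t ` As {s, t}) \<subseteq> closure (\<Union>I\<in>parts s t. X I ` H I)"
    unfolding \<kappa>_dense[OF st] by (rule closure_minimal) simp
  then show ?thesis
    using \<eta>'[OF st] unfolding gns_space_def by blast
qed

sublocale hilbert_inductive_system H u W
proof
  show "hilbert_tensor_system H u" by (rule H_system)
  show "W I J x \<in> H J" if "I \<in> parts s t" "J \<in> parts s t" "I \<subseteq> J" "x \<in> H I" for s t I J x
    using X_W[OF that(1)] that(2-4) by blast
qed

sublocale hilbert_limit H u W H' u' V' X
proof
  show "X J (W I J x) = X I x" if "I \<in> parts s t" "J \<in> parts s t" "I \<subseteq> J" "x \<in> H I" for s t I J x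
    using X_W[OF that(1)] that(2-4) by blast
qed (fact H'_system X(1) X_dense V'_isometry X_tensor)+

end

section \<open>The Bhat-Mukherjee dilation as a limit, and the comparison\<close>

text \<open>The range property is a hypothesis about every \<open>W\<close>, because the dilation
  yields its own \<open>W\<close> only inside the proof, while the property itself comes from the
  GNS side through \<open>X_W\<close>.\<close>

lemma bhat_mukherjee_limit:
  assumes dil: "bhat_mukherjee_dilation H u V Hs us Vs" and H: "hilbert_tensor_system H u"
    and W_mem: "\<And>W s t I J x. connecting_isometries H u V W \<Longrightarrow> I \<in> parts s t \<Longrightarrow> J \<in> parts s t
      \<Longrightarrow> I \<subseteq> J \<Longrightarrow> x \<in> H I \<Longrightarrow> W I J x \<in> H J"
  obtains W \<nu> where "connecting_isometries H u V W" "hilbert_limit H u W Hs us Vs \<nu>"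
proof -
  obtain W \<nu> where W: "connecting_isometries H u V W"
    and lim: "\<forall>s t. 0 < s \<and> s < t \<longrightarrow>
               (\<forall>I\<in>parts s t. isometry_map (H I) (Hs {s, t}) (\<nu> I))
               \<and> (\<forall>I\<in>parts s t. \<forall>J\<in>parts s t. I \<subseteq> J \<longrightarrow> (\<forall>x\<in>H I. \<nu> J (W I J x) = \<nu> I x))
               \<and> closure (\<Union>I\<in>parts s t. \<nu> I ` H I) = Hs {s, t}"
    and Vs: "\<forall>r s t. 0 < r \<and> r < s \<and> s < t \<longrightarrow>
               unitary_map (Hs {r, t}) (Hs {r, s, t}) (Vs r s t)
               \<and> (\<forall>I\<in>parts r s. \<forall>J\<in>parts s t.
                    tensor_operator (H I) (H J) (H (I \<union> J)) (u I J) (Hs {r, s, t}) (us {r, s} {s, t})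
                      (\<nu> I) (\<nu> J) (Vs r s t \<circ> \<nu> (I \<union> J)))"
    using dil unfolding bhat_mukherjee_dilation_def by (elim conjE exE)
  have "hilbert_limit H u W Hs us Vs \<nu>"
  proof
    show "hilbert_tensor_system H u" by fact
    show "hilbert_tensor_system Hs us"
      using dil by (simp add: bhat_mukherjee_dilation_def)
    show "W I J x \<in> H J" if "I \<in> parts s t" "J \<in> parts s t" "I \<subseteq> J" "x \<in> H I" for s t I J x
      by (rule W_mem[OF W that])
    show "isometry_map (H I) (Hs {s, t}) (\<nu> I)" if "I \<in> parts s t" for s t I
      using lim partsD(1,2)[OF that] that by blast
    show "\<nu> J (W I J x) = \<nu> I x" if "I \<in> parts s t" "J \<in> parts s t" "I \<subseteq> J" "x \<in> H I" for s t I J x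
      using lim partsD(1,2)[OF that(1)] that by blast
    show "Hs {s, t} \<subseteq> closure (\<Union>I\<in>parts s t. \<nu> I ` H I)" if "0 < s" "s < t" for s t
      using lim that by blast
    show "isometry_map (Hs {r, t}) (Hs {r, s, t}) (Vs r s t)" if "0 < r" "r < s" "s < t" for r s t
      using Vs that unfolding unitary_map_def by blast
    show "Vs r s t (\<nu> (I \<union> J) (u I J x y)) = us {r, s} {s, t} (\<nu> I x) (\<nu> J y)"
      if IJ: "I \<in> parts r s" "J \<in> parts s t" and xy: "x \<in> H I" "y \<in> H J" for r s t I J x y
    proof -
      have "tensor_operator (H I) (H J) (H (I \<union> J)) (u I J) (Hs {r, s, t}) (us {r, s} {s, t})
          (\<nu> I) (\<nu> J) (Vs r s t \<circ> \<nu> (I \<union> J))"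
        using Vs partsD(1,2)[OF IJ(1)] partsD(1,2)[OF IJ(2)] IJ by blast
      then have "(Vs r s t \<circ> \<nu> (I \<union> J)) (u I J x y) = us {r, s} {s, t} (\<nu> I x) (\<nu> J y)"
        using xy unfolding tensor_operator_def by blast
      then show ?thesis by simp
    qed
  qed
  with W show thesis by (rule that)
qed

theorem theorem6p5:
  fixes A :: "real set \<Rightarrow> 'a::cstar_algebra set"
    and \<tau> :: "real set \<Rightarrow> real set \<Rightarrow> 'a \<Rightarrow> 'a \<Rightarrow> 'a"
    and \<Delta> :: "real \<Rightarrow> real \<Rightarrow> real \<Rightarrow> 'a \<Rightarrow> 'a"
    and \<phi> :: "real \<Rightarrow> real \<Rightarrow> 'a \<Rightarrow> complex"
    and H :: "real set \<Rightarrow> 'h::hilbert_space set"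
    and u :: "real set \<Rightarrow> real set \<Rightarrow> 'h \<Rightarrow> 'h \<Rightarrow> 'h"
    and V :: "real \<Rightarrow> real \<Rightarrow> real \<Rightarrow> 'h \<Rightarrow> 'h"
    and Hs :: "real set \<Rightarrow> 'k::hilbert_space set"
    and us :: "real set \<Rightarrow> real set \<Rightarrow> 'k \<Rightarrow> 'k \<Rightarrow> 'k"
    and Vs :: "real \<Rightarrow> real \<Rightarrow> real \<Rightarrow> 'k \<Rightarrow> 'k"
    and As :: "real set \<Rightarrow> 'b::cstar_algebra set"
    and \<tau>s :: "real set \<Rightarrow> real set \<Rightarrow> 'b \<Rightarrow> 'b \<Rightarrow> 'b"
    and \<Delta>s :: "real \<Rightarrow> real \<Rightarrow> real \<Rightarrow> 'b \<Rightarrow> 'b"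
    and \<kappa> :: "real set \<Rightarrow> 'a \<Rightarrow> 'b"
    and \<phi>s :: "real \<Rightarrow> real \<Rightarrow> 'b \<Rightarrow> complex"
    and H' :: "real set \<Rightarrow> 'l::hilbert_space set"
    and u' :: "real set \<Rightarrow> real set \<Rightarrow> 'l \<Rightarrow> 'l \<Rightarrow> 'l"
    and V' :: "real \<Rightarrow> real \<Rightarrow> real \<Rightarrow> 'l \<Rightarrow> 'l"
  assumes "cstar_subproduct_system A \<tau> \<Delta>"
    and "counit A \<tau> \<Delta> \<phi>"
    and "associated_system A \<tau> \<Delta> \<phi> H u V"
    and "bhat_mukherjee_dilation H u V Hs us Vs"
    and "inductive_dilation A \<tau> \<Delta> As \<tau>s \<Delta>s \<kappa>"
    and "counit_dilation A \<phi> As \<tau>s \<Delta>s \<kappa> \<phi>s"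
    and "associated_system As \<tau>s \<Delta>s \<phi>s H' u' V'"
  shows "tsirelson_product_system H' u' V' \<and> tsirelson_product_system Hs us Vs
    \<and> tsirelson_isomorphic H' u' V' Hs us Vs"
proof -
  note sub = assms(1)[unfolded cstar_subproduct_system_def]
  note A = cstar_tensor_systemD[OF sub[THEN conjunct1]]
  note ass = assms(3)[unfolded associated_system_def]
  note ass' = assms(7)[unfolded associated_system_def]
  note dil = assms(5)[unfolded inductive_dilation_def]
  note As = cstar_tensor_systemD[OF dil[THEN conjunct1]]
  note codil = assms(6)[unfolded counit_dilation_def]
  note coun = codil[THEN conjunct1, unfolded counit_def]
  obtain \<eta> where \<eta>: "\<forall>s t. 0 < s \<and> s < t \<longrightarrow> gns_space (A {s, t}) (\<phi> s t) (H {s, t}) (\<eta> s t)"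
    and V: "\<forall>r s t. 0 < r \<and> r < s \<and> s < t \<longrightarrow>
              isometry_map (H {r, t}) (H {r, s, t}) (V r s t)
              \<and> (\<exists>\<omega> E. tensor_functional (A {r, s}) (A {s, t}) (A {r, s, t}) (\<tau> {r, s} {s, t}) (\<phi> r s) (\<phi> s t) \<omega>
                     \<and> gns_space (A {r, s, t}) \<omega> (H {r, s, t}) E
                     \<and> (\<forall>x\<in>A {r, s}. \<forall>y\<in>A {s, t}.
                          E (\<tau> {r, s} {s, t} x y) = u {r, s} {s, t} (\<eta> r s x) (\<eta> s t y))
                     \<and> (\<forall>x\<in>A {r, t}. V r s t (\<eta> r t x) = E (\<Delta> r s t x)))"
    using ass[THEN conjunct2] by (elim exE conjE)
  obtain \<eta>' where \<eta>': "\<forall>s t. 0 < s \<and> s < t \<longrightarrow> gns_space (As {s, t}) (\<phi>s s t) (H' {s, t}) (\<eta>' s t)"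
    and V': "\<forall>r s t. 0 < r \<and> r < s \<and> s < t \<longrightarrow>
              isometry_map (H' {r, t}) (H' {r, s, t}) (V' r s t)
              \<and> (\<exists>\<omega> E. tensor_functional (As {r, s}) (As {s, t}) (As {r, s, t}) (\<tau>s {r, s} {s, t}) (\<phi>s r s) (\<phi>s s t) \<omega>
                     \<and> gns_space (As {r, s, t}) \<omega> (H' {r, s, t}) E
                     \<and> (\<forall>x\<in>As {r, s}. \<forall>y\<in>As {s, t}.
                          E (\<tau>s {r, s} {s, t} x y) = u' {r, s} {s, t} (\<eta>' r s x) (\<eta>' s t y))
                     \<and> (\<forall>x\<in>As {r, t}. V' r s t (\<eta>' r t x) = E (\<Delta>s r s t x)))"
    using ass'[THEN conjunct2] by (elim exE conjE)
  obtain D where D: "connecting_homs A \<tau> \<Delta> D"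
    and lim: "\<forall>s t. 0 < s \<and> s < t \<longrightarrow>
               (\<forall>I\<in>parts s t. star_mono (A I) (As {s, t}) (\<kappa> I))
               \<and> (\<forall>I\<in>parts s t. \<forall>J\<in>parts s t. I \<subseteq> J \<longrightarrow> (\<forall>x\<in>A I. \<kappa> J (D I J x) = \<kappa> I x))
               \<and> closure (\<Union>I\<in>parts s t. \<kappa> I ` A I) = As {s, t}"
    using dil[THEN conjunct2, THEN conjunct1] by (elim exE conjE)
  note \<Delta>s = dil[THEN conjunct2, THEN conjunct2]
  have \<kappa>_hom: "star_hom (A I) (As {s, t}) (\<kappa> I)" if "I \<in> parts s t" for s t I
    using lim partsD(1,2)[OF that] that unfolding star_mono_def by blast
  have \<kappa>_mem: "\<kappa> I a \<in> As {s, t}" if "I \<in> parts s t" "a \<in> A I" for s t I a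
    using \<kappa>_hom[OF that(1)] that(2) unfolding star_hom_def clinear_map_def by blast
  \<comment> \<open>This evaluation of \<open>\<Delta>s\<close> is what reduces the co-unit identity
    and the formula for \<open>V'\<close> to statements about \<open>\<kappa>\<close>.\<close>
  have \<Delta>s_\<kappa>: "\<Delta>s r s t (\<kappa> (I \<union> J) (\<tau> I J a b)) = \<tau>s {r, s} {s, t} (\<kappa> I a) (\<kappa> J b)"
    if IJ: "I \<in> parts r s" "J \<in> parts s t" and ab: "a \<in> A I" "b \<in> A J" for r s t I J a b
  proof -
    have "tensor_hom (A I) (A J) (A (I \<union> J)) (\<tau> I J) (As {r, s, t}) (\<tau>s {r, s} {s, t})
        (\<kappa> I) (\<kappa> J) (\<Delta>s r s t \<circ> \<kappa> (I \<union> J))"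
      using \<Delta>s partsD(1,2)[OF IJ(1)] partsD(1,2)[OF IJ(2)] IJ by blast
    then have "(\<Delta>s r s t \<circ> \<kappa> (I \<union> J)) (\<tau> I J a b) = \<tau>s {r, s} {s, t} (\<kappa> I a) (\<kappa> J b)"
      using ab unfolding tensor_hom_def by blast
    then show ?thesis by simp
  qed
  have \<kappa>\<tau>_mem: "\<kappa> (I \<union> J) (\<tau> I J a b) \<in> As {r, t}"
    if "I \<in> parts r s" "J \<in> parts s t" "a \<in> A I" "b \<in> A J" for r s t I J a b
    by (rule \<kappa>_mem[OF parts_Un[OF that(1,2)] min_tensorD(1)[OF A(2)[OF that(1,2)] that(3,4)]])
  have \<phi>s_bounded: "bounded_functional (As {s, t}) (\<phi>s s t)" if "0 < s" "s < t" for s t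
    using coun[THEN conjunct1] that unfolding state_def by blast
  have \<Delta>_mem: "\<Delta> r s t a \<in> A {r, s, t}" if "0 < r" "r < s" "s < t" "a \<in> A {r, t}" for r s t a
  proof -
    have "star_mono (A {r, t}) (A {r, s, t}) (\<Delta> r s t)"
      using sub that by blast
    then show ?thesis
      using that(4) unfolding star_mono_def star_hom_def clinear_map_def by blast
  qed
  have \<kappa>_\<Delta>: "\<kappa> {r, s, t} (\<Delta> r s t a) = \<kappa> {r, t} a" if o: "0 < r" "r < s" "s < t" and a: "a \<in> A {r, t}" for r s t a
  proof -
    have p: "{r, t} \<in> parts r t" "{r, s, t} \<in> parts r t" "{r, t} \<subseteq> {r, s, t}"
      using o by (auto intro: parts_pair parts_triple)
    have "D {r, t} {r, s, t} a = \<Delta> r s t a"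
      using D[unfolded connecting_homs_def, THEN conjunct2, THEN conjunct1] o a by blast
    moreover have "\<kappa> {r, s, t} (D {r, t} {r, s, t} a) = \<kappa> {r, t} a"
      using lim partsD(1,2)[OF p(1)] p a by blast
    ultimately show ?thesis by simp
  qed
  \<comment> \<open>The co-unit identity on \<open>As\<close> stands in for a product state on
    \<open>A (I \<union> J)\<close>: the functional \<open>\<omega>\<close> involves only two
    factors, however fine the partitions are.\<close>
  have \<phi>s_\<tau>: "\<phi>s r t (\<kappa> (I \<union> J) (\<tau> I J a b)) = \<phi>s r s (\<kappa> I a) * \<phi>s s t (\<kappa> J b)"
    if IJ: "I \<in> parts r s" "J \<in> parts s t" and ab: "a \<in> A I" "b \<in> A J" for r s t I J a b
  proof -
    obtain \<omega> where \<omega>: "tensor_functional (As {r, s}) (As {s, t}) (As {r, s, t}) (\<tau>s {r, s} {s, t}) (\<phi>s r s) (\<phi>s s t) \<omega>"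
      "\<forall>x\<in>As {r, t}. \<phi>s r t x = \<omega> (\<Delta>s r s t x)"
      using coun[THEN conjunct2] partsD(1,2)[OF IJ(1)] partsD(1,2)[OF IJ(2)] by blast
    have "\<phi>s r t (\<kappa> (I \<union> J) (\<tau> I J a b)) = \<omega> (\<tau>s {r, s} {s, t} (\<kappa> I a) (\<kappa> J b))"
      using \<omega>(2) \<kappa>\<tau>_mem[OF IJ ab] by (simp add: \<Delta>s_\<kappa>[OF IJ ab])
    also have "\<dots> = \<phi>s r s (\<kappa> I a) * \<phi>s s t (\<kappa> J b)"
      using \<omega>(1) \<kappa>_mem[OF IJ(1) ab(1)] \<kappa>_mem[OF IJ(2) ab(2)] unfolding tensor_functional_def by blast
    finally show ?thesis .
  qed
  have V_\<eta>: "\<exists>E. bounded_clinear_map (A {r, s, t}) (H {r, s, t}) E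
        \<and> (\<forall>a\<in>A {r, s}. \<forall>b\<in>A {s, t}. E (\<tau> {r, s} {s, t} a b) = u {r, s} {s, t} (\<eta> r s a) (\<eta> s t b))
        \<and> (\<forall>a\<in>A {r, t}. V r s t (\<eta> r t a) = E (\<Delta> r s t a))"
    if o: "0 < r" "r < s" "s < t" for r s t
  proof -
    obtain \<omega> E where \<omega>: "tensor_functional (A {r, s}) (A {s, t}) (A {r, s, t}) (\<tau> {r, s} {s, t}) (\<phi> r s) (\<phi> s t) \<omega>"
      and E: "gns_space (A {r, s, t}) \<omega> (H {r, s, t}) E"
      and "\<forall>a\<in>A {r, s}. \<forall>b\<in>A {s, t}. E (\<tau> {r, s} {s, t} a b) = u {r, s} {s, t} (\<eta> r s a) (\<eta> s t b)"
        "\<forall>a\<in>A {r, t}. V r s t (\<eta> r t a) = E (\<Delta> r s t a)"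
      using V o by blast
    moreover have "bounded_clinear_map (A {r, s, t}) (H {r, s, t}) E"
      using \<omega> by (intro gns_space_bounded[OF E] A(1)[OF parts_triple[OF o]]) (simp add: tensor_functional_def)
    ultimately show ?thesis by blast
  qed
  have V'_\<eta>': "V' r s t (\<eta>' r t (\<kappa> (I \<union> J) (\<tau> I J a b))) = u' {r, s} {s, t} (\<eta>' r s (\<kappa> I a)) (\<eta>' s t (\<kappa> J b))"
    if IJ: "I \<in> parts r s" "J \<in> parts s t" and ab: "a \<in> A I" "b \<in> A J" for r s t I J a b
  proof -
    obtain E where E: "\<forall>x\<in>As {r, s}. \<forall>y\<in>As {s, t}. E (\<tau>s {r, s} {s, t} x y) = u' {r, s} {s, t} (\<eta>' r s x) (\<eta>' s t y)"
      "\<forall>x\<in>As {r, t}. V' r s t (\<eta>' r t x) = E (\<Delta>s r s t x)"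
      using V' partsD(1,2)[OF IJ(1)] partsD(1,2)[OF IJ(2)] by blast
    have "V' r s t (\<eta>' r t (\<kappa> (I \<union> J) (\<tau> I J a b))) = E (\<tau>s {r, s} {s, t} (\<kappa> I a) (\<kappa> J b))"
      using E(2) \<kappa>\<tau>_mem[OF IJ ab] by (simp add: \<Delta>s_\<kappa>[OF IJ ab])
    also have "\<dots> = u' {r, s} {s, t} (\<eta>' r s (\<kappa> I a)) (\<eta>' s t (\<kappa> J b))"
      using E(1) \<kappa>_mem[OF IJ(1) ab(1)] \<kappa>_mem[OF IJ(2) ab(2)] by blast
    finally show ?thesis .
  qed
  \<comment> \<open>Kept open in \<open>W\<close>, since it is used twice: for an arbitrary
    \<open>W\<close>, to show that its values lie in the right spaces, and for the one taken from
    the Bhat-Mukherjee dilation, so that both limits run over the same system.\<close>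
  have dilated: "dilated_counit A \<tau> \<Delta> \<phi> H u V W \<eta> As \<kappa> \<phi>s H' u' V' \<eta>'"
    if W: "connecting_isometries H u V W" for W
  proof (rule dilated_counit.intro)
    show "cstar_tensor_system A \<tau>"
      by (rule sub[THEN conjunct1])
    show "hilbert_tensor_system H u"
      by (rule ass[THEN conjunct1])
    show "hilbert_tensor_system H' u'"
      by (rule ass'[THEN conjunct1])
    show "connecting_isometries H u V W"
      by (rule W)
    fix s t :: real assume st: "0 < s" "s < t"
    show "cstar_subalgebra (As {s, t})"
      by (rule As(1)[OF parts_pair[OF st]])
    show "gns_space (A {s, t}) (\<phi> s t) (H {s, t}) (\<eta> s t)"
      using \<eta> st by blast
    show "gns_space (As {s, t}) (\<phi>s s t) (H' {s, t}) (\<eta>' s t)"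
      using \<eta>' st by blast
    show "bounded_functional (As {s, t}) (\<phi>s s t)"
      by (rule \<phi>s_bounded[OF st])
    show "closure (\<Union>I\<in>parts s t. \<kappa> I ` A I) = As {s, t}"
      by (rule lim[THEN spec, THEN spec, THEN mp, OF conjI[OF st], THEN conjunct2, THEN conjunct2])
    show "\<phi>s s t (\<kappa> {s, t} a) = \<phi> s t a" if "a \<in> A {s, t}" for a
      by (rule codil[THEN conjunct2, rule_format, OF conjI[OF st] that])
  next
    fix r s t :: real assume o: "0 < r" "r < s" "s < t"
    show "isometry_map (H {r, t}) (H {r, s, t}) (V r s t)"
      using V o by blast
    show "isometry_map (H' {r, t}) (H' {r, s, t}) (V' r s t)"
      using V' o by blast
  qed (rule V_\<eta> V'_\<eta>' \<kappa>_hom \<Delta>_mem \<kappa>_\<Delta> \<phi>s_\<tau>; assumption)+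
  obtain W \<nu> where W: "connecting_isometries H u V W" and \<nu>: "hilbert_limit H u W Hs us Vs \<nu>"
  proof (rule bhat_mukherjee_limit[OF assms(4) ass[THEN conjunct1]])
    fix W s t I J x
    assume "connecting_isometries H u V W" and IJ: "I \<in> parts s t" "J \<in> parts s t" "I \<subseteq> J" "x \<in> H I"
    then interpret dilated_counit A \<tau> \<Delta> \<phi> H u V W \<eta> As \<kappa> \<phi>s H' u' V' \<eta>'
      by (intro dilated)
    show "W I J x \<in> H J"
      by (rule W_mem[OF IJ])
  qed
  interpret X: dilated_counit A \<tau> \<Delta> \<phi> H u V W \<eta> As \<kappa> \<phi>s H' u' V' \<eta>'
    by (rule dilated[OF W])
  show ?thesis
    using X.tsirelson_product_system_limit hilbert_limit.tsirelson_product_system_limit[OF \<nu>]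
      hilbert_limits_isomorphic[OF X.hilbert_limit_axioms \<nu>] by blast
qed

end
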